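(* The limit space $\mathfrak h_\infty=\lim_{g\to\infty}\mathfrak h_g$ is an infinite dimensional Hermitian symmetric space.
   Context: For $g\ge1$, $\mathfrak h_g=\{X+iY : X,Y\text{ real symmetric } g\times g\text{ matrices},\ Y>0\}$ is the Siegel upper half space, a Hermitian symmetric space of noncompact type equal to $Sp(2g,\mathbb R)/U(g)$. Embed $\mathfrak h_g\hookrightarrow\mathfrak h_{g+1}$, as a totally geodesic subspace, by $X+iY\mapsto\begin{pmatrix}X&0\\0&0\end{pmatrix}+i\begin{pmatrix}Y&0\\0&1\end{pmatrix}$. Then $\mathfrak h_\infty$ is the direct limit with its natural topology. It is an infinite dimensional smooth manifold locally modelled on $\mathbb C^\infty$, the space of finite complex sequences with the finite (direct limit) topology. Concretely, $$\mathfrak h_\infty=\left\{\begin{pmatrix}X&0\\0&0\end{pmatrix}+i\begin{pmatrix}Y&0\\0&I_\infty\end{pmatrix} : X,Y\ \text{symmetric } g\times g\text{ matrices for some } g,\ Y>0\right\}.$$ The invariant Hermitian metrics on the $\mathfrak h_g$ are normalized compatibly with the embeddings. Being Hermitian symmetric means that every point of $\mathfrak h_\infty$ is an isolated fixed point of an involutive holomorphic isometry of $\mathfrak h_\infty$. *)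

theory Defs
  imports
    "HOL-Analysis.Function_Topology"
    "HOL-Analysis.T1_Spaces"
    "HOL-Analysis.Derivative"
    "HOL-Library.Extended_Nat"
    "HOL-Library.Nat_Bijection"
    "Jordan_Normal_Form.Gauss_Jordan_Elimination"
begin

section \<open>Direct limit topologies and the model spaces\<close>

(* The direct limit of an increasing sequence of subspaces of an ambient space: a set is open
   iff its trace on every member of the sequence is open there. *)
definition direct_limit_topology :: "(nat \<Rightarrow> 'a::topological_space set) \<Rightarrow> 'a topology" where
  "direct_limit_topology S = topology (\<lambda>U. U \<subseteq> (\<Union>n. S n) \<and> (\<forall>n. openin (top_of_set (S n)) (U \<inter> S n)))"

lemma openin_direct_limit_topology:
  "openin (direct_limit_topology S) U \<longleftrightarrow>
     U \<subseteq> (\<Union>n. S n) \<and> (\<forall>n. openin (top_of_set (S n)) (U \<inter> S n))"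
proof -
  have "istopology (\<lambda>U. U \<subseteq> (\<Union>n. S n) \<and> (\<forall>n. openin (top_of_set (S n)) (U \<inter> S n)))"
    unfolding istopology_def
  proof (rule conjI; intro allI impI conjI)
    fix U V n
    assume U: "U \<subseteq> (\<Union>n. S n) \<and> (\<forall>n. openin (top_of_set (S n)) (U \<inter> S n))"
      and V: "V \<subseteq> (\<Union>n. S n) \<and> (\<forall>n. openin (top_of_set (S n)) (V \<inter> S n))"
    show "U \<inter> V \<subseteq> (\<Union>n. S n)"
      by (rule le_infI1 [OF U [THEN conjunct1]])
    have "openin (top_of_set (S n)) ((U \<inter> S n) \<inter> (V \<inter> S n))"
      by (rule openin_Int [OF U [THEN conjunct2, THEN spec] V [THEN conjunct2, THEN spec]])
    moreover have "(U \<inter> S n) \<inter> (V \<inter> S n) = U \<inter> V \<inter> S n"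
      by blast
    ultimately show "openin (top_of_set (S n)) (U \<inter> V \<inter> S n)"
      by simp
  next
    fix K n
    assume K: "\<forall>U\<in>K. U \<subseteq> (\<Union>n. S n) \<and> (\<forall>n. openin (top_of_set (S n)) (U \<inter> S n))"
    show "\<Union>K \<subseteq> (\<Union>n. S n)"
      by (rule Union_least) (rule K [THEN bspec, THEN conjunct1])
    have "openin (top_of_set (S n)) (\<Union>U\<in>K. U \<inter> S n)"
    proof (rule openin_Union)
      fix T
      assume "T \<in> (\<lambda>U. U \<inter> S n) ` K"
      then obtain U where "U \<in> K" and T: "T = U \<inter> S n"
        by (rule imageE)
      show "openin (top_of_set (S n)) T"
        unfolding T by (rule K [THEN bspec, OF \<open>U \<in> K\<close>, THEN conjunct2, THEN spec])
    qed
    moreover have "(\<Union>U\<in>K. U \<inter> S n) = \<Union>K \<inter> S n"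
      by blast
    ultimately show "openin (top_of_set (S n)) (\<Union>K \<inter> S n)"
      by simp
  qed
  then show ?thesis
    unfolding direct_limit_topology_def by (simp add: topology_inverse')
qed

lemma topspace_direct_limit_topology: "topspace (direct_limit_topology S) = (\<Union>n. S n)"
proof
  show "topspace (direct_limit_topology S) \<subseteq> (\<Union>n. S n)"
    by (rule openin_direct_limit_topology [THEN iffD1, OF openin_topspace, THEN conjunct1])
  have "(\<Union>n. S n) \<inter> S n = S n" for n
    by blast
  then have "openin (direct_limit_topology S) (\<Union>n. S n)"
    by (simp add: openin_direct_limit_topology)
  then show "(\<Union>n. S n) \<subseteq> topspace (direct_limit_topology S)"
    by (rule openin_subset)
qed

definition cseq :: "nat \<Rightarrow> (nat \<Rightarrow> complex) set" where
  "cseq n = {v. \<forall>k\<ge>n. v k = 0}"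

(* The model space C^N: for finite N the Euclidean space of dimension N, for N = \<infinity> the space
   of finite complex sequences with the direct limit topology. *)
definition model_top :: "enat \<Rightarrow> (nat \<Rightarrow> complex) topology" where
  "model_top N = (case N of enat n \<Rightarrow> top_of_set (cseq n) | \<infinity> \<Rightarrow> direct_limit_topology cseq)"

abbreviation model :: "enat \<Rightarrow> (nat \<Rightarrow> complex) set" where
  "model N \<equiv> topspace (model_top N)"

lemma model_enat: "model (enat n) = cseq n"
  by (simp add: model_top_def)

lemma model_infinity: "model \<infinity> = {v. finite {k. v k \<noteq> 0}}"
proof -
  have "model \<infinity> = (\<Union>n. cseq n)"
    by (simp add: model_top_def topspace_direct_limit_topology)
  also have "\<dots> = {v. finite {k. v k \<noteq> 0}}"
  proof (rule Set.set_eqI)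
    fix v :: "nat \<Rightarrow> complex"
    have "(\<forall>k\<ge>n. v k = 0) \<longleftrightarrow> (\<forall>k\<in>{k. v k \<noteq> 0}. k < n)" for n
      by (simp only: Ball_def mem_Collect_eq not_le [symmetric]) blast
    then show "v \<in> (\<Union>n. cseq n) \<longleftrightarrow> v \<in> {v. finite {k. v k \<noteq> 0}}"
      by (simp only: cseq_def UN_iff mem_Collect_eq finite_nat_set_iff_bounded bex_UNIV)
  qed
  finally show ?thesis .
qed


section \<open>Holomorphic maps and smooth functions on open subsets of the model spaces\<close>

definition has_gateaux_deriv ::
  "enat \<Rightarrow> ((nat \<Rightarrow> complex) \<Rightarrow> nat \<Rightarrow> complex) \<Rightarrow> (nat \<Rightarrow> complex) \<Rightarrow> (nat \<Rightarrow> complex) \<Rightarrow>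
   (nat \<Rightarrow> complex) \<Rightarrow> bool" where
  "has_gateaux_deriv M f x v d \<longleftrightarrow>
     limitin (model_top M) (\<lambda>t::complex. \<lambda>k. (f (\<lambda>j. x j + t * v j) k - f x k) / t) d (at 0)"

definition gateaux_deriv ::
  "enat \<Rightarrow> ((nat \<Rightarrow> complex) \<Rightarrow> nat \<Rightarrow> complex) \<Rightarrow> (nat \<Rightarrow> complex) \<Rightarrow> (nat \<Rightarrow> complex) \<Rightarrow>
   nat \<Rightarrow> complex" where
  "gateaux_deriv M f x v = (THE d. has_gateaux_deriv M f x v d)"

(* Holomorphy between locally convex spaces: continuous and complex Gateaux differentiable.
   The set W is meant to be open in the model space C^N. *)
definition holomorphic_map ::
  "enat \<Rightarrow> enat \<Rightarrow> (nat \<Rightarrow> complex) set \<Rightarrow> ((nat \<Rightarrow> complex) \<Rightarrow> nat \<Rightarrow> complex) \<Rightarrow> bool" where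
  "holomorphic_map N M W f \<longleftrightarrow>
     continuous_map (subtopology (model_top N) W) (model_top M) f \<and>
     (\<forall>x\<in>W. \<forall>v\<in>model N. \<exists>d. has_gateaux_deriv M f x v d)"

(* Smoothness in the real sense: all iterated real directional derivatives exist and are
   continuous on W (open in C^N). For finite N these include all iterated partial derivatives in
   the real coordinates; for N = \<infinity> the condition amounts to smoothness on each W \<inter> C^n, i.e. to
   smoothness for the direct limit structure. *)
coinductive smooth_fun ::
  "enat \<Rightarrow> (nat \<Rightarrow> complex) set \<Rightarrow> ((nat \<Rightarrow> complex) \<Rightarrow> complex) \<Rightarrow> bool"
  for N :: enat and W :: "(nat \<Rightarrow> complex) set" where
  "\<lbrakk>continuous_map (subtopology (model_top N) W) euclidean f;
    \<forall>v\<in>model N. \<exists>f'.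
      (\<forall>x\<in>W. ((\<lambda>t::real. f (\<lambda>j. x j + of_real t * v j)) has_vector_derivative f' x) (at 0)) \<and>
      smooth_fun N W f'\<rbrakk>
   \<Longrightarrow> smooth_fun N W f"


section \<open>Complex manifolds modelled on \<open>C\<^sup>N\<close>, Hermitian metrics, Hermitian symmetric spaces\<close>

type_synonym 'a chart = "'a set \<times> ('a \<Rightarrow> nat \<Rightarrow> complex)"

record 'a cmanifold =
  mfd_dim :: enat
  mfd_top :: "'a topology"
  mfd_atlas :: "'a chart set"

definition complex_manifold :: "'a cmanifold \<Rightarrow> bool" where
  "complex_manifold X \<longleftrightarrow>
     Hausdorff_space (mfd_top X) \<and>
     (\<Union>(U, \<phi>)\<in>mfd_atlas X. U) = topspace (mfd_top X) \<and>
     (\<forall>(U, \<phi>)\<in>mfd_atlas X.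
        openin (mfd_top X) U \<and>
        openin (model_top (mfd_dim X)) (\<phi> ` U) \<and>
        homeomorphic_map (subtopology (mfd_top X) U)
          (subtopology (model_top (mfd_dim X)) (\<phi> ` U)) \<phi>) \<and>
     (\<forall>(U, \<phi>)\<in>mfd_atlas X. \<forall>(V, \<psi>)\<in>mfd_atlas X.
        holomorphic_map (mfd_dim X) (mfd_dim X) (\<phi> ` (U \<inter> V)) (\<psi> \<circ> inv_into U \<phi>))"

definition mfd_holomorphic :: "'a cmanifold \<Rightarrow> 'b cmanifold \<Rightarrow> ('a \<Rightarrow> 'b) \<Rightarrow> bool" where
  "mfd_holomorphic X Y F \<longleftrightarrow>
     continuous_map (mfd_top X) (mfd_top Y) F \<and>
     (\<forall>(U, \<phi>)\<in>mfd_atlas X. \<forall>(V, \<psi>)\<in>mfd_atlas Y.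
        holomorphic_map (mfd_dim X) (mfd_dim Y) (\<phi> ` {p \<in> U. F p \<in> V}) (\<psi> \<circ> F \<circ> inv_into U \<phi>))"

(* G c p v w is the inner product at the point p of the two tangent vectors whose components in
   the chart c are v and w. *)
type_synonym 'a metric =
  "'a chart \<Rightarrow> 'a \<Rightarrow> (nat \<Rightarrow> complex) \<Rightarrow> (nat \<Rightarrow> complex) \<Rightarrow> complex"

definition metric_preserving ::
  "'a cmanifold \<Rightarrow> 'a metric \<Rightarrow> 'b cmanifold \<Rightarrow> 'b metric \<Rightarrow> ('a \<Rightarrow> 'b) \<Rightarrow> bool" where
  "metric_preserving X G Y H F \<longleftrightarrow>
     (\<forall>(U, \<phi>)\<in>mfd_atlas X. \<forall>(V, \<psi>)\<in>mfd_atlas Y. \<forall>p\<in>U. F p \<in> V \<longrightarrow>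
        (\<forall>v\<in>model (mfd_dim X). \<forall>w\<in>model (mfd_dim X).
           let D = gateaux_deriv (mfd_dim Y) (\<psi> \<circ> F \<circ> inv_into U \<phi>) (\<phi> p)
           in H (V, \<psi>) (F p) (D v) (D w) = G (U, \<phi>) p v w))"

(* The last condition says that the coordinate expressions of G in different charts agree. Since
   G is sesquilinear, smoothness for fixed v and w is smoothness of the metric tensor. *)
definition hermitian_metric :: "'a cmanifold \<Rightarrow> 'a metric \<Rightarrow> bool" where
  "hermitian_metric X G \<longleftrightarrow>
     (\<forall>(U, \<phi>)\<in>mfd_atlas X.
        (\<forall>p\<in>U. \<forall>u\<in>model (mfd_dim X). \<forall>v\<in>model (mfd_dim X). \<forall>w\<in>model (mfd_dim X). \<forall>a b.
           G (U, \<phi>) p (\<lambda>k. a * u k + b * v k) w = a * G (U, \<phi>) p u w + b * G (U, \<phi>) p v w) \<and>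
        (\<forall>p\<in>U. \<forall>v\<in>model (mfd_dim X). \<forall>w\<in>model (mfd_dim X).
           G (U, \<phi>) p w v = cnj (G (U, \<phi>) p v w)) \<and>
        (\<forall>p\<in>U. \<forall>v\<in>model (mfd_dim X). v \<noteq> (\<lambda>k. 0) \<longrightarrow> 0 < Re (G (U, \<phi>) p v v)) \<and>
        (\<forall>v\<in>model (mfd_dim X). \<forall>w\<in>model (mfd_dim X).
           smooth_fun (mfd_dim X) (\<phi> ` U) (\<lambda>x. G (U, \<phi>) (inv_into U \<phi> x) v w))) \<and>
     metric_preserving X G X G (\<lambda>p. p)"

definition holomorphic_isometry :: "'a cmanifold \<Rightarrow> 'a metric \<Rightarrow> ('a \<Rightarrow> 'a) \<Rightarrow> bool" where
  "holomorphic_isometry X G F \<longleftrightarrow>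
     bij_betw F (topspace (mfd_top X)) (topspace (mfd_top X)) \<and>
     mfd_holomorphic X X F \<and>
     mfd_holomorphic X X (inv_into (topspace (mfd_top X)) F) \<and>
     metric_preserving X G X G F"

definition isolated_fixed_point :: "'a topology \<Rightarrow> ('a \<Rightarrow> 'a) \<Rightarrow> 'a \<Rightarrow> bool" where
  "isolated_fixed_point T F p \<longleftrightarrow>
     F p = p \<and> (\<exists>U. openin T U \<and> p \<in> U \<and> (\<forall>q\<in>U. F q = q \<longrightarrow> q = p))"

definition hermitian_symmetric_space :: "'a cmanifold \<Rightarrow> 'a metric \<Rightarrow> bool" where
  "hermitian_symmetric_space X G \<longleftrightarrow>
     complex_manifold X \<and> hermitian_metric X G \<and>
     (\<forall>p\<in>topspace (mfd_top X). \<exists>F.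
        holomorphic_isometry X G F \<and>
        (\<forall>q\<in>topspace (mfd_top X). F (F q) = q) \<and>
        isolated_fixed_point (mfd_top X) F p)"

definition infinite_dimensional :: "'a cmanifold \<Rightarrow> bool" where
  "infinite_dimensional X \<longleftrightarrow> mfd_dim X = \<infinity>"


section \<open>Siegel upper half spaces and their limit\<close>

definition pos_def_mat :: "nat \<Rightarrow> real mat \<Rightarrow> bool" where
  "pos_def_mat g Y \<longleftrightarrow> (\<forall>v\<in>carrier_vec g. v \<noteq> 0\<^sub>v g \<longrightarrow> 0 < v \<bullet> (Y *\<^sub>v v))"

definition siegel :: "nat \<Rightarrow> complex mat set" where
  "siegel g = {map_mat complex_of_real X + \<i> \<cdot>\<^sub>m map_mat complex_of_real Y | X Y.
     X \<in> carrier_mat g g \<and> Y \<in> carrier_mat g g \<and>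
     transpose_mat X = X \<and> transpose_mat Y = Y \<and> pos_def_mat g Y}"

definition siegel_embed :: "nat \<Rightarrow> complex mat \<Rightarrow> complex mat" where
  "siegel_embed g Z = four_block_mat Z (0\<^sub>m g 1) (0\<^sub>m 1 g) (\<i> \<cdot>\<^sub>m 1\<^sub>m 1)"

definition pad :: "complex mat \<Rightarrow> nat \<Rightarrow> nat \<Rightarrow> complex" where
  "pad Z = (\<lambda>i j. if i < dim_row Z \<and> j < dim_col Z then Z $$ (i, j) else if i = j then \<i> else 0)"

definition siegel_block :: "nat \<Rightarrow> (nat \<Rightarrow> nat \<Rightarrow> complex) \<Rightarrow> complex mat" where
  "siegel_block g p = Matrix.mat g g (\<lambda>(i, j). p i j)"

(* h_g as a set of infinite matrices. By the next lemmas, this identification turns the embedding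
   of h_g into h_(g+1) into an inclusion. The topology induced by the product topology on infinite
   matrices is the Euclidean one, as only finitely many entries vary. *)
definition siegel_level :: "nat \<Rightarrow> (nat \<Rightarrow> nat \<Rightarrow> complex) set" where
  "siegel_level g = pad ` siegel g"

lemma pad_siegel_embed:
  assumes "Z \<in> carrier_mat g g"
  shows "pad (siegel_embed g Z) = pad Z"
  using assms by (intro ext) (auto simp: pad_def siegel_embed_def)

lemma siegel_block_pad:
  assumes "Z \<in> carrier_mat g g"
  shows "siegel_block g (pad Z) = Z"
  using assms by (intro eq_matI) (auto simp: pad_def siegel_block_def)

(* The entries on and above the diagonal, relative to the base point \<i> I. The entry (i, j) with
   i \<le> j has number triangle j + i, so h_g occupies the first g (g + 1) / 2 coordinates. *)
definition siegel_coord :: "(nat \<Rightarrow> nat \<Rightarrow> complex) \<Rightarrow> nat \<Rightarrow> complex" where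
  "siegel_coord p = (\<lambda>n. case prod_decode n of (i, k) \<Rightarrow> p i (i + k) - (if k = 0 then \<i> else 0))"

definition siegel_mfd :: "nat \<Rightarrow> (nat \<Rightarrow> nat \<Rightarrow> complex) cmanifold" where
  "siegel_mfd g = \<lparr>mfd_dim = enat (triangle g), mfd_top = top_of_set (siegel_level g),
     mfd_atlas = {(siegel_level g, siegel_coord)}\<rparr>"

definition siegel_limit :: "(nat \<Rightarrow> nat \<Rightarrow> complex) cmanifold" where
  "siegel_limit = \<lparr>mfd_dim = \<infinity>, mfd_top = direct_limit_topology (\<lambda>n. siegel_level (Suc n)),
     mfd_atlas = {(\<Union>n. siegel_level (Suc n), siegel_coord)}\<rparr>"


section \<open>The invariant metrics\<close>

definition symplectic_form :: "nat \<Rightarrow> real mat" where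
  "symplectic_form g = four_block_mat (0\<^sub>m g g) (1\<^sub>m g) (- 1\<^sub>m g) (0\<^sub>m g g)"

definition symplectic_group :: "nat \<Rightarrow> real mat set" where
  "symplectic_group g = {M \<in> carrier_mat (2 * g) (2 * g).
     transpose_mat M * symplectic_form g * M = symplectic_form g}"

(* (A B; C D) acts on h_g by Z \<mapsto> (A Z + B) (C Z + D)^(-1); the inverse exists for M in Sp(2g, R)
   and Z in h_g. *)
definition symplectic_act :: "nat \<Rightarrow> real mat \<Rightarrow> complex mat \<Rightarrow> complex mat" where
  "symplectic_act g M Z =
     (case split_block (map_mat complex_of_real M) g g of (A, B, C, D) \<Rightarrow>
        (A * Z + B) * the (mat_inverse (C * Z + D)))"

definition invariant_hermitian_metric :: "nat \<Rightarrow> (nat \<Rightarrow> nat \<Rightarrow> complex) metric \<Rightarrow> bool" where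
  "invariant_hermitian_metric g h \<longleftrightarrow>
     hermitian_metric (siegel_mfd g) h \<and>
     (\<forall>M\<in>symplectic_group g.
        metric_preserving (siegel_mfd g) h (siegel_mfd g) h (\<lambda>p. pad (symplectic_act g M (siegel_block g p))))"

definition compatible_invariant_metrics :: "(nat \<Rightarrow> (nat \<Rightarrow> nat \<Rightarrow> complex) metric) \<Rightarrow> bool" where
  "compatible_invariant_metrics h \<longleftrightarrow>
     (\<forall>g\<ge>1. invariant_hermitian_metric g (h g) \<and>
        metric_preserving (siegel_mfd g) (h g) (siegel_mfd (Suc g)) (h (Suc g))
          (\<lambda>p. pad (siegel_embed g (siegel_block g p))))"

(* The value is read off at the first level containing the point and both tangent vectors; for a
   compatible family any other such level gives the same value. *)
definition limit_metric ::
  "(nat \<Rightarrow> (nat \<Rightarrow> nat \<Rightarrow> complex) metric) \<Rightarrow> (nat \<Rightarrow> nat \<Rightarrow> complex) metric" where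
  "limit_metric h = (\<lambda>c p v w.
     let g = (LEAST g. 1 \<le> g \<and> p \<in> siegel_level g \<and> v \<in> cseq (triangle g) \<and> w \<in> cseq (triangle g))
     in h g (siegel_level g, siegel_coord) p v w)"

end

theory Submission
  imports Defs "HOL-Analysis.Function_Metric" "HOL-Analysis.Abstract_Topological_Spaces"
    "Jordan_Normal_Form.Determinant"
begin

text \<open>
  In the coordinates given by the upper triangular entries, the form
  \<open>tr (Y\<^sup>-\<^sup>1 V Y\<^sup>-\<^sup>1 W\<^sup>*)\<close> at \<open>X + \<i> Y\<close> defines a compatible family of invariant
  metrics. Writing \<open>Q = C Z + D\<close>, the symplectic relations give
  \<open>F Z' - F Z = Q(Z)\<^sup>-\<^sup>T (Z' - Z) Q(Z')\<^sup>-\<^sup>1\<close>, which yields both the derivative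
  \<open>V \<mapsto> Q\<^sup>-\<^sup>T V Q\<^sup>-\<^sup>1\<close> of the action and, with \<open>Z\<close> replaced by its conjugate, the
  transformation law of \<open>Y\<close>; invariance of the trace follows.

  For the limit, every finite set of points and tangent vectors lies in some level, on which the
  limit metric is \<open>h g\<close>, and the topologies are final, so that continuity and smoothness may be
  tested on each level. The symmetry at \<open>X + \<i> Y\<close> is \<open>Z \<mapsto> X - Y (Z - X)\<^sup>-\<^sup>1 Y\<close>. It is symplectic
  on each level, commutes with the embeddings, and fixes no other point of any level.
\<close>

text \<open>The second half of the statement concerns an arbitrary compatible family
  \<open>h\<close>, so about \<open>h g\<close> nothing is known there beyond the axioms of a
  metric, compatibility and invariance under \<open>symplectic_group g\<close>. Each symmetry
  therefore has to be realised, on every sufficiently large level, by an explicit symplectic matrix.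
  The trace form serves only to show that compatible families exist. The formula of the symmetry
  arises from \<open>Z \<mapsto> - Z^-1\<close>, the symmetry at the base point, by conjugation with
  \<open>Z \<mapsto> R Z R + X\<close>, where \<open>R\<close> is a symmetric square root of
  \<open>Y\<close>: the roots merge into \<open>Y\<close>, so that no choice remains that could
  depend on the level. Openness of the positive definite cone and a factorisation
  \<open>Y = L^T L\<close> both come from induction on the size via Schur complements, without
  compactness or spectral theory. Derivatives need no estimates either: the difference quotients of
  the action and of the inverse matrix have closed forms.\<close>

section \<open>Inverse matrices, and continuity of determinant and inverse\<close>

definition mat_inv :: "'a::field mat \<Rightarrow> 'a mat" where
  "mat_inv A = the (mat_inverse A)"

lemma mat_inv:
  fixes A :: "'a::field mat"
  assumes A: "A \<in> carrier_mat n n" and d: "det A \<noteq> 0"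
  shows "A * mat_inv A = 1\<^sub>m n" "mat_inv A * A = 1\<^sub>m n" "mat_inv A \<in> carrier_mat n n"
proof -
  have "A \<in> Units (ring_mat TYPE('a) n ())"
    by (rule det_non_zero_imp_unit[OF A d])
  with mat_inverse(1)[OF A, of "()"] obtain B where "mat_inverse A = Some B"
    by (cases "mat_inverse A") auto
  with mat_inverse(2)[OF A this]
  show "A * mat_inv A = 1\<^sub>m n" "mat_inv A * A = 1\<^sub>m n" "mat_inv A \<in> carrier_mat n n"
    by (auto simp: mat_inv_def)
qed

text \<open>A right inverse is enough: the determinant of \<open>A * B\<close> shows that
  \<open>A\<close> is invertible, and multiplying by \<open>mat_inv A\<close> from the left
  identifies \<open>B\<close>. Explicit inverses below are verified by exhibiting such a
  product.\<close>

lemma mat_inv_unique: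
  fixes A :: "'a::field mat"
  assumes A: "A \<in> carrier_mat n n" and B: "B \<in> carrier_mat n n" and AB: "A * B = 1\<^sub>m n"
  shows "det A \<noteq> 0" "mat_inv A = B"
proof -
  show d: "det A \<noteq> 0"
    using det_mult[OF A B] AB by auto
  have "mat_inv A = mat_inv A * (A * B)"
    using mat_inv[OF A d] by (simp add: AB)
  also have "\<dots> = mat_inv A * A * B"
    using assoc_mult_mat[OF mat_inv(3)[OF A d] A B] by simp
  also have "\<dots> = B"
    using mat_inv[OF A d] B by simp
  finally show "mat_inv A = B" .
qed

lemma det_nonzeroI:
  fixes A :: "'a::field mat"
  assumes "A \<in> carrier_mat n n"
    and "\<And>w. w \<in> carrier_vec n \<Longrightarrow> A *\<^sub>v w = 0\<^sub>v n \<Longrightarrow> w = 0\<^sub>v n"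
  shows "det A \<noteq> 0"
  using assms det_0_iff_vec_prod_zero_field by blast

lemma transpose_mat_inv:
  fixes A :: "'a::field mat"
  assumes A: "A \<in> carrier_mat n n" and d: "det A \<noteq> 0"
  shows "transpose_mat (mat_inv A) = mat_inv (transpose_mat A)"
proof (rule mat_inv_unique(2)[symmetric, of _ n])
  have "transpose_mat A * transpose_mat (mat_inv A) = transpose_mat (mat_inv A * A)"
    by (rule transpose_mult[symmetric, of _ n n _ n]) (use mat_inv[OF A d] A in auto)
  then show "transpose_mat A * transpose_mat (mat_inv A) = 1\<^sub>m n"
    using mat_inv[OF A d] by simp
qed (use mat_inv[OF A d] A in auto)

text \<open>The Leibniz formula is a polynomial in the entries.\<close>

lemma tendsto_det:
  fixes A :: "'b \<Rightarrow> 'a::real_normed_field mat"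
  assumes A: "\<And>t. A t \<in> carrier_mat n n" "A0 \<in> carrier_mat n n"
    and lim: "\<And>i j. i < n \<Longrightarrow> j < n \<Longrightarrow> ((\<lambda>t. A t $$ (i, j)) \<longlongrightarrow> A0 $$ (i, j)) F"
  shows "((\<lambda>t. det (A t)) \<longlongrightarrow> det A0) F"
proof -
  have *: "i < n \<Longrightarrow> \<pi> permutes {0..<n} \<Longrightarrow> \<pi> i < n" for \<pi> i
    using permutes_in_image[of \<pi> "{0..<n}" i] by auto
  show ?thesis
    unfolding det_def'[OF A(1)] det_def'[OF A(2)]
    by (intro tendsto_sum tendsto_mult tendsto_const tendsto_prod lim) (use * in auto)
qed

text \<open>By Cramer's rule the entries of the inverse are cofactors divided by the determinant,
  hence quotients of polynomials in the entries.\<close>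

lemma tendsto_mat_inv:
  fixes A :: "'b \<Rightarrow> 'a::{real_normed_field} mat"
  assumes A: "\<And>t. A t \<in> carrier_mat n n" "A0 \<in> carrier_mat n n"
    and lim: "\<And>i j. i < n \<Longrightarrow> j < n \<Longrightarrow> ((\<lambda>t. A t $$ (i, j)) \<longlongrightarrow> A0 $$ (i, j)) F"
    and d: "det A0 \<noteq> 0" and ij: "i < n" "j < n"
  shows "((\<lambda>t. mat_inv (A t) $$ (i, j)) \<longlongrightarrow> mat_inv A0 $$ (i, j)) F"
proof -
  have adj: "mat_inv B $$ (i, j) = cofactor B j i / det B"
    if B: "B \<in> carrier_mat n n" and dB: "det B \<noteq> 0" for B :: "'a mat"
  proof -
    have "B * ((1 / det B) \<cdot>\<^sub>m adj_mat B) = 1\<^sub>m n"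
      using adj_mat[OF B] dB B by (simp add: mult_smult_distrib[OF B]) (auto intro!: eq_matI)
    then have "mat_inv B = (1 / det B) \<cdot>\<^sub>m adj_mat B"
      using adj_mat[OF B] B by (intro mat_inv_unique) auto
    then show ?thesis
      using B ij by (simp add: adj_mat_def)
  qed
  \<comment> \<open>The \<open>A t\<close> are known to be invertible only near the limit, so the
    identification with cofactor quotients holds eventually, which is enough.\<close>
  have ev: "eventually (\<lambda>t. det (A t) \<noteq> 0) F"
    using tendsto_imp_eventually_ne[OF tendsto_det[OF A lim] d] .
  have "((\<lambda>t. cofactor (A t) j i / det (A t)) \<longlongrightarrow> cofactor A0 j i / det A0) F"
    unfolding cofactor_def
  proof (intro tendsto_divide tendsto_mult tendsto_const tendsto_det[OF A lim] d
      tendsto_det[of _ "n - 1"])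
    fix k l
    assume kl: "k < n - 1" "l < n - 1"
    have "mat_delete B j i $$ (k, l) =
        B $$ (if k < j then k else Suc k, if l < i then l else Suc l)"
      if "B \<in> carrier_mat n n" for B :: "'a mat"
      using that kl by (simp add: mat_delete_def)
    with A kl show "((\<lambda>t. mat_delete (A t) j i $$ (k, l)) \<longlongrightarrow> mat_delete A0 j i $$ (k, l)) F"
      by (auto intro!: lim)
  qed (use A in \<open>auto intro: mat_delete_carrier[of _ n n, simplified]\<close>)
  then have "((\<lambda>t. cofactor (A t) j i / det (A t)) \<longlongrightarrow> mat_inv A0 $$ (i, j)) F"
    using adj[OF A(2) d] by simp
  then show ?thesis
    by (rule Lim_transform_eventually) (use ev adj A in \<open>auto elim!: eventually_mono\<close>)
qed

lemma mult_mat_index: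
  assumes "A \<in> carrier_mat n n" "B \<in> carrier_mat n n" "i < n" "j < n"
  shows "(A * B) $$ (i, j) = (\<Sum>k<n. A $$ (i, k) * B $$ (k, j))"
  using assms by (simp add: scalar_prod_def lessThan_atLeast0)

lemma tendsto_mat_mult:
  fixes A B :: "'b \<Rightarrow> 'a::{real_normed_algebra, semiring_0} mat"
  assumes "\<And>t. A t \<in> carrier_mat n n" "A0 \<in> carrier_mat n n"
    and "\<And>t. B t \<in> carrier_mat n n" "B0 \<in> carrier_mat n n"
    and "\<And>i j. i < n \<Longrightarrow> j < n \<Longrightarrow> ((\<lambda>t. A t $$ (i, j)) \<longlongrightarrow> A0 $$ (i, j)) F"
    and "\<And>i j. i < n \<Longrightarrow> j < n \<Longrightarrow> ((\<lambda>t. B t $$ (i, j)) \<longlongrightarrow> B0 $$ (i, j)) F"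
    and "i < n" "j < n"
  shows "((\<lambda>t. (A t * B t) $$ (i, j)) \<longlongrightarrow> (A0 * B0) $$ (i, j)) F"
  unfolding mult_mat_index[OF assms(1,3,7,8)] mult_mat_index[OF assms(2,4,7,8)]
  by (intro tendsto_sum tendsto_mult assms) (use assms in auto)


section \<open>Positive definite quadratic forms\<close>

text \<open>Stated for functions on index pairs rather than for matrices, so that the size can
  shrink in an induction while the entries stay in place.\<close>

definition pd :: "nat \<Rightarrow> (nat \<Rightarrow> nat \<Rightarrow> real) \<Rightarrow> bool" where
  "pd n Y \<longleftrightarrow> (\<forall>x. (\<exists>i<n. x i \<noteq> 0) \<longrightarrow> 0 < (\<Sum>i<n. \<Sum>j<n. x i * Y i j * x j))"

lemma pd_cong:
  assumes "\<And>i j. i < n \<Longrightarrow> j < n \<Longrightarrow> Y i j = Y' i j"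
  shows "pd n Y \<longleftrightarrow> pd n Y'"
  unfolding pd_def using assms by (intro all_cong arg_cong[of _ _ "(<) 0"] sum.cong) auto

text \<open>Completing the square in the last variable. The remaining form belongs to the Schur
  complement of the entry \<open>Y n n\<close>.\<close>

lemma quadratic_form_complete_square:
  fixes Y :: "nat \<Rightarrow> nat \<Rightarrow> real"
  assumes sym: "\<And>i j. i \<le> n \<Longrightarrow> j \<le> n \<Longrightarrow> Y i j = Y j i" and a: "Y n n \<noteq> 0"
  shows "(\<Sum>i<Suc n. \<Sum>j<Suc n. x i * Y i j * x j) =
    Y n n * (x n + (\<Sum>i<n. Y i n * x i) / Y n n)\<^sup>2 +
    (\<Sum>i<n. \<Sum>j<n. x i * (Y i j - Y i n * Y n j / Y n n) * x j)"
proof -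
  let ?s = "\<Sum>i<n. Y i n * x i"
  have s1: "(\<Sum>i<n. x i * Y i n * x n) = x n * ?s"
    by (simp add: sum_distrib_left mult_ac)
  have s2: "(\<Sum>j<n. x n * Y n j * x j) = x n * ?s"
    unfolding sum_distrib_left using sym[of n] by (intro sum.cong) (auto simp del: mult_cancel_left mult_cancel_right)
  have "(\<Sum>i<n. \<Sum>j<n. x i * (Y i n * Y n j / Y n n) * x j) =
      (\<Sum>i<n. \<Sum>j<n. (Y i n * x i) * (Y j n * x j)) / Y n n"
    unfolding sum_divide_distrib
  proof (intro sum.cong refl)
    fix i j
    assume "i \<in> {..<n}" "j \<in> {..<n}"
    then have "Y n j = Y j n"
      by (intro sym) auto
    then show "x i * (Y i n * Y n j / Y n n) * x j = Y i n * x i * (Y j n * x j) / Y n n"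
      by simp
  qed
  also have "\<dots> = ?s * ?s / Y n n"
    by (simp add: sum_product)
  finally have s3: "(\<Sum>i<n. \<Sum>j<n. x i * (Y i j - Y i n * Y n j / Y n n) * x j) =
      (\<Sum>i<n. \<Sum>j<n. x i * Y i j * x j) - ?s * ?s / Y n n"
    by (simp add: sum_subtractf algebra_simps)
  have "Y n n * (x n + ?s / Y n n)\<^sup>2 = Y n n * x n * x n + 2 * x n * ?s + ?s * ?s / Y n n"
    using a by (simp add: field_simps power2_eq_square)
  moreover have "(\<Sum>i<Suc n. \<Sum>j<Suc n. x i * Y i j * x j) =
      (\<Sum>i<n. \<Sum>j<n. x i * Y i j * x j) + x n * ?s + (x n * ?s + x n * Y n n * x n)"
    by (simp add: sum.distrib s1 s2)
  ultimately show ?thesis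
    unfolding s3 by (simp add: mult.commute)
qed

text \<open>Reduces positive definiteness to one strict inequality and a smaller form, which is the
  step of both inductions on the size below.\<close>

lemma pd_Suc_iff:
  assumes sym: "\<And>i j. i \<le> n \<Longrightarrow> j \<le> n \<Longrightarrow> Y i j = Y j i"
  shows "pd (Suc n) Y \<longleftrightarrow> 0 < Y n n \<and> pd n (\<lambda>i j. Y i j - Y i n * Y n j / Y n n)"
proof (intro iffI conjI)
  assume Y: "pd (Suc n) Y"
  have *: "(\<Sum>j<n. (if i = n then 1 else 0) * Y i j * (if j = n then 1 else 0)) = 0" for i
    by (intro sum.neutral) auto
  \<comment> \<open>The last unit vector as a test vector isolates the corner entry.\<close>
  have "0 < (\<Sum>i<Suc n. \<Sum>j<Suc n. (if i = n then 1 else 0) * Y i j * (if j = n then 1 else 0))"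
    by (rule Y[unfolded pd_def, rule_format]) (rule exI[of _ n], simp)
  also have "\<dots> = Y n n"
    by (simp add: *)
  finally show pos: "0 < Y n n" .
  show "pd n (\<lambda>i j. Y i j - Y i n * Y n j / Y n n)"
    unfolding pd_def
  proof (intro allI impI)
    fix x :: "nat \<Rightarrow> real"
    assume x: "\<exists>i<n. x i \<noteq> 0"
    \<comment> \<open>The last coordinate is chosen so that the completed square vanishes.\<close>
    define x' where "x' = x(n := - (\<Sum>i<n. Y i n * x i) / Y n n)"
    have "\<exists>i<Suc n. x' i \<noteq> 0"
      using x by (auto simp: x'_def intro: less_SucI)
    then have "0 < (\<Sum>i<Suc n. \<Sum>j<Suc n. x' i * Y i j * x' j)"
      using Y unfolding pd_def by blast
    also have "\<dots> = (\<Sum>i<n. \<Sum>j<n. x' i * (Y i j - Y i n * Y n j / Y n n) * x' j)"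
      using pos by (subst quadratic_form_complete_square[OF sym]) (auto simp: x'_def)
    also have "\<dots> = (\<Sum>i<n. \<Sum>j<n. x i * (Y i j - Y i n * Y n j / Y n n) * x j)"
      by (intro sum.cong) (auto simp: x'_def)
    finally show "0 < (\<Sum>i<n. \<Sum>j<n. x i * (Y i j - Y i n * Y n j / Y n n) * x j)" .
  qed
next
  assume *: "0 < Y n n \<and> pd n (\<lambda>i j. Y i j - Y i n * Y n j / Y n n)"
  show "pd (Suc n) Y"
    unfolding pd_def
  proof (intro allI impI)
    fix x :: "nat \<Rightarrow> real"
    assume x: "\<exists>i<Suc n. x i \<noteq> 0"
    let ?q = "\<Sum>i<n. \<Sum>j<n. x i * (Y i j - Y i n * Y n j / Y n n) * x j"
    let ?s = "Y n n * (x n + (\<Sum>i<n. Y i n * x i) / Y n n)\<^sup>2"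
    have s: "?s \<ge> 0"
      using * by simp
    have "0 < ?s + ?q"
    proof (cases "\<exists>i<n. x i \<noteq> 0")
      case True
      then have "?q > 0"
        using * unfolding pd_def by blast
      with s show ?thesis
        by linarith
    next
      case False
      then have "x n \<noteq> 0" "\<forall>i<n. x i = 0"
        using x less_Suc_eq by auto
      then show ?thesis
        using * by simp
    qed
    then show "0 < (\<Sum>i<Suc n. \<Sum>j<Suc n. x i * Y i j * x j)"
      using * by (subst quadratic_form_complete_square[OF sym]) auto
  qed
qed

text \<open>Openness of the positive definite cone: the corner entry stays positive near the limit,
  and the Schur complement depends continuously on the entries, so induction on the size
  applies.\<close>

lemma pd_eventually:
  fixes Y :: "'b \<Rightarrow> nat \<Rightarrow> nat \<Rightarrow> real"
  assumes "\<And>t i j. i < n \<Longrightarrow> j < n \<Longrightarrow> Y t i j = Y t j i"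
    and "\<And>i j. i < n \<Longrightarrow> j < n \<Longrightarrow> Y0 i j = Y0 j i"
    and "\<And>i j. i < n \<Longrightarrow> j < n \<Longrightarrow> ((\<lambda>t. Y t i j) \<longlongrightarrow> Y0 i j) F"
    and "pd n Y0"
  shows "eventually (\<lambda>t. pd n (Y t)) F"
  using assms
proof (induction n arbitrary: Y Y0)
  case 0
  then show ?case
    by (simp add: pd_def)
next
  case (Suc n)
  have Y0: "0 < Y0 n n" "pd n (\<lambda>i j. Y0 i j - Y0 i n * Y0 n j / Y0 n n)"
    using Suc.prems(4) by (subst (asm) pd_Suc_iff; simp add: Suc.prems(2))+
  have "eventually (\<lambda>t. 0 < Y t n n) F"
    using Suc.prems(3)[of n n] Y0(1) by (auto simp: order_tendsto_iff)
  moreover have "eventually (\<lambda>t. pd n (\<lambda>i j. Y t i j - Y t i n * Y t n j / Y t n n)) F"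
  proof (rule Suc.IH[OF _ _ _ Y0(2)])
    fix t i j
    assume ij: "i < n" "j < n"
    then have "Y t i n = Y t n i" "Y t j n = Y t n j" "Y t i j = Y t j i"
      by (auto intro!: Suc.prems(1))
    then show "Y t i j - Y t i n * Y t n j / Y t n n = Y t j i - Y t j n * Y t n i / Y t n n"
      by simp
    have "Y0 i n = Y0 n i" "Y0 j n = Y0 n j" "Y0 i j = Y0 j i"
      using ij by (auto intro!: Suc.prems(2))
    then show "Y0 i j - Y0 i n * Y0 n j / Y0 n n = Y0 j i - Y0 j n * Y0 n i / Y0 n n"
      by simp
    show "((\<lambda>t. Y t i j - Y t i n * Y t n j / Y t n n) \<longlongrightarrow>
        Y0 i j - Y0 i n * Y0 n j / Y0 n n) F"
      using ij Y0(1) by (intro tendsto_intros Suc.prems(3)) auto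
  qed
  ultimately show ?case
    by eventually_elim (subst pd_Suc_iff; simp add: Suc.prems(1))
qed

text \<open>A Cholesky factorisation built from the last index: the Schur complement is factorised
  by induction, and one further row accounts for what was subtracted.\<close>

lemma pd_sum_of_squares:
  fixes Y :: "nat \<Rightarrow> nat \<Rightarrow> real"
  assumes "\<And>i j. i < n \<Longrightarrow> j < n \<Longrightarrow> Y i j = Y j i" and "pd n Y"
  shows "\<exists>c. \<forall>i<n. \<forall>j<n. Y i j = (\<Sum>m<n. c m i * c m j)"
  using assms
proof (induction n arbitrary: Y)
  case 0
  then show ?case by simp
next
  case (Suc n)
  have Y: "0 < Y n n" "pd n (\<lambda>i j. Y i j - Y i n * Y n j / Y n n)"
    using Suc.prems(2) by (subst (asm) pd_Suc_iff; simp add: Suc.prems(1))+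
  have "\<exists>c. \<forall>i<n. \<forall>j<n. Y i j - Y i n * Y n j / Y n n = (\<Sum>m<n. c m i * c m j)"
  proof (rule Suc.IH[OF _ Y(2)])
    fix i j
    assume "i < n" "j < n"
    then have "Y i n = Y n i" "Y j n = Y n j" "Y i j = Y j i"
      by (auto intro!: Suc.prems(1))
    then show "Y i j - Y i n * Y n j / Y n n = Y j i - Y j n * Y n i / Y n n"
      by simp
  qed
  then obtain c where c: "\<And>i j. i < n \<Longrightarrow> j < n \<Longrightarrow>
      Y i j - Y i n * Y n j / Y n n = (\<Sum>m<n. c m i * c m j)"
    by blast
  \<comment> \<open>The new row \<open>n\<close> contributes \<open>Y i n * Y n j / Y n n\<close>.
    The old rows are extended by 0 in column \<open>n\<close>, where the new row alone already gives
    the right entries.\<close>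
  define c' where "c' m i = (if m < n then if i < n then c m i else 0 else Y i n / sqrt (Y n n))"
    for m i
  have "Y i j = (\<Sum>m<Suc n. c' m i * c' m j)" if ij: "i < Suc n" "j < Suc n" for i j
  proof -
    have last: "c' n i * c' n j = Y i n * Y n j / Y n n"
      using Y(1) Suc.prems(1)[of j n] ij by (simp add: c'_def)
    have "(\<Sum>m<n. c' m i * c' m j) = (if i < n \<and> j < n then \<Sum>m<n. c m i * c m j else 0)"
      by (auto simp: c'_def intro!: sum.neutral)
    also have "\<dots> = Y i j - Y i n * Y n j / Y n n"
      using ij Y(1) c[of i j] by (auto simp: less_Suc_eq)
    finally show ?thesis
      using last by simp
  qed
  then show ?case
    by blast
qed


section \<open>Direct limits and Gateaux derivatives\<close>

lemma tendsto_fun_iff: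
  fixes f :: "'b \<Rightarrow> 'i \<Rightarrow> 'c::topological_space"
  shows "(f \<longlongrightarrow> l) F \<longleftrightarrow> (\<forall>k. ((\<lambda>t. f t k) \<longlongrightarrow> l k) F)"
  using limitin_componentwise[of "\<lambda>_::'i. euclidean::'c topology" UNIV f l F]
  unfolding euclidean_product_topology PiE_UNIV_domain by simp

lemma openin_top_of_setI:
  assumes "U \<subseteq> S" and "\<And>x. x \<in> U \<Longrightarrow> eventually (\<lambda>y. y \<in> U) (at x within S)"
  shows "openin (top_of_set S) U"
proof (subst openin_subopen, intro ballI)
  fix x
  assume x: "x \<in> U"
  then obtain T where T: "open T" "x \<in> T" "\<And>y. y \<in> T \<Longrightarrow> y \<noteq> x \<Longrightarrow> y \<in> S \<Longrightarrow> y \<in> U"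
    using assms(2)[OF x] unfolding eventually_at_topological by blast
  have "openin (top_of_set S) (S \<inter> T)"
    using T(1) by (simp add: openin_open_Int)
  moreover have "x \<in> S \<inter> T" "S \<inter> T \<subseteq> U"
    using T x assms(1) by auto
  ultimately show "\<exists>T. openin (top_of_set S) T \<and> x \<in> T \<and> T \<subseteq> U"
    by blast
qed

text \<open>The universal property of the final topology. As \<open>S\<close> increases, continuity
  from some stage \<open>n0\<close> on is enough; the symmetries used later are controlled only from
  a stage on.\<close>

lemma continuous_map_from_direct_limit:
  assumes S: "mono S" and f: "\<And>n. n0 \<le> n \<Longrightarrow> continuous_map (top_of_set (S n)) T f"
  shows "continuous_map (direct_limit_topology S) T f"
proof -
  have f': "continuous_map (top_of_set (S n)) T f" for n
    by (rule continuous_map_from_subtopology_mono[OF f[of "max n n0"]])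
      (use monoD[OF S, of n "max n n0"] in auto)
  show ?thesis
    unfolding continuous_map_def topspace_direct_limit_topology
  proof (intro conjI allI impI)
    show "f \<in> \<Union> (range S) \<rightarrow> topspace T"
      using f' by (fastforce simp: continuous_map_def)
    fix U
    assume U: "openin T U"
    show "openin (direct_limit_topology S) {x \<in> \<Union> (range S). f x \<in> U}"
      unfolding openin_direct_limit_topology
    proof (intro conjI allI)
      fix n
      have "{x \<in> \<Union> (range S). f x \<in> U} \<inter> S n = {x \<in> S n. f x \<in> U}"
        by auto
      with f'[of n] U show "openin (top_of_set (S n)) ({x \<in> \<Union> (range S). f x \<in> U} \<inter> S n)"
        by (simp add: continuous_map_def)
    qed auto
  qed
qed

lemma continuous_map_into_direct_limit:
  assumes "continuous_map X (top_of_set (S n)) f"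
  shows "continuous_map X (direct_limit_topology S) f"
proof -
  have "continuous_map (top_of_set (S n)) (direct_limit_topology S) id"
    unfolding continuous_map_def topspace_direct_limit_topology openin_direct_limit_topology
    by (auto simp: Int_commute Collect_conj_eq)
  from continuous_map_compose[OF assms this] show ?thesis
    by simp
qed

lemma limitin_direct_limit:
  assumes "limitin (top_of_set (S n)) f d F"
  shows "limitin (direct_limit_topology S) f d F"
  using assms unfolding limitin_def topspace_direct_limit_topology openin_direct_limit_topology
proof (safe)
  fix U
  assume U: "\<forall>U. openin (top_of_set (S n)) U \<and> d \<in> U \<longrightarrow> (\<forall>\<^sub>F x in F. f x \<in> U)"
    "\<forall>n. openin (top_of_set (S n)) (U \<inter> S n)" "d \<in> U"
  assume "d \<in> topspace (top_of_set (S n))"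
  with U have "\<forall>\<^sub>F x in F. f x \<in> U \<inter> S n"
    by auto
  then show "\<forall>\<^sub>F x in F. f x \<in> U"
    by (rule eventually_mono) auto
qed auto

text \<open>The direct limit topology is at least as fine as the one induced from the ambient space,
  so traces of ambient open sets separate points.\<close>

lemma Hausdorff_direct_limit:
  fixes S :: "nat \<Rightarrow> 'a::t2_space set"
  shows "Hausdorff_space (direct_limit_topology S)"
  unfolding Hausdorff_space_def topspace_direct_limit_topology
proof (intro allI impI, elim conjE)
  fix x y
  assume xy: "x \<in> \<Union> (range S)" "y \<in> \<Union> (range S)" "x \<noteq> y"
  from hausdorff[OF xy(3)] obtain U V where UV: "open U" "open V" "x \<in> U" "y \<in> V" "U \<inter> V = {}"
    by blast
  have *: "openin (direct_limit_topology S) (\<Union> (range S) \<inter> U)" if "open U" for U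
    unfolding openin_direct_limit_topology
  proof (intro conjI allI)
    fix n
    have "\<Union> (range S) \<inter> U \<inter> S n = S n \<inter> U"
      by auto
    then show "openin (top_of_set (S n)) (\<Union> (range S) \<inter> U \<inter> S n)"
      using that by (simp add: openin_open_Int)
  qed auto
  show "\<exists>U V. openin (direct_limit_topology S) U \<and> openin (direct_limit_topology S) V \<and>
      x \<in> U \<and> y \<in> V \<and> disjnt U V"
  proof (intro exI conjI)
    show "openin (direct_limit_topology S) (\<Union> (range S) \<inter> U)"
      "openin (direct_limit_topology S) (\<Union> (range S) \<inter> V)"
      using * UV(1,2) by auto
    show "x \<in> \<Union> (range S) \<inter> U" "y \<in> \<Union> (range S) \<inter> V"
      using UV(3,4) xy by auto
    show "disjnt (\<Union> (range S) \<inter> U) (\<Union> (range S) \<inter> V)"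
      using UV(5) unfolding disjnt_def by blast
  qed
qed

text \<open>An open subset of a direct limit is the direct limit of its traces. The reindexing
  \<open>r\<close> is there because the coordinate domain of level \<open>Suc n\<close> is a trace
  on the coordinate space with index \<open>triangle (Suc n)\<close>, not \<open>n\<close>.\<close>

lemma subtopology_direct_limit:
  assumes S: "mono S" and r: "\<And>n. n \<le> r n" and D: "openin (direct_limit_topology S) D"
    and T: "\<And>n. T n = D \<inter> S (r n)"
  shows "subtopology (direct_limit_topology S) D = direct_limit_topology T"
  unfolding topology_eq openin_open_subtopology[OF D]
proof (intro allI iffI)
  fix U
  assume U: "openin (direct_limit_topology S) U \<and> U \<subseteq> D"
  show "openin (direct_limit_topology T) U"
    unfolding openin_direct_limit_topology
  proof (intro conjI allI subsetI)
    fix x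
    assume "x \<in> U"
    then have "x \<in> D" "x \<in> \<Union> (range S)"
      using U unfolding openin_direct_limit_topology by blast+
    then obtain n where "x \<in> S n" "x \<in> D"
      by blast
    then have "x \<in> T n"
      using monoD[OF S r[of n]] by (auto simp: T)
    then show "x \<in> \<Union> (range T)"
      by auto
  next
    fix n
    have "openin (top_of_set (S (r n))) (U \<inter> S (r n))"
      using U by (auto simp: openin_direct_limit_topology)
    moreover have "U \<inter> T n = U \<inter> S (r n)"
      using U by (auto simp: T)
    ultimately show "openin (top_of_set (T n)) (U \<inter> T n)"
      using openin_subset_trans[of "S (r n)" "U \<inter> S (r n)" "T n"] by (auto simp: T)
  qed
next
  fix U
  assume U: "openin (direct_limit_topology T) U"
  then have UT: "U \<subseteq> \<Union> (range T)" "\<And>n. openin (top_of_set (T n)) (U \<inter> T n)"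
    by (auto simp: openin_direct_limit_topology)
  have UD: "U \<subseteq> D"
    using UT(1) by (auto simp: T)
  have "openin (top_of_set (S n)) (U \<inter> S n)" for n
  proof -
    \<comment> \<open>Openness of \<open>D\<close> makes its trace open in the stage, so that
      openness in the trace lifts to openness in the stage.\<close>
    have "openin (top_of_set (S (r n))) (T n)"
      using D by (simp add: T openin_direct_limit_topology)
    then have "openin (top_of_set (S (r n))) (U \<inter> T n)"
      using UT(2) openin_trans by blast
    then obtain V where V: "open V" "U \<inter> T n = S (r n) \<inter> V"
      by (auto simp: openin_open)
    have "U \<inter> S n = S n \<inter> V"
      using V(2) UD monoD[OF S r[of n]] by (auto simp: T)
    then show ?thesis
      using V(1) by (simp add: openin_open_Int)
  qed
  moreover have "U \<subseteq> \<Union> (range S)"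
    using UT(1) unfolding T by blast
  ultimately show "openin (direct_limit_topology S) U \<and> U \<subseteq> D"
    using UD by (simp add: openin_direct_limit_topology)
qed

section \<open>Model spaces and Gateaux derivatives\<close>

lemma cseq_line:
  assumes "x \<in> cseq n" "v \<in> cseq n"
  shows "(\<lambda>j. x j + t * v j) \<in> cseq n"
  unfolding cseq_def
proof (intro CollectI allI impI)
  fix k
  assume "n \<le> k"
  then have "x k = 0" "v k = 0"
    using assms unfolding cseq_def by blast+
  then show "x k + t * v k = 0"
    by simp
qed

lemma mono_cseq: "mono cseq"
  by (auto simp: mono_def cseq_def)

lemma Hausdorff_model: "Hausdorff_space (model_top N)"
  by (cases N) (auto simp: model_top_def Hausdorff_direct_limit intro!: Hausdorff_space_subtopology)

lemma model_infinity_UN: "model \<infinity> = (\<Union>n. cseq n)"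
  by (simp add: model_top_def topspace_direct_limit_topology)

lemma has_gateaux_deriv_unique:
  assumes "has_gateaux_deriv M f x v d" "has_gateaux_deriv M f x v d'"
  shows "d = d'"
  using assms limitin_Hausdorff_unique[OF _ _ _ Hausdorff_model]
  unfolding has_gateaux_deriv_def by fastforce

lemma gateaux_derivI: "has_gateaux_deriv M f x v d \<Longrightarrow> gateaux_deriv M f x v = d"
  unfolding gateaux_deriv_def by (blast intro: has_gateaux_deriv_unique)

text \<open>\<open>model_top (enat m)\<close> is a subspace of a product, so its limits are
  componentwise once the difference quotients lie in the subspace.\<close>

lemma has_gateaux_deriv_enat_iff:
  "has_gateaux_deriv (enat m) f x v d \<longleftrightarrow>
     d \<in> cseq m \<and>
     eventually (\<lambda>t::complex. (\<lambda>k. (f (\<lambda>j. x j + t * v j) k - f x k) / t) \<in> cseq m) (at 0) \<and>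
     (\<forall>k. ((\<lambda>t. (f (\<lambda>j. x j + t * v j) k - f x k) / t) \<longlongrightarrow> d k) (at 0))"
  by (auto simp: has_gateaux_deriv_def model_top_def limitin_subtopology tendsto_fun_iff)

text \<open>The inclusion of a stage into the direct limit is continuous, so a derivative computed
  on a finite stage persists in the limit.\<close>

lemma has_gateaux_deriv_infinity:
  assumes "has_gateaux_deriv (enat m) f x v d"
  shows "has_gateaux_deriv \<infinity> f x v d"
  using assms limitin_direct_limit by (simp add: has_gateaux_deriv_def model_top_def)

lemma has_gateaux_deriv_cong:
  assumes "has_gateaux_deriv M f x v d" "f x = f' x"
    and "eventually (\<lambda>t::complex. f (\<lambda>j. x j + t * v j) = f' (\<lambda>j. x j + t * v j)) (at 0)"
  shows "has_gateaux_deriv M f' x v d"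
  using assms(1) unfolding has_gateaux_deriv_def
proof (rule limitin_transform_eventually[rotated])
  show "\<forall>\<^sub>F t in at 0. (\<lambda>k. (f (\<lambda>j. x j + t * v j) k - f x k) / t) =
      (\<lambda>k. (f' (\<lambda>j. x j + t * v j) k - f' x k) / t)"
    using assms(3) by eventually_elim (simp add: assms(2))
qed

lemma has_gateaux_deriv_ident:
  assumes "v \<in> cseq m"
  shows "has_gateaux_deriv (enat m) (\<lambda>x. x) x v v"
proof -
  have ev: "eventually (\<lambda>t::complex. (x k + t * v k - x k) / t = v k) (at 0)" for k
    by (rule eventually_at_topological[THEN iffD2]) (auto intro: exI[of _ UNIV])
  show ?thesis
    unfolding has_gateaux_deriv_enat_iff
  proof (intro conjI allI)
    show "((\<lambda>t. (x k + t * v k - x k) / t) \<longlongrightarrow> v k) (at 0)" for k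
      by (rule tendsto_eventually[OF ev])
    show "v \<in> cseq m"
      by (rule assms)
    have "(\<lambda>k. (x k + t * v k - x k) / t) \<in> cseq m" for t :: complex
      unfolding cseq_def
    proof (intro CollectI allI impI)
      fix k
      assume "m \<le> k"
      then have "v k = 0"
        using assms unfolding cseq_def by blast
      then show "(x k + t * v k - x k) / t = 0"
        by simp
    qed
    then show "eventually (\<lambda>t. (\<lambda>k. (x k + t * v k - x k) / t) \<in> cseq m) (at 0)"
      by (intro always_eventually allI)
  qed
qed


section \<open>Global coordinates on the Siegel spaces\<close>

text \<open>Inverse of \<open>siegel_coord\<close> on symmetric matrices: \<open>min\<close> and
  \<open>max\<close> send both \<open>(i, j)\<close> and \<open>(j, i)\<close> to the entry on or
  above the diagonal, and the summand restores the base point that \<open>siegel_coord\<close>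
  subtracts.\<close>

definition uncoord :: "(nat \<Rightarrow> complex) \<Rightarrow> nat \<Rightarrow> nat \<Rightarrow> complex" where
  "uncoord x i j = x (prod_encode (min i j, max i j - min i j)) + (if i = j then \<i> else 0)"

lemma siegel_coord_uncoord [simp]: "siegel_coord (uncoord x) = x"
proof
  fix n
  obtain i k where ik: "prod_decode n = (i, k)"
    by (cases "prod_decode n")
  then have "n = prod_encode (i, k)"
    by (metis prod_decode_inverse)
  then show "siegel_coord (uncoord x) n = x n"
    by (simp add: siegel_coord_def uncoord_def)
qed

lemma uncoord_sym: "uncoord x i j = uncoord x j i"
  by (auto simp: uncoord_def min.commute max.commute)

lemma uncoord_siegel_coord:
  assumes "\<And>i j. p i j = p j i"
  shows "uncoord (siegel_coord p) = p"
  by (intro ext) (auto simp: siegel_coord_def uncoord_def min_def max_def assms)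

text \<open>\<open>prod_encode\<close> runs through the antidiagonals
  \<open>i + k = 0, 1, 2, ...\<close> in order, so the first \<open>triangle g\<close> codes are
  those with \<open>i + k < g\<close>. As \<open>i + k\<close> is the column of the encoded entry,
  these are the upper triangular entries of the block of size \<open>g\<close>.\<close>

lemma prod_encode_less_triangle: "prod_encode (i, k) < triangle g \<longleftrightarrow> i + k < g"
proof
  show "prod_encode (i, k) < triangle g" if "i + k < g"
  proof -
    have "prod_encode (i, k) < triangle (Suc (i + k))"
      by (simp add: prod_encode_def)
    also have "\<dots> \<le> triangle g"
      using that by (metis Suc_leI lift_Suc_mono_le triangle_Suc le_add1)
    finally show ?thesis .
  qed
  show "i + k < g" if "prod_encode (i, k) < triangle g"
  proof (rule ccontr)
    assume "\<not> i + k < g"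
    then have "triangle g \<le> triangle (i + k)"
      by (metis lift_Suc_mono_le triangle_Suc le_add1 not_less)
    with that show False
      by (simp add: prod_encode_def)
  qed
qed

text \<open>Vanishing of the late coordinates says that the matrix is padded beyond size
  \<open>g\<close>; this makes coordinate domains comparable with
  \<open>siegel_level\<close>.\<close>

lemma cseq_triangle_iff:
  "x \<in> cseq (triangle g) \<longleftrightarrow>
    (\<forall>i j. g \<le> i \<or> g \<le> j \<longrightarrow> uncoord x i j = (if i = j then \<i> else 0))"
proof
  assume x: "x \<in> cseq (triangle g)"
  show "\<forall>i j. g \<le> i \<or> g \<le> j \<longrightarrow> uncoord x i j = (if i = j then \<i> else 0)"
  proof (intro allI impI)
    fix i j
    assume "g \<le> i \<or> g \<le> j"
    then have "\<not> prod_encode (min i j, max i j - min i j) < triangle g"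
      unfolding prod_encode_less_triangle by (auto simp: min_def max_def)
    then have "x (prod_encode (min i j, max i j - min i j)) = 0"
      using x unfolding cseq_def by (metis (mono_tags) mem_Collect_eq not_le)
    then show "uncoord x i j = (if i = j then \<i> else 0)"
      unfolding uncoord_def by simp
  qed
next
  assume *: "\<forall>i j. g \<le> i \<or> g \<le> j \<longrightarrow> uncoord x i j = (if i = j then \<i> else 0)"
  show "x \<in> cseq (triangle g)"
    unfolding cseq_def
  proof (intro CollectI allI impI)
    fix n
    assume n: "triangle g \<le> n"
    obtain i k where "prod_decode n = (i, k)"
      by (cases "prod_decode n")
    then have ik: "n = prod_encode (i, k)"
      by (metis prod_decode_inverse)
    with n have "g \<le> i + k"
      using prod_encode_less_triangle[of i k g] by simp
    with * have "uncoord x i (i + k) = (if i = i + k then \<i> else 0)"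
      by blast
    then show "x n = 0"
      by (simp add: uncoord_def ik)
  qed
qed

lemma triangle_ge: "n \<le> triangle n"
  by (induction n) auto

lemma mono_triangle: "mono triangle"
  unfolding mono_iff_le_Suc by simp

lemma model_infinity_triangle:
  assumes "v \<in> model \<infinity>"
  obtains g0 where "\<And>g. g0 \<le> g \<Longrightarrow> v \<in> cseq (triangle g)"
proof -
  from assms obtain n where "v \<in> cseq n"
    by (auto simp: model_infinity_UN)
  then have "v \<in> cseq (triangle g)" if "n \<le> g" for g
    using monoD[OF mono_cseq order_trans[OF that triangle_ge]] by blast
  then show ?thesis
    using that by blast
qed

section \<open>Entrywise descriptions of the Siegel spaces and of the levels\<close>

lemma scalar_prod_mult_mat_vec:
  fixes Y :: "'a::comm_semiring_0 mat"
  assumes "Y \<in> carrier_mat g g" "v \<in> carrier_vec g" "w \<in> carrier_vec g"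
  shows "v \<bullet> (Y *\<^sub>v w) = (\<Sum>i<g. \<Sum>j<g. v $ i * Y $$ (i, j) * w $ j)"
  using assms by (simp add: scalar_prod_def lessThan_atLeast0 sum_distrib_left mult.assoc)

lemma pos_def_mat_iff_pd:
  assumes Y: "Y \<in> carrier_mat g g"
  shows "pos_def_mat g Y \<longleftrightarrow> pd g (\<lambda>i j. Y $$ (i, j))"
proof
  assume *: "pos_def_mat g Y"
  show "pd g (\<lambda>i j. Y $$ (i, j))"
    unfolding pd_def
  proof (intro allI impI)
    fix x :: "nat \<Rightarrow> real"
    assume x: "\<exists>i<g. x i \<noteq> 0"
    then have "Matrix.vec g x \<noteq> 0\<^sub>v g"
      by (metis index_vec index_zero_vec(1))
    with * have "0 < Matrix.vec g x \<bullet> (Y *\<^sub>v Matrix.vec g x)"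
      by (auto simp: pos_def_mat_def)
    then show "0 < (\<Sum>i<g. \<Sum>j<g. x i * Y $$ (i, j) * x j)"
      by (simp add: scalar_prod_mult_mat_vec[OF Y])
  qed
next
  assume *: "pd g (\<lambda>i j. Y $$ (i, j))"
  show "pos_def_mat g Y"
    unfolding pos_def_mat_def
  proof (intro ballI impI)
    fix v :: "real Matrix.vec"
    assume v: "v \<in> carrier_vec g" "v \<noteq> 0\<^sub>v g"
    then have "\<exists>i<g. v $ i \<noteq> 0"
      by (metis carrier_vecD eq_vecI index_zero_vec)
    then show "0 < v \<bullet> (Y *\<^sub>v v)"
      using * v by (simp add: scalar_prod_mult_mat_vec[OF Y] pd_def)
  qed
qed

text \<open>\<open>X\<close> and \<open>Y\<close> are recovered as the entrywise real and imaginary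
  parts. Membership in the Siegel space is used in this form from here on.\<close>

lemma siegel_iff:
  "Z \<in> siegel g \<longleftrightarrow> Z \<in> carrier_mat g g \<and> transpose_mat Z = Z \<and> pd g (\<lambda>i j. Im (Z $$ (i, j)))"
proof
  assume "Z \<in> siegel g"
  then obtain X Y where XY: "X \<in> carrier_mat g g" "Y \<in> carrier_mat g g"
      "transpose_mat X = X" "transpose_mat Y = Y" "pos_def_mat g Y"
    and Z: "Z = map_mat complex_of_real X + \<i> \<cdot>\<^sub>m map_mat complex_of_real Y"
    unfolding siegel_def by blast
  have "X $$ (i, j) = X $$ (j, i)" "Y $$ (i, j) = Y $$ (j, i)" if "i < g" "j < g" for i j
    using XY that by (metis carrier_matD index_transpose_mat(1))+
  then have "transpose_mat Z = Z"
    using XY by (intro eq_matI) (auto simp: Z)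
  moreover have "pd g (\<lambda>i j. Im (Z $$ (i, j)))"
    using XY(5)[unfolded pos_def_mat_iff_pd[OF XY(2)]]
    by (subst pd_cong[of _ _ "\<lambda>i j. Y $$ (i, j)"]) (use XY in \<open>auto simp: Z\<close>)
  ultimately show "Z \<in> carrier_mat g g \<and> transpose_mat Z = Z \<and> pd g (\<lambda>i j. Im (Z $$ (i, j)))"
    using XY by (simp add: Z)
next
  assume Z: "Z \<in> carrier_mat g g \<and> transpose_mat Z = Z \<and> pd g (\<lambda>i j. Im (Z $$ (i, j)))"
  let ?X = "map_mat Re Z" and ?Y = "map_mat Im Z"
  have ZXY: "Z = map_mat complex_of_real ?X + \<i> \<cdot>\<^sub>m map_mat complex_of_real ?Y"
  proof (rule eq_matI)
    fix i j
    assume "i < dim_row (map_mat complex_of_real ?X + \<i> \<cdot>\<^sub>m map_mat complex_of_real ?Y)"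
      "j < dim_col (map_mat complex_of_real ?X + \<i> \<cdot>\<^sub>m map_mat complex_of_real ?Y)"
    then have "i < dim_row Z" "j < dim_col Z"
      by simp_all
    then show "Z $$ (i, j) = (map_mat complex_of_real ?X + \<i> \<cdot>\<^sub>m map_mat complex_of_real ?Y) $$ (i, j)"
      by (simp add: complex_eq_iff)
  qed (use Z in simp_all)
  have "transpose_mat ?X = ?X" "transpose_mat ?Y = ?Y"
    using Z by (metis map_mat_transpose)+
  moreover have "pos_def_mat g ?Y"
    using Z by (subst pos_def_mat_iff_pd) (auto cong: pd_cong)
  ultimately have "?X \<in> carrier_mat g g \<and> ?Y \<in> carrier_mat g g \<and> transpose_mat ?X = ?X \<and>
      transpose_mat ?Y = ?Y \<and> pos_def_mat g ?Y"
    using Z by simp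
  with ZXY show "Z \<in> siegel g"
    unfolding siegel_def mem_Collect_eq by blast
qed


text \<open>An intrinsic description inside the infinite matrices, in which levels of different size
  can be compared.\<close>

lemma siegel_level_iff:
  "p \<in> siegel_level g \<longleftrightarrow>
    (\<forall>i j. p i j = p j i) \<and> (\<forall>i j. g \<le> i \<or> g \<le> j \<longrightarrow> p i j = (if i = j then \<i> else 0)) \<and>
    pd g (\<lambda>i j. Im (p i j))"
proof
  assume "p \<in> siegel_level g"
  then obtain Z where "Z \<in> siegel g" and p: "p = pad Z"
    unfolding siegel_level_def by (rule imageE)
  then have Z: "Z \<in> carrier_mat g g" "transpose_mat Z = Z" "pd g (\<lambda>i j. Im (Z $$ (i, j)))"
    by (simp_all only: siegel_iff)
  have "Z $$ (i, j) = Z $$ (j, i)" if "i < g" "j < g" for i j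
    using Z that by (metis carrier_matD index_transpose_mat(1))
  moreover have "pd g (\<lambda>i j. Im (p i j))"
    using Z by (subst pd_cong[of _ _ "\<lambda>i j. Im (Z $$ (i, j))"]) (auto simp: p pad_def)
  ultimately show "(\<forall>i j. p i j = p j i) \<and>
      (\<forall>i j. g \<le> i \<or> g \<le> j \<longrightarrow> p i j = (if i = j then \<i> else 0)) \<and> pd g (\<lambda>i j. Im (p i j))"
    using Z by (auto simp: p pad_def)
next
  assume p: "(\<forall>i j. p i j = p j i) \<and>
      (\<forall>i j. g \<le> i \<or> g \<le> j \<longrightarrow> p i j = (if i = j then \<i> else 0)) \<and> pd g (\<lambda>i j. Im (p i j))"
  have "p = pad (siegel_block g p)"
    using p by (intro ext) (auto simp: pad_def siegel_block_def)
  moreover have "siegel_block g p \<in> siegel g"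
    unfolding siegel_iff
  proof (intro conjI)
    show "transpose_mat (siegel_block g p) = siegel_block g p"
      using p by (intro eq_matI) (auto simp: siegel_block_def)
    show "pd g (\<lambda>i j. Im (siegel_block g p $$ (i, j)))"
      using p by (subst pd_cong[of _ _ "\<lambda>i j. Im (p i j)"]) (auto simp: siegel_block_def)
  qed (auto simp: siegel_block_def)
  ultimately show "p \<in> siegel_level g"
    unfolding siegel_level_def by blast
qed

lemma siegel_block_in_siegel:
  assumes "p \<in> siegel_level g"
  shows "siegel_block g p \<in> siegel g" "pad (siegel_block g p) = p"
  using assms siegel_block_pad unfolding siegel_level_def by (auto simp: siegel_iff)

lemma siegel_block_index [simp]: "i < g \<Longrightarrow> j < g \<Longrightarrow> siegel_block g p $$ (i, j) = p i j"
  by (simp add: siegel_block_def)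

lemma siegel_block_carrier [simp]: "siegel_block g p \<in> carrier_mat g g"
  by (simp add: siegel_block_def)

text \<open>Leading blocks inherit positivity: a vector of the smaller size is extended by
  zero.\<close>

lemma pd_mono:
  assumes "pd n Y" "m \<le> n"
  shows "pd m Y"
  unfolding pd_def
proof (intro allI impI)
  fix x :: "nat \<Rightarrow> real"
  assume x: "\<exists>i<m. x i \<noteq> 0"
  let ?x = "\<lambda>i. if i < m then x i else 0"
  have "\<exists>i<n. ?x i \<noteq> 0"
    using x assms(2) by force
  with assms(1) have "0 < (\<Sum>i<n. \<Sum>j<n. ?x i * Y i j * ?x j)"
    unfolding pd_def by (auto dest!: spec[of _ ?x])
  also have "\<dots> = (\<Sum>i<m. \<Sum>j<n. ?x i * Y i j * ?x j)"
    using assms(2) by (intro sum.mono_neutral_right) auto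
  also have "\<dots> = (\<Sum>i<m. \<Sum>j<m. x i * Y i j * x j)"
    using assms(2) by (intro sum.cong sum.mono_neutral_cong_right) auto
  finally show "0 < (\<Sum>i<m. \<Sum>j<m. x i * Y i j * x j)" .
qed

text \<open>Passing to \<open>Suc g\<close> appends a row that vanishes off the diagonal, so the
  Schur complement is the old matrix, and the new corner has imaginary part 1.\<close>

lemma siegel_level_Suc: "siegel_level g \<subseteq> siegel_level (Suc g)"
proof
  fix p
  assume p: "p \<in> siegel_level g"
  then have p': "\<And>i j. p i j = p j i"
      "\<And>i j. g \<le> i \<or> g \<le> j \<Longrightarrow> p i j = (if i = j then \<i> else 0)" "pd g (\<lambda>i j. Im (p i j))"
    unfolding siegel_level_iff by blast+
  have "pd (Suc g) (\<lambda>i j. Im (p i j))"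
  proof (subst pd_Suc_iff, goal_cases)
    case (1 i j)
    then show ?case
      using p'(1)[of i j] by simp
  next
    case 2
    have "p i g = 0" if "i < g" for i
      using p'(2)[of i g] that by simp
    then have "pd g (\<lambda>i j. Im (p i j) - Im (p i g) * Im (p g j) / Im (p g g)) \<longleftrightarrow>
        pd g (\<lambda>i j. Im (p i j))"
      by (intro pd_cong) simp
    moreover have "p g g = \<i>"
      using p'(2)[of g g] by simp
    ultimately show ?case
      using p'(3) by simp
  qed
  then show "p \<in> siegel_level (Suc g)"
    using p' unfolding siegel_level_iff by (meson Suc_leD)
qed

lemma mono_siegel_level: "mono siegel_level"
  unfolding mono_iff_le_Suc using siegel_level_Suc by blast

section \<open>The coordinate domains of the levels\<close>

definition siegel_dom :: "nat \<Rightarrow> (nat \<Rightarrow> complex) set" where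
  "siegel_dom g = siegel_coord ` siegel_level g"

lemma uncoord_siegel_coord_level: "p \<in> siegel_level g \<Longrightarrow> uncoord (siegel_coord p) = p"
  by (rule uncoord_siegel_coord) (simp add: siegel_level_iff)

lemma siegel_dom_iff: "x \<in> siegel_dom g \<longleftrightarrow> uncoord x \<in> siegel_level g"
  unfolding siegel_dom_def using uncoord_siegel_coord_level by force

lemma siegel_dom_iff':
  "x \<in> siegel_dom g \<longleftrightarrow> x \<in> cseq (triangle g) \<and> pd g (\<lambda>i j. Im (uncoord x i j))"
  unfolding siegel_dom_iff siegel_level_iff cseq_triangle_iff by (auto intro: uncoord_sym)

lemma inv_into_siegel_coord:
  "x \<in> siegel_dom g \<Longrightarrow> inv_into (siegel_level g) siegel_coord x = uncoord x"
  using inv_into_f_f[of siegel_coord "siegel_level g" "uncoord x"]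
    inj_on_inverseI[of "siegel_level g" uncoord siegel_coord]
  by (simp add: siegel_dom_iff uncoord_siegel_coord_level)

lemma mono_siegel_dom: "mono siegel_dom"
  using mono_siegel_level unfolding mono_def siegel_dom_iff subset_iff by blast

text \<open>A leading block of a positive definite matrix is positive definite, so a point of a
  higher level without late coordinates already belongs to level \<open>g\<close>. Therefore the
  union of the domains has the expected trace on each coordinate space.\<close>

lemma siegel_dom_Int_cseq:
  assumes "x \<in> siegel_dom g'" "x \<in> cseq (triangle g)"
  shows "x \<in> siegel_dom g"
proof (cases "g \<le> g'")
  case True
  then show ?thesis
    using assms pd_mono unfolding siegel_dom_iff' by blast
next
  case False
  then show ?thesis
    using assms(1) monoD[OF mono_siegel_dom, of g' g] by auto
qed

lemma tendsto_uncoord: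
  assumes "(f \<longlongrightarrow> x) F"
  shows "((\<lambda>t. uncoord (f t) i j) \<longlongrightarrow> uncoord x i j) F"
  using assms unfolding uncoord_def tendsto_fun_iff by (intro tendsto_add tendsto_const) blast

text \<open>Positivity is an open condition by \<open>pd_eventually\<close>. The vanishing of late
  coordinates is a closed one and has to be assumed along the filter.\<close>

lemma eventually_siegel_dom:
  assumes "x \<in> siegel_dom g" "(f \<longlongrightarrow> x) F" "eventually (\<lambda>t. f t \<in> cseq (triangle g)) F"
  shows "eventually (\<lambda>t. f t \<in> siegel_dom g) F"
proof -
  have "eventually (\<lambda>t. pd g (\<lambda>i j. Im (uncoord (f t) i j))) F"
  proof (rule pd_eventually[of _ _ "\<lambda>i j. Im (uncoord x i j)"])
    show "Im (uncoord y i j) = Im (uncoord y j i)" for y i j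
      by (subst uncoord_sym) (rule refl)
    then show "Im (uncoord x i j) = Im (uncoord x j i)" for i j .
    show "((\<lambda>t. Im (uncoord (f t) i j)) \<longlongrightarrow> Im (uncoord x i j)) F" for i j
      by (intro tendsto_Im tendsto_uncoord assms)
    show "pd g (\<lambda>i j. Im (uncoord x i j))"
      using assms(1) by (simp add: siegel_dom_iff')
  qed
  with assms(3) show ?thesis
    by eventually_elim (simp add: siegel_dom_iff')
qed

lemma openin_siegel_dom: "openin (top_of_set (cseq (triangle g))) (siegel_dom g)"
proof (rule openin_top_of_setI)
  show "siegel_dom g \<subseteq> cseq (triangle g)"
    by (auto simp: siegel_dom_iff')
  fix x
  assume "x \<in> siegel_dom g"
  then show "\<forall>\<^sub>F y in at x within cseq (triangle g). y \<in> siegel_dom g"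
    by (rule eventually_siegel_dom) (auto intro: tendsto_ident_at simp: eventually_at_filter)
qed

lemma tendsto_line:
  fixes x v :: "nat \<Rightarrow> complex"
  assumes "(f \<longlongrightarrow> 0) F"
  shows "((\<lambda>t j. x j + f t * v j) \<longlongrightarrow> x) F"
  unfolding tendsto_fun_iff
proof
  show "((\<lambda>t. x k + f t * v k) \<longlongrightarrow> x k) F" for k
    using tendsto_add[OF tendsto_const[of "x k"] tendsto_mult_left_zero[OF assms, of "v k"]] by simp
qed

text \<open>The parameter is an arbitrary function tending to 0, so that complex lines (for Gateaux
  derivatives) and real lines (for smoothness) are covered together.\<close>

lemma line_in_siegel_dom:
  assumes "x \<in> siegel_dom g" "v \<in> cseq (triangle g)" "(f \<longlongrightarrow> 0) F"
  shows "eventually (\<lambda>t. (\<lambda>j. x j + f t * v j) \<in> siegel_dom g) F"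
proof (rule eventually_siegel_dom[OF assms(1) tendsto_line[OF assms(3)]])
  have "(\<lambda>j. x j + f t * v j) \<in> cseq (triangle g)" for t
    using assms(1,2) unfolding siegel_dom_iff' by (intro cseq_line) auto
  then show "\<forall>\<^sub>F t in F. (\<lambda>j. x j + f t * v j) \<in> cseq (triangle g)"
    by (intro always_eventually allI)
qed

abbreviation level_map ::
  "nat \<Rightarrow> ((nat \<Rightarrow> nat \<Rightarrow> complex) \<Rightarrow> nat \<Rightarrow> nat \<Rightarrow> complex) \<Rightarrow> (nat \<Rightarrow> complex) \<Rightarrow> nat \<Rightarrow> complex" where
  "level_map g F \<equiv> siegel_coord \<circ> F \<circ> inv_into (siegel_level g) siegel_coord"

lemma siegel_coord_in_dom: "p \<in> siegel_level g \<Longrightarrow> siegel_coord p \<in> siegel_dom g"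
  by (simp add: siegel_dom_def)

lemma level_map_eq: "x \<in> siegel_dom g \<Longrightarrow> level_map g F x = siegel_coord (F (uncoord x))"
  by (simp add: inv_into_siegel_coord)

text \<open>\<open>inv_into\<close> has no useful value off the domain, but the derivative does not
  see such points: the line stays in \<open>siegel_dom g\<close> for small parameters. Comparisons
  between coordinate expressions of maps go through this lemma.\<close>

lemma has_gateaux_deriv_dom_cong:
  assumes d: "has_gateaux_deriv M f (siegel_coord p) v d"
    and p: "p \<in> siegel_level g" and v: "v \<in> cseq (triangle g)"
    and eq: "\<And>x. x \<in> siegel_dom g \<Longrightarrow> f x = f' x"
  shows "has_gateaux_deriv M f' (siegel_coord p) v d"
proof (rule has_gateaux_deriv_cong[OF d])
  show "f (siegel_coord p) = f' (siegel_coord p)"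
    by (rule eq[OF siegel_coord_in_dom[OF p]])
  have "\<forall>\<^sub>F t::complex in at 0. (\<lambda>j. siegel_coord p j + t * v j) \<in> siegel_dom g"
    by (rule line_in_siegel_dom[OF siegel_coord_in_dom[OF p] v]) (rule tendsto_ident_at)
  then show "\<forall>\<^sub>F t::complex in at 0.
      f (\<lambda>j. siegel_coord p j + t * v j) = f' (\<lambda>j. siegel_coord p j + t * v j)"
    by eventually_elim (rule eq)
qed

lemma continuous_on_matrix_entry:
  "continuous_on A (\<lambda>p :: 'i \<Rightarrow> 'j \<Rightarrow> 'c::topological_space. p i j)"
  by (rule continuous_on_product_then_coordinatewise)
    (rule continuous_on_subset[OF continuous_on_product_coordinates], simp)

lemma continuous_on_siegel_coord: "continuous_on A siegel_coord"
proof (rule continuous_on_coordinatewise_then_product)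
  fix n
  obtain i k where "prod_decode n = (i, k)"
    by (cases "prod_decode n")
  then have "siegel_coord p n = p i (i + k) - (if k = 0 then \<i> else 0)" for p
    by (simp add: siegel_coord_def)
  then show "continuous_on A (\<lambda>p. siegel_coord p n)"
    by (simp only:) (intro continuous_on_diff continuous_on_const continuous_on_matrix_entry)
qed

lemma continuous_on_uncoord: "continuous_on A uncoord"
  by (intro continuous_on_coordinatewise_then_product)
    (auto simp: uncoord_def intro!: continuous_on_add continuous_on_const continuous_on_subset[OF continuous_on_product_coordinates])


section \<open>The symplectic action\<close>

lemma four_block_mat_eqD:
  assumes eq: "four_block_mat A B C D = four_block_mat A' B' C' D'"
    and c: "A \<in> carrier_mat n n" "B \<in> carrier_mat n n" "C \<in> carrier_mat n n" "D \<in> carrier_mat n n"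
      "A' \<in> carrier_mat n n" "B' \<in> carrier_mat n n" "C' \<in> carrier_mat n n" "D' \<in> carrier_mat n n"
  shows "A = A'" "B = B'" "C = C'" "D = D'"
proof -
  have e: "four_block_mat A B C D $$ (i, j) = four_block_mat A' B' C' D' $$ (i, j)" for i j
    by (simp add: eq)
  have "A $$ (i, j) = A' $$ (i, j) \<and> B $$ (i, j) = B' $$ (i, j) \<and>
      C $$ (i, j) = C' $$ (i, j) \<and> D $$ (i, j) = D' $$ (i, j)" if "i < n" "j < n" for i j
    using e[of i j] e[of i "j + n"] e[of "i + n" j] e[of "i + n" "j + n"] c that
    by (simp add: index_mat_four_block)
  then show "A = A'" "B = B'" "C = C'" "D = D'"
    using c by (auto intro!: eq_matI)
qed

abbreviation cnj_mat :: "complex mat \<Rightarrow> complex mat" where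
  "cnj_mat \<equiv> map_mat cnj"

lemma cnj_mat_mult:
  assumes "A \<in> carrier_mat n n" "B \<in> carrier_mat n n"
  shows "cnj_mat (A * B) = cnj_mat A * cnj_mat B"
  by (rule eq_matI) (use assms in \<open>auto simp: scalar_prod_def\<close>)

lemma cnj_mat_inv:
  assumes A: "A \<in> carrier_mat n n" and d: "det A \<noteq> 0"
  shows "det (cnj_mat A) \<noteq> 0" "cnj_mat (mat_inv A) = mat_inv (cnj_mat A)"
proof -
  have "cnj_mat A * cnj_mat (mat_inv A) = cnj_mat (A * mat_inv A)"
    using cnj_mat_mult[OF A mat_inv(3)[OF A d]] by simp
  also have "\<dots> = 1\<^sub>m n"
    unfolding mat_inv(1)[OF A d] by (rule eq_matI) auto
  finally have "cnj_mat A * cnj_mat (mat_inv A) = 1\<^sub>m n" .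
  from mat_inv_unique[OF _ _ this] A mat_inv(3)[OF A d]
  show "det (cnj_mat A) \<noteq> 0" "cnj_mat (mat_inv A) = mat_inv (cnj_mat A)"
    by auto
qed

text \<open>The imaginary part as a complex matrix, so that it can be multiplied with complex
  denominators.\<close>

definition im_mat :: "complex mat \<Rightarrow> complex mat" where
  "im_mat Z = map_mat (\<lambda>z. complex_of_real (Im z)) Z"

lemma im_mat_carrier [simp]: "im_mat Z \<in> carrier_mat n m \<longleftrightarrow> Z \<in> carrier_mat n m"
  by (simp add: im_mat_def)

lemma cnj_im_mat [simp]: "cnj_mat (im_mat Z) = im_mat Z"
  by (rule eq_matI) (auto simp: im_mat_def)

lemma minus_cnj_mat:
  "Z - cnj_mat Z = (2 * \<i>) \<cdot>\<^sub>m im_mat Z"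
  by (rule eq_matI) (auto simp: im_mat_def complex_eq_iff)

text \<open>Cross terms between the real and imaginary parts of \<open>w\<close> are purely
  imaginary, so the real part is the sum of the values of the real form at both parts.\<close>

lemma pd_complex:
  assumes "pd n Y" "\<exists>i<n. w i \<noteq> 0"
  shows "0 < Re (\<Sum>i<n. \<Sum>j<n. cnj (w i) * complex_of_real (Y i j) * w j)"
proof -
  let ?q = "\<lambda>x. \<Sum>i<n. \<Sum>j<n. x i * Y i j * x j"
  have "Re (\<Sum>i<n. \<Sum>j<n. cnj (w i) * complex_of_real (Y i j) * w j) =
      ?q (\<lambda>i. Re (w i)) + ?q (\<lambda>i. Im (w i))"
    by (simp add: sum.distrib[symmetric] algebra_simps)
  moreover have nonneg: "0 \<le> ?q x" for x
  proof (cases "\<exists>i<n. x i \<noteq> 0")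
    case True
    then show ?thesis
      using assms(1) unfolding pd_def by (simp add: less_imp_le)
  next
    case False
    then have "?q x = 0"
      by (intro sum.neutral ballI) simp
    then show ?thesis
      by simp
  qed
  moreover have "0 < ?q (\<lambda>i. Re (w i)) \<or> 0 < ?q (\<lambda>i. Im (w i))"
  proof -
    have pos: "0 < ?q x" if "i < n" "x i \<noteq> 0" for x i
      using assms(1)[unfolded pd_def, rule_format, of x] that by blast
    obtain i where "i < n" "Re (w i) \<noteq> 0 \<or> Im (w i) \<noteq> 0"
      using assms(2) by (auto simp: complex_eq_iff)
    then show ?thesis
      using pos[of i "\<lambda>i. Re (w i)"] pos[of i "\<lambda>i. Im (w i)"] by blast
  qed
  ultimately show ?thesis
    using nonneg[of "\<lambda>i. Re (w i)"] nonneg[of "\<lambda>i. Im (w i)"] by linarith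
qed

lemma im_mat_form_pos:
  assumes Z: "Z \<in> siegel g" and w: "w \<in> carrier_vec g" "w \<noteq> 0\<^sub>v g"
  shows "0 < Re (map_vec cnj w \<bullet> (im_mat Z *\<^sub>v w))"
proof -
  have Z': "Z \<in> carrier_mat g g" "pd g (\<lambda>i j. Im (Z $$ (i, j)))"
    using Z by (auto simp: siegel_iff)
  have ne: "\<exists>i<g. w $ i \<noteq> 0"
    using w by (metis carrier_vecD eq_vecI index_zero_vec)
  have "map_vec cnj w \<bullet> (im_mat Z *\<^sub>v w) =
      (\<Sum>i<g. \<Sum>j<g. map_vec cnj w $ i * im_mat Z $$ (i, j) * w $ j)"
    by (rule scalar_prod_mult_mat_vec) (use Z' w in auto)
  also have "\<dots> = (\<Sum>i<g. \<Sum>j<g. cnj (w $ i) * complex_of_real (Im (Z $$ (i, j))) * w $ j)"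
    by (intro sum.cong refl) (use Z' w in \<open>auto simp: im_mat_def\<close>)
  finally show ?thesis
    using pd_complex[OF Z'(2) ne] by simp
qed

text \<open>A nonzero kernel vector would make the form in \<open>im_mat_form_pos\<close>
  vanish.\<close>

lemma det_im_mat:
  assumes Z: "Z \<in> siegel g"
  shows "det (im_mat Z) \<noteq> 0"
proof (rule det_nonzeroI)
  show "im_mat Z \<in> carrier_mat g g"
    using Z by (simp add: siegel_iff)
  fix w :: "complex Matrix.vec"
  assume w: "w \<in> carrier_vec g" "im_mat Z *\<^sub>v w = 0\<^sub>v g"
  show "w = 0\<^sub>v g"
    using im_mat_form_pos[OF Z w(1)] w by (auto simp: scalar_prod_def)
qed

text \<open>The symplectic relations for a real block matrix, transported to complex matrices; being
  real becomes invariance under conjugation. The last two relations are transposes of each other,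
  and the expansion in \<open>denom_numer\<close> rewrites with both.\<close>

definition symplectic_blocks ::
  "nat \<Rightarrow> complex mat \<Rightarrow> complex mat \<Rightarrow> complex mat \<Rightarrow> complex mat \<Rightarrow> bool" where
  "symplectic_blocks g A B C D \<longleftrightarrow>
     A \<in> carrier_mat g g \<and> B \<in> carrier_mat g g \<and> C \<in> carrier_mat g g \<and> D \<in> carrier_mat g g \<and>
     cnj_mat A = A \<and> cnj_mat B = B \<and> cnj_mat C = C \<and> cnj_mat D = D \<and>
     transpose_mat C * A = transpose_mat A * C \<and> transpose_mat D * B = transpose_mat B * D \<and>
     transpose_mat A * D = 1\<^sub>m g + transpose_mat C * B \<and>
     transpose_mat D * A = 1\<^sub>m g + transpose_mat B * C"

text \<open>Used in both directions: to read off the block relations of a given symplectic matrix,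
  and to check the explicit matrix of a symmetry.\<close>

lemma symplectic_form_product:
  fixes A B C D :: "'a::comm_ring_1 mat"
  assumes [simp]: "A \<in> carrier_mat g g" "B \<in> carrier_mat g g" "C \<in> carrier_mat g g" "D \<in> carrier_mat g g"
  shows "transpose_mat (four_block_mat A B C D) *
      four_block_mat (0\<^sub>m g g) (1\<^sub>m g) (- 1\<^sub>m g) (0\<^sub>m g g) * four_block_mat A B C D =
    four_block_mat (transpose_mat A * C - transpose_mat C * A)
      (transpose_mat A * D - transpose_mat C * B)
      (transpose_mat B * C - transpose_mat D * A) (transpose_mat B * D - transpose_mat D * B)"
proof -
  have [simp]: "X * - 1\<^sub>m g = - X" if "X \<in> carrier_mat g g" for X :: "'a mat"
    using that by (simp add: uminus_mult_right_mat)
  have [simp]: "X * 0\<^sub>m g g = 0\<^sub>m g g" "X * 1\<^sub>m g = X" if "X \<in> carrier_mat g g" for X :: "'a mat"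
    using that by auto
  have [simp]: "- X + 0\<^sub>m g g = - X" "0\<^sub>m g g + X = X" "X + 0\<^sub>m g g = X" "0\<^sub>m g g + - X = - X"
    if "X \<in> carrier_mat g g" for X :: "'a mat"
    using that by auto
  have e: "- X * Y + V * W = V * W - X * Y"
    if "X \<in> carrier_mat g g" "Y \<in> carrier_mat g g" "V \<in> carrier_mat g g" "W \<in> carrier_mat g g"
    for X Y V W :: "'a mat"
  proof -
    have "- X * Y = - (X * Y)"
      using that by (intro uminus_mult_left_mat) auto
    moreover have "X * Y \<in> carrier_mat g g" "V * W \<in> carrier_mat g g"
      using that by auto
    moreover have "- P + Q = Q - P" if "P \<in> carrier_mat g g" "Q \<in> carrier_mat g g"
      for P Q :: "'a mat"
      by (rule eq_matI) (use that in auto)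
    ultimately show ?thesis
      by simp
  qed
  have "transpose_mat (four_block_mat A B C D) *
      four_block_mat (0\<^sub>m g g) (1\<^sub>m g) (- 1\<^sub>m g) (0\<^sub>m g g) =
    four_block_mat (- transpose_mat C) (transpose_mat A) (- transpose_mat D) (transpose_mat B)"
    by (subst transpose_four_block_mat[of _ g g _ g _ g], simp_all)
      (subst mult_four_block_mat[of _ g g _ g _ g _ _ g _ g], simp_all)
  then show ?thesis
    by (simp only:) (subst mult_four_block_mat[of _ g g _ g _ g _ _ g _ g], simp_all add: e)
qed

text \<open>The relations are derived for the real blocks and then mapped entrywise to complex
  matrices, since that is where the action lives.\<close>

lemma symplectic_group_blocks:
  assumes M: "M \<in> symplectic_group g"
  obtains A B C D where "symplectic_blocks g A B C D"
    "\<And>Z. symplectic_act g M Z = (A * Z + B) * mat_inv (C * Z + D)"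
proof -
  obtain A B C D where s: "split_block M g g = (A, B, C, D)"
    by (cases "split_block M g g")
  have dims: "dim_row M = g + g" "dim_col M = g + g"
    using M by (auto simp: symplectic_group_def)
  note b = split_block[OF s dims]
  have "four_block_mat (transpose_mat A * C - transpose_mat C * A)
      (transpose_mat A * D - transpose_mat C * B)
      (transpose_mat B * C - transpose_mat D * A) (transpose_mat B * D - transpose_mat D * B) =
      four_block_mat (0\<^sub>m g g) (1\<^sub>m g) (- 1\<^sub>m g) (0\<^sub>m g g)"
    using M symplectic_form_product[OF b(1-4)] b(5)
    by (simp add: symplectic_group_def symplectic_form_def)
  from four_block_mat_eqD[OF this] b(1-4)
  have rel: "transpose_mat A * C - transpose_mat C * A = 0\<^sub>m g g"
      "transpose_mat A * D - transpose_mat C * B = 1\<^sub>m g"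
      "transpose_mat B * C - transpose_mat D * A = - 1\<^sub>m g"
      "transpose_mat B * D - transpose_mat D * B = 0\<^sub>m g g"
    by (meson minus_carrier_mat mult_carrier_mat one_carrier_mat transpose_carrier_mat
        uminus_carrier_mat zero_carrier_mat)+
  have diff: "X = Y + E" if "X - Y = E" "X \<in> carrier_mat g g" "Y \<in> carrier_mat g g"
    for X Y E :: "real mat"
    using that by (auto intro!: eq_matI)
  let ?c = "map_mat complex_of_real"
  have cm: "transpose_mat (?c X) * ?c Y = ?c (transpose_mat X * Y)"
    if "X \<in> carrier_mat g g" "Y \<in> carrier_mat g g" for X Y :: "real mat"
    by (rule eq_matI) (use that in \<open>auto simp: scalar_prod_def\<close>)
  have 1: "transpose_mat C * A = transpose_mat A * C"
    using diff[OF rel(1)] b(1-4) by (metis left_add_zero_mat mult_carrier_mat right_add_zero_mat transpose_carrier_mat)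
  have 2: "transpose_mat D * B = transpose_mat B * D"
    using diff[OF rel(4)] b(1-4) by (metis mult_carrier_mat right_add_zero_mat transpose_carrier_mat)
  have 3: "transpose_mat A * D = 1\<^sub>m g + transpose_mat C * B"
  proof -
    have "transpose_mat A * D = transpose_mat C * B + 1\<^sub>m g"
      using b(1-4) by (intro diff[OF rel(2)]) auto
    also have "\<dots> = 1\<^sub>m g + transpose_mat C * B"
      using b(1-4) by (intro comm_add_mat[of _ g g]) auto
    finally show ?thesis .
  qed
  have 4: "transpose_mat D * A = 1\<^sub>m g + transpose_mat B * C"
  proof (rule eq_matI)
    fix i j
    assume ij: "i < dim_row (1\<^sub>m g + transpose_mat B * C)" "j < dim_col (1\<^sub>m g + transpose_mat B * C)"
    have "(transpose_mat B * C - transpose_mat D * A) $$ (i, j) = (- 1\<^sub>m g) $$ (i, j)"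
      using rel(3) by simp
    then show "(transpose_mat D * A) $$ (i, j) = (1\<^sub>m g + transpose_mat B * C) $$ (i, j)"
      using ij b(1-4) by (auto simp del: index_mult_mat(1) split: if_splits)
  qed (use b(1-4) in auto)
  have plus: "?c (1\<^sub>m g + X) = 1\<^sub>m g + ?c X" if "X \<in> carrier_mat g g" for X
    using that by (auto intro!: eq_matI)
  have "symplectic_blocks g (?c A) (?c B) (?c C) (?c D)"
    unfolding symplectic_blocks_def
    using b(1-4) by (auto simp: cm 1 2 3 4 plus intro!: eq_matI simp del: index_mult_mat(1))
  moreover have "split_block (?c M) g g = (?c A, ?c B, ?c C, ?c D)"
    using s dims by (auto simp: split_block_def Let_def intro!: eq_matI)
  then have "symplectic_act g M Z = (?c A * Z + ?c B) * mat_inv (?c C * Z + ?c D)" for Z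
    by (simp add: symplectic_act_def mat_inv_def)
  ultimately show ?thesis
    using that by blast
qed


lemma mat_expand:
  fixes P Q R S :: "'a::comm_ring_1 mat"
  assumes "P \<in> carrier_mat n n" "Q \<in> carrier_mat n n" "R \<in> carrier_mat n n" "S \<in> carrier_mat n n"
  shows "(P + Q) * (R + S) = (P * R + P * S) + (Q * R + Q * S)"
proof -
  have "(P + Q) * (R + S) = P * (R + S) + Q * (R + S)"
    by (rule add_mult_distrib_mat) (use assms in auto)
  also have "P * (R + S) = P * R + P * S"
    by (rule mult_add_distrib_mat) (use assms in auto)
  also have "Q * (R + S) = Q * R + Q * S"
    by (rule mult_add_distrib_mat) (use assms in auto)
  finally show ?thesis .
qed

lemma mat_cancel_left:
  fixes P :: "'a::comm_ring_1 mat"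
  assumes "P * Q = 1\<^sub>m n" "P \<in> carrier_mat n n" "Q \<in> carrier_mat n n" "R \<in> carrier_mat n n"
  shows "P * (Q * R) = R"
proof -
  have "P * (Q * R) = P * Q * R"
    by (rule assoc_mult_mat[symmetric]) (use assms in auto)
  then show ?thesis
    using assms by simp
qed

lemma cnj_mat_mult_vec:
  assumes "E \<in> carrier_mat n n" "w \<in> carrier_vec n"
  shows "cnj_mat E *\<^sub>v map_vec cnj w = map_vec cnj (E *\<^sub>v w)"
  by (rule eq_vecI) (use assms in \<open>auto simp: scalar_prod_def\<close>)

lemma smult_mat_mult_vec:
  fixes E :: "'a::comm_ring_1 mat"
  assumes "E \<in> carrier_mat n n" "w \<in> carrier_vec n"
  shows "(k \<cdot>\<^sub>m E) *\<^sub>v w = k \<cdot>\<^sub>v (E *\<^sub>v w)"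
  by (rule eq_vecI) (use assms in \<open>auto simp: scalar_prod_def sum_distrib_left mult.assoc\<close>)

locale symplectic_action =
  fixes g :: nat and A B C D :: "complex mat"
  assumes blocks: "symplectic_blocks g A B C D"
begin

definition numer :: "complex mat \<Rightarrow> complex mat" where "numer Z = A * Z + B"
definition denom :: "complex mat \<Rightarrow> complex mat" where "denom Z = C * Z + D"
definition act :: "complex mat \<Rightarrow> complex mat" where "act Z = numer Z * mat_inv (denom Z)"

lemma carriers [simp]:
  "A \<in> carrier_mat g g" "B \<in> carrier_mat g g" "C \<in> carrier_mat g g" "D \<in> carrier_mat g g"
  using blocks by (auto simp: symplectic_blocks_def)

text \<open>Instantiating all dimensions with \<open>g\<close> leaves no inner dimension to guess,
  so the simplifier can discharge carrier conditions and associate products to the right.\<close>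

lemmas square_mat_simps [simp] =
  assoc_mult_mat[where ?n\<^sub>1.0 = g and ?n\<^sub>2.0 = g and ?n\<^sub>3.0 = g and ?n\<^sub>4.0 = g]
  mult_carrier_mat[where nr = g and n = g and nc = g]
  left_mult_one_mat[where nr = g and nc = g] right_mult_one_mat[where nr = g and nc = g]

lemma numer_carrier [simp]: "Z \<in> carrier_mat g g \<Longrightarrow> numer Z \<in> carrier_mat g g"
  by (simp add: numer_def)

lemma denom_carrier [simp]: "Z \<in> carrier_mat g g \<Longrightarrow> denom Z \<in> carrier_mat g g"
  by (simp add: denom_def)

text \<open>The column formed by \<open>numer Z\<close> and \<open>denom Z\<close> is the block
  matrix applied to the column \<open>(Z, 1)\<close>. Up to sign, the identity says that the
  symplectic form has the same value on the images of \<open>(Z, 1)\<close> and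
  \<open>(Z', 1)\<close> as on these columns themselves.\<close>

lemma denom_numer:
  assumes Z [simp]: "Z \<in> carrier_mat g g" and sym: "transpose_mat Z = Z"
    and Z' [simp]: "Z' \<in> carrier_mat g g"
  shows "transpose_mat (denom Z) * numer Z' - transpose_mat (numer Z) * denom Z' = Z' - Z"
proof -
  have tr: "transpose_mat (X * Z + Y) = Z * transpose_mat X + transpose_mat Y"
    if "X \<in> carrier_mat g g" "Y \<in> carrier_mat g g" for X Y
    using that transpose_add[of "X * Z" g g Y] transpose_mult[of X g g Z g] by (simp add: sym)
  let ?S1 = "Z * (transpose_mat A * (C * Z'))" and ?S2 = "Z * (transpose_mat C * B)"
    and ?S3 = "transpose_mat B * (C * Z')" and ?S4 = "transpose_mat B * D"
  have l1: "Z * transpose_mat C * (A * Z') = ?S1"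
  proof -
    have "Z * transpose_mat C * (A * Z') = Z * ((transpose_mat C * A) * Z')"
      by simp
    also have "transpose_mat C * A = transpose_mat A * C"
      using blocks by (simp add: symplectic_blocks_def)
    finally show ?thesis
      by simp
  qed
  have l2: "transpose_mat D * (A * Z') = Z' + ?S3"
  proof -
    have "transpose_mat D * (A * Z') = (transpose_mat D * A) * Z'"
      by simp
    also have "transpose_mat D * A = 1\<^sub>m g + transpose_mat B * C"
      using blocks by (simp add: symplectic_blocks_def)
    also have "\<dots> * Z' = 1\<^sub>m g * Z' + transpose_mat B * C * Z'"
      by (rule add_mult_distrib_mat[where nr = g and n = g and nc = g]) auto
    finally show ?thesis
      by simp
  qed
  have l3: "Z * transpose_mat A * D = Z + ?S2"
  proof -
    have "Z * transpose_mat A * D = Z * (transpose_mat A * D)"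
      by simp
    also have "transpose_mat A * D = 1\<^sub>m g + transpose_mat C * B"
      using blocks by (simp add: symplectic_blocks_def)
    also have "Z * \<dots> = Z * 1\<^sub>m g + Z * (transpose_mat C * B)"
      by (rule mult_add_distrib_mat[where nr = g and n = g and nc = g]) auto
    finally show ?thesis
      by simp
  qed
  have l4: "transpose_mat D * B = ?S4"
    using blocks by (simp add: symplectic_blocks_def)
  have lhs: "transpose_mat (denom Z) * numer Z' = (?S1 + ?S2) + ((Z' + ?S3) + ?S4)"
    unfolding denom_def numer_def tr[OF carriers(3,4)]
    by (subst mat_expand[of _ g]) (simp_all only: l1 l2 l4, simp_all)
  have rhs: "transpose_mat (numer Z) * denom Z' = (?S1 + (Z + ?S2)) + (?S3 + ?S4)"
    unfolding denom_def numer_def tr[OF carriers(1,2)]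
    by (subst mat_expand[of _ g]) (simp_all only: l3, simp_all)
  \<comment> \<open>The terms \<open>?S1\<close> to \<open>?S4\<close> occur in both products and
    cancel; what survives comes from the identity matrices in the last two relations.\<close>
  have "S1 + S2 + (Z' + S3 + S4) - (S1 + (Z + S2) + (S3 + S4)) = Z' - Z"
    if "S1 \<in> carrier_mat g g" "S2 \<in> carrier_mat g g" "S3 \<in> carrier_mat g g" "S4 \<in> carrier_mat g g"
    for S1 S2 S3 S4
    by (rule eq_matI) (use that carrier_matD[OF Z] carrier_matD[OF Z'] in auto)
  from this[of ?S1 ?S2 ?S3 ?S4] show ?thesis
    unfolding lhs rhs by simp
qed

lemma denom_numer_sym:
  assumes Z: "Z \<in> carrier_mat g g" "transpose_mat Z = Z"
  shows "transpose_mat (denom Z) * numer Z = transpose_mat (numer Z) * denom Z"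
proof -
  have "X = Y" if "X - Y = Z - Z" "X \<in> carrier_mat g g" "Y \<in> carrier_mat g g" for X Y
  proof (rule eq_matI)
    fix i j
    assume ij: "i < dim_row Y" "j < dim_col Y"
    have "(X - Y) $$ (i, j) = (Z - Z) $$ (i, j)"
      by (simp add: that(1))
    with ij that(2,3) Z show "X $$ (i, j) = Y $$ (i, j)"
      by simp
  qed (use that in auto)
  from this[OF denom_numer[OF Z Z(1)]] show ?thesis
    using Z by simp
qed

lemma act_carrier [simp]:
  assumes "Z \<in> carrier_mat g g" "det (denom Z) \<noteq> 0"
  shows "act Z \<in> carrier_mat g g"
  using assms mat_inv[of "denom Z" g] by (simp add: act_def)

text \<open>\<open>denom_numer\<close> with both points equal says that the transposed denominator
  times the numerator is symmetric. Removing the denominators on both sides gives the second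
  expression for \<open>act Z\<close>, and with it the symmetry.\<close>

lemma act_transposed:
  assumes Z: "Z \<in> carrier_mat g g" "transpose_mat Z = Z" "det (denom Z) \<noteq> 0"
  shows "act Z = transpose_mat (mat_inv (denom Z)) * transpose_mat (numer Z)"
    and "transpose_mat (act Z) = act Z"
proof -
  define Q P Qi where "Q = denom Z" and "P = numer Z" and "Qi = mat_inv Q"
  have c [simp]: "Q \<in> carrier_mat g g" "P \<in> carrier_mat g g" "Qi \<in> carrier_mat g g"
    using Z mat_inv[of Q g] by (auto simp: Q_def P_def Qi_def)
  have inv: "Q * Qi = 1\<^sub>m g" "Qi * Q = 1\<^sub>m g"
    using Z mat_inv[of Q g] by (auto simp: Q_def Qi_def)
  have invt: "transpose_mat Qi * transpose_mat Q = 1\<^sub>m g"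
    using transpose_mult[of Q g g Qi g] by (simp add: inv)
  have "P * Qi = transpose_mat Qi * (transpose_mat Q * (P * Qi))"
    by (rule mat_cancel_left[OF invt, symmetric]) auto
  also have "\<dots> = transpose_mat Qi * ((transpose_mat Q * P) * Qi)"
    by simp
  also have "transpose_mat Q * P = transpose_mat P * Q"
    using denom_numer_sym[OF Z(1,2)] by (simp add: Q_def P_def)
  also have "transpose_mat Qi * (transpose_mat P * Q * Qi) = transpose_mat Qi * (transpose_mat P * (Q * Qi))"
    by simp
  also have "\<dots> = transpose_mat Qi * transpose_mat P"
    by (simp add: inv)
  finally show 1: "act Z = transpose_mat (mat_inv (denom Z)) * transpose_mat (numer Z)"
    by (simp add: act_def Q_def P_def Qi_def)
  have "transpose_mat (P * Qi) = transpose_mat Qi * transpose_mat P"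
    by (rule transpose_mult[where nr = g and n = g and nc = g]) auto
  with 1 show "transpose_mat (act Z) = act Z"
    by (simp add: act_def Q_def P_def Qi_def)
qed

text \<open>Multiply \<open>denom_numer\<close> by the inverse denominators on both sides; by
  \<open>act_transposed\<close> the subtracted term becomes \<open>act Z\<close>. It is stated
  beyond the Siegel space, since \<open>im_act\<close> applies it with the conjugate of a
  point.\<close>

lemma act_diff:
  assumes Z: "Z \<in> carrier_mat g g" "transpose_mat Z = Z" "det (denom Z) \<noteq> 0"
    and Z': "Z' \<in> carrier_mat g g" "det (denom Z') \<noteq> 0"
  shows "act Z' - act Z = transpose_mat (mat_inv (denom Z)) * ((Z' - Z) * mat_inv (denom Z'))"
proof -
  define Q P Qi where "Q = denom Z" and "P = numer Z" and "Qi = mat_inv Q"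
  define Q' P' Qi' where "Q' = denom Z'" and "P' = numer Z'" and "Qi' = mat_inv Q'"
  have c [simp]: "Q \<in> carrier_mat g g" "P \<in> carrier_mat g g" "Qi \<in> carrier_mat g g"
     "Q' \<in> carrier_mat g g" "P' \<in> carrier_mat g g" "Qi' \<in> carrier_mat g g"
    using Z Z' mat_inv[of Q g] mat_inv[of Q' g]
    by (auto simp: Q_def P_def Qi_def Q'_def P'_def Qi'_def)
  have inv: "Qi * Q = 1\<^sub>m g" "Q * Qi = 1\<^sub>m g" "Q' * Qi' = 1\<^sub>m g"
    using Z mat_inv[of Q g] Z' mat_inv[of Q' g] by (auto simp: Q_def Qi_def Q'_def Qi'_def)
  have invt: "transpose_mat Qi * transpose_mat Q = 1\<^sub>m g"
    using transpose_mult[of Q g g Qi g] by (simp add: inv)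
  have "(Z' - Z) * Qi' = (transpose_mat Q * P' - transpose_mat P * Q') * Qi'"
    using denom_numer[OF Z(1,2) Z'(1)] by (simp add: Q_def P_def Q'_def P'_def)
  also have "\<dots> = transpose_mat Q * P' * Qi' - transpose_mat P * Q' * Qi'"
    by (rule minus_mult_distrib_mat[where nr = g and n = g and nc = g]) auto
  also have "\<dots> = transpose_mat Q * (P' * Qi') - transpose_mat P"
    by (simp add: inv)
  finally have "transpose_mat Qi * ((Z' - Z) * Qi') =
      transpose_mat Qi * (transpose_mat Q * (P' * Qi') - transpose_mat P)"
    by simp
  also have "\<dots> = transpose_mat Qi * (transpose_mat Q * (P' * Qi')) - transpose_mat Qi * transpose_mat P"
    by (rule mult_minus_distrib_mat[where nr = g and n = g and nc = g]) auto
  also have "transpose_mat Qi * (transpose_mat Q * (P' * Qi')) = P' * Qi'"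
    by (rule mat_cancel_left[OF invt]) auto
  finally show ?thesis
    using act_transposed(1)[OF Z] by (simp add: act_def Q_def P_def Qi_def Q'_def P'_def Qi'_def)
qed

lemma cnj_numer: "Z \<in> carrier_mat g g \<Longrightarrow> cnj_mat (numer Z) = numer (cnj_mat Z)"
  and cnj_denom: "Z \<in> carrier_mat g g \<Longrightarrow> cnj_mat (denom Z) = denom (cnj_mat Z)"
proof -
  have plus: "cnj_mat (X + Y) = cnj_mat X + cnj_mat Y"
    if "X \<in> carrier_mat g g" "Y \<in> carrier_mat g g" for X Y
    by (rule eq_matI) (use that in auto)
  assume Z: "Z \<in> carrier_mat g g"
  have "cnj_mat A = A" "cnj_mat B = B" "cnj_mat C = C" "cnj_mat D = D"
    using blocks by (auto simp: symplectic_blocks_def)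
  then show "cnj_mat (numer Z) = numer (cnj_mat Z)" "cnj_mat (denom Z) = denom (cnj_mat Z)"
    unfolding numer_def denom_def using Z
    by (simp_all add: plus cnj_mat_mult[of _ g])
qed

text \<open>If \<open>denom Z\<close> kills \<open>w\<close>, then the denominator at the conjugate
  of \<open>Z\<close> kills the conjugate of \<open>w\<close>. Evaluating \<open>denom_numer\<close>
  for the conjugate of \<open>Z\<close> and \<open>Z\<close> between these two vectors yields 0 on
  one side and \<open>2 * \<i>\<close> times the form of \<open>im_mat_form_pos\<close> on the
  other.\<close>

lemma det_denom:
  assumes Z: "Z \<in> siegel g"
  shows "det (denom Z) \<noteq> 0"
proof (rule det_nonzeroI)
  have Zc [simp]: "Z \<in> carrier_mat g g" and sym: "transpose_mat Z = Z"
    using Z by (auto simp: siegel_iff)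
  show "denom Z \<in> carrier_mat g g"
    by simp
  fix w :: "complex Matrix.vec"
  assume w [simp]: "w \<in> carrier_vec g" and Qw: "denom Z *\<^sub>v w = 0\<^sub>v g"
  let ?w = "map_vec cnj w" and ?Z = "cnj_mat Z"
  have sym': "transpose_mat ?Z = ?Z"
    using sym by (metis map_mat_transpose)
  have "denom ?Z *\<^sub>v ?w = map_vec cnj (denom Z *\<^sub>v w)"
    unfolding cnj_denom[OF Zc, symmetric] by (rule cnj_mat_mult_vec[of _ g]) auto
  then have Qw': "denom ?Z *\<^sub>v ?w = 0\<^sub>v g"
    unfolding Qw by (auto intro!: eq_vecI)
  have [simp]: "?w \<in> carrier_vec g" "?Z \<in> carrier_mat g g"
    by auto
  have Pw: "numer Z *\<^sub>v w \<in> carrier_vec g"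
    by (rule mult_mat_vec_carrier[of _ g g]) auto
  have "(transpose_mat (denom ?Z) * numer Z - transpose_mat (numer ?Z) * denom Z) *\<^sub>v w =
      transpose_mat (denom ?Z) * numer Z *\<^sub>v w - transpose_mat (numer ?Z) * denom Z *\<^sub>v w"
    by (rule minus_mult_distrib_mat_vec[where nr = g and nc = g]) auto
  also have "transpose_mat (numer ?Z) * denom Z *\<^sub>v w = transpose_mat (numer ?Z) *\<^sub>v (denom Z *\<^sub>v w)"
    by (rule assoc_mult_mat_vec[where ?n\<^sub>1.0 = g and ?n\<^sub>2.0 = g and ?n\<^sub>3.0 = g]) auto
  also have "\<dots> = 0\<^sub>v g"
    unfolding Qw by (rule eq_vecI) (use carrier_matD[OF numer_carrier[of ?Z]] in auto)
  also have "transpose_mat (denom ?Z) * numer Z *\<^sub>v w = transpose_mat (denom ?Z) *\<^sub>v (numer Z *\<^sub>v w)"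
    by (rule assoc_mult_mat_vec[where ?n\<^sub>1.0 = g and ?n\<^sub>2.0 = g and ?n\<^sub>3.0 = g]) auto
  finally have "((2 * \<i>) \<cdot>\<^sub>m im_mat Z) *\<^sub>v w = transpose_mat (denom ?Z) *\<^sub>v (numer Z *\<^sub>v w) - 0\<^sub>v g"
    using denom_numer[OF _ sym', of Z] by (simp add: minus_cnj_mat)
  also have "\<dots> = transpose_mat (denom ?Z) *\<^sub>v (numer Z *\<^sub>v w)"
    by (rule eq_vecI) (use carrier_matD[OF denom_carrier[of ?Z]] in auto)
  also have "?w \<bullet> \<dots> = (denom ?Z *\<^sub>v ?w) \<bullet> (numer Z *\<^sub>v w)"
    by (subst transpose_vec_mult_scalar[of "transpose_mat (denom ?Z)" g g, symmetric])
      (auto simp: Pw)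
  also have "\<dots> = 0"
    unfolding Qw' using Pw by (rule scalar_prod_left_zero)
  finally have "?w \<bullet> (((2 * \<i>) \<cdot>\<^sub>m im_mat Z) *\<^sub>v w) = 0" .
  moreover have "((2 * \<i>) \<cdot>\<^sub>m im_mat Z) *\<^sub>v w = (2 * \<i>) \<cdot>\<^sub>v (im_mat Z *\<^sub>v w)"
    by (rule smult_mat_mult_vec[of _ g]) auto
  ultimately have "(2 * \<i>) * (?w \<bullet> (im_mat Z *\<^sub>v w)) = 0"
    using carrier_matD[OF Zc] carrier_vecD[OF w] by (simp add: im_mat_def)
  then show "w = 0\<^sub>v g"
    using im_mat_form_pos[OF Z, of w] by auto
qed

lemma cnj_act:
  assumes Z: "Z \<in> siegel g"
  shows "cnj_mat (act Z) = act (cnj_mat Z)" "det (denom (cnj_mat Z)) \<noteq> 0"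
proof -
  have Zc: "Z \<in> carrier_mat g g"
    using Z by (auto simp: siegel_iff)
  then have dc: "denom Z \<in> carrier_mat g g"
    by simp
  show "cnj_mat (act Z) = act (cnj_mat Z)"
    unfolding act_def
    using Zc mat_inv(3)[OF dc det_denom[OF Z]] cnj_mat_inv(2)[OF dc det_denom[OF Z]]
    by (simp add: cnj_mat_mult[of _ g] cnj_numer cnj_denom)
  show "det (denom (cnj_mat Z)) \<noteq> 0"
    using cnj_mat_inv(1)[OF dc det_denom[OF Z]] Zc by (simp add: cnj_denom)
qed

text \<open>\<open>act_diff\<close> from the conjugate of \<open>Z\<close> to \<open>Z\<close>: as
  the blocks are real, both differences are \<open>2 * \<i>\<close> times an imaginary part.\<close>

lemma im_act:
  assumes Z: "Z \<in> siegel g"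
  shows "im_mat (act Z) =
    transpose_mat (mat_inv (cnj_mat (denom Z))) * (im_mat Z * mat_inv (denom Z))"
proof -
  have Zc [simp]: "Z \<in> carrier_mat g g" "cnj_mat Z \<in> carrier_mat g g" and sym: "transpose_mat Z = Z"
    using Z by (auto simp: siegel_iff)
  have sym': "transpose_mat (cnj_mat Z) = cnj_mat Z"
    using sym by (metis map_mat_transpose)
  let ?L = "transpose_mat (mat_inv (cnj_mat (denom Z)))" and ?R = "mat_inv (denom Z)"
  have [simp]: "mat_inv (cnj_mat (denom Z)) \<in> carrier_mat g g" "?R \<in> carrier_mat g g"
    using mat_inv(3)[of "denom Z" g] mat_inv(3)[of "denom (cnj_mat Z)" g] cnj_act(2)[OF Z] det_denom[OF Z]
    by (auto simp: cnj_denom)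
  have [simp]: "act Z \<in> carrier_mat g g"
    using det_denom[OF Z] by simp
  have "act Z - cnj_mat (act Z) = ?L * ((Z - cnj_mat Z) * ?R)"
    unfolding cnj_act(1)[OF Z]
    using act_diff[OF _ sym' cnj_act(2)[OF Z] _ det_denom[OF Z]] by (simp add: cnj_denom)
  then have "(2 * \<i>) \<cdot>\<^sub>m im_mat (act Z) = ?L * (((2 * \<i>) \<cdot>\<^sub>m im_mat Z) * ?R)"
    by (simp add: minus_cnj_mat)
  also have "\<dots> = (2 * \<i>) \<cdot>\<^sub>m (?L * (im_mat Z * ?R))"
    by (simp add: mult_smult_assoc_mat[of _ g g _ g] mult_smult_distrib[of _ g g _ g])
  finally have e: "(2 * \<i>) \<cdot>\<^sub>m im_mat (act Z) = (2 * \<i>) \<cdot>\<^sub>m (?L * (im_mat Z * ?R))" .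
  have "X = Y" if "(2 * \<i>) \<cdot>\<^sub>m X = (2 * \<i>) \<cdot>\<^sub>m Y" "X \<in> carrier_mat g g" "Y \<in> carrier_mat g g" for X Y
  proof (rule eq_matI)
    fix i j
    assume ij: "i < dim_row Y" "j < dim_col Y"
    have "((2 * \<i>) \<cdot>\<^sub>m X) $$ (i, j) = ((2 * \<i>) \<cdot>\<^sub>m Y) $$ (i, j)"
      by (simp add: that(1))
    with ij that(2,3) show "X $$ (i, j) = Y $$ (i, j)"
      by simp
  qed (use that in auto)
  from this[OF e] show ?thesis
    by simp
qed

text \<open>In this inverted form of \<open>im_act\<close> the denominators occur without inverses,
  so they cancel against the inverse denominators in the derivative of the action.\<close>

lemma inv_im_act:
  assumes Z: "Z \<in> siegel g"
  shows "mat_inv (im_mat (act Z)) =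
    denom Z * (mat_inv (im_mat Z) * transpose_mat (cnj_mat (denom Z)))"
proof -
  define Q Qi Qc Qci Y Yi where "Q = denom Z" and "Qi = mat_inv Q" and "Qc = cnj_mat Q"
    and "Qci = mat_inv Qc" and "Y = im_mat Z" and "Yi = mat_inv Y"
  have Zc [simp]: "Z \<in> carrier_mat g g"
    using Z by (auto simp: siegel_iff)
  have c [simp]: "Q \<in> carrier_mat g g" "Qc \<in> carrier_mat g g" "Y \<in> carrier_mat g g"
    by (auto simp: Q_def Qc_def Y_def)
  have d: "det Q \<noteq> 0" "det Qc \<noteq> 0" "det Y \<noteq> 0"
    using det_denom[OF Z] cnj_mat_inv(1)[of Q g] det_im_mat[OF Z] by (auto simp: Q_def Qc_def Y_def)
  note i = mat_inv[OF c(1) d(1), folded Qi_def] mat_inv[OF c(2) d(2), folded Qci_def]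
    mat_inv[OF c(3) d(3), folded Yi_def]
  note [simp] = i(3,6,9)
  have it: "transpose_mat Qci * transpose_mat Qc = 1\<^sub>m g"
    using transpose_mult[of Qc g g Qci g] by (simp add: i)
  have "transpose_mat Qci * (Y * Qi) * (Q * (Yi * transpose_mat Qc)) =
      transpose_mat Qci * (Y * (Qi * (Q * (Yi * transpose_mat Qc))))"
    by simp
  also have "\<dots> = 1\<^sub>m g"
    using it by (simp add: mat_cancel_left[OF i(2)] mat_cancel_left[OF i(7)])
  finally have "mat_inv (transpose_mat Qci * (Y * Qi)) = Q * (Yi * transpose_mat Qc)"
    by (intro mat_inv_unique[of _ g]) auto
  then show ?thesis
    unfolding im_act[OF Z] by (simp add: Q_def Qi_def Qc_def Qci_def Y_def Yi_def)
qed

end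


section \<open>The action in coordinates\<close>

text \<open>Tangent vectors as symmetric matrices. Unlike in \<open>uncoord\<close> there is no base
  point to add.\<close>

definition coord_mat :: "nat \<Rightarrow> (nat \<Rightarrow> complex) \<Rightarrow> complex mat" where
  "coord_mat g v = Matrix.mat g g (\<lambda>(i, j). v (prod_encode (min i j, max i j - min i j)))"

text \<open>The linear part of \<open>siegel_coord\<close> on matrices of size \<open>g\<close>;
  positions outside the block count as 0.\<close>

definition mat_coord :: "nat \<Rightarrow> complex mat \<Rightarrow> nat \<Rightarrow> complex" where
  "mat_coord g E n = (case prod_decode n of (i, k) \<Rightarrow> if i + k < g then E $$ (i, i + k) else 0)"

lemma coord_mat_carrier [simp]: "coord_mat g v \<in> carrier_mat g g"
  by (simp add: coord_mat_def)

lemma dim_coord_mat [simp]: "dim_row (coord_mat g v) = g" "dim_col (coord_mat g v) = g"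
  by (simp_all add: coord_mat_def)

lemma coord_mat_sym: "transpose_mat (coord_mat g v) = coord_mat g v"
  by (rule eq_matI) (auto simp: coord_mat_def min.commute max.commute)

lemma siegel_block_line:
  "siegel_block g (uncoord (\<lambda>j. x j + t * v j)) =
    siegel_block g (uncoord x) + t \<cdot>\<^sub>m coord_mat g v"
  by (rule eq_matI) (auto simp: coord_mat_def siegel_block_def uncoord_def)

lemma coord_mat_mat_coord:
  assumes "E \<in> carrier_mat g g" "transpose_mat E = E"
  shows "coord_mat g (mat_coord g E) = E"
proof (rule eq_matI)
  fix i j
  assume ij: "i < dim_row E" "j < dim_col E"
  then have "E $$ (j, i) = E $$ (i, j)"
    using assms by (metis carrier_matD index_transpose_mat(1))
  with ij assms(1) show "coord_mat g (mat_coord g E) $$ (i, j) = E $$ (i, j)"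
    by (auto simp: coord_mat_def mat_coord_def min_def max_def)
qed (use assms carrier_matD[OF coord_mat_carrier[of g "mat_coord g E"]] in auto)

lemma prod_decode_sum_less:
  assumes "prod_decode n = (i, k)"
  shows "i + k < g \<longleftrightarrow> n < triangle g"
  using prod_encode_less_triangle[of i k g] prod_decode_inverse[of n] assms by simp

lemma mat_coord_cseq: "mat_coord g E \<in> cseq (triangle g)"
  unfolding cseq_def
proof (intro CollectI allI impI)
  fix n
  assume n: "triangle g \<le> n"
  obtain i k where ik: "prod_decode n = (i, k)"
    by (cases "prod_decode n")
  then have "\<not> i + k < g"
    using n prod_decode_sum_less[OF ik, of g] by simp
  then show "mat_coord g E n = 0"
    by (simp add: mat_coord_def ik)
qed

text \<open>The base points cancel, and outside the block both padded matrices agree.\<close>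

lemma siegel_coord_pad_diff:
  assumes "E \<in> carrier_mat g g" "E' \<in> carrier_mat g g"
  shows "siegel_coord (pad E) n - siegel_coord (pad E') n = mat_coord g (E - E') n"
proof -
  obtain i k where ik: "prod_decode n = (i, k)"
    by (cases "prod_decode n")
  show ?thesis
    using assms by (auto simp: siegel_coord_def mat_coord_def ik pad_def)
qed

lemma tendsto_siegel_block:
  assumes "(f \<longlongrightarrow> x) F" "i < g" "j < g"
  shows "((\<lambda>t. siegel_block g (uncoord (f t)) $$ (i, j)) \<longlongrightarrow> siegel_block g (uncoord x) $$ (i, j)) F"
  using tendsto_uncoord[OF assms(1)] assms by simp

context symplectic_action
begin

lemma tendsto_numer_denom:
  assumes Z: "\<And>t. Zt t \<in> carrier_mat g g" "Z \<in> carrier_mat g g"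
    and lim: "\<And>i j. i < g \<Longrightarrow> j < g \<Longrightarrow> ((\<lambda>t. Zt t $$ (i, j)) \<longlongrightarrow> Z $$ (i, j)) F"
    and ij: "i < g" "j < g"
  shows "((\<lambda>t. numer (Zt t) $$ (i, j)) \<longlongrightarrow> numer Z $$ (i, j)) F"
    and "((\<lambda>t. denom (Zt t) $$ (i, j)) \<longlongrightarrow> denom Z $$ (i, j)) F"
proof -
  have *: "((\<lambda>t. (X * Zt t + Y) $$ (i, j)) \<longlongrightarrow> (X * Z + Y) $$ (i, j)) F"
    if "X \<in> carrier_mat g g" "Y \<in> carrier_mat g g" for X Y
  proof -
    have "((\<lambda>t. (X * Zt t) $$ (i, j)) \<longlongrightarrow> (X * Z) $$ (i, j)) F"
      using that by (intro tendsto_mat_mult[where n = g]) (auto intro: Z lim ij)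
    then have "((\<lambda>t. (X * Zt t) $$ (i, j) + Y $$ (i, j)) \<longlongrightarrow> (X * Z) $$ (i, j) + Y $$ (i, j)) F"
      by (intro tendsto_add tendsto_const)
    then show ?thesis
      using that Z ij by (simp del: index_mult_mat(1))
  qed
  show "((\<lambda>t. numer (Zt t) $$ (i, j)) \<longlongrightarrow> numer Z $$ (i, j)) F"
    "((\<lambda>t. denom (Zt t) $$ (i, j)) \<longlongrightarrow> denom Z $$ (i, j)) F"
    unfolding numer_def denom_def by (intro * carriers)+
qed

definition act_pad :: "(nat \<Rightarrow> nat \<Rightarrow> complex) \<Rightarrow> nat \<Rightarrow> nat \<Rightarrow> complex" where
  "act_pad p = pad (act (siegel_block g p))"

lemma continuous_on_act_pad: "continuous_on (siegel_level g) act_pad"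
  unfolding continuous_on_def
proof
  fix p
  assume p: "p \<in> siegel_level g"
  have lim: "((\<lambda>q. q i j) \<longlongrightarrow> p i j) (at p within siegel_level g)" for i j
    using continuous_on_matrix_entry[of "siegel_level g" i j] p by (auto simp: continuous_on_def)
  have d: "det (denom (siegel_block g q)) \<noteq> 0" if "q \<in> siegel_level g" for q
    by (rule det_denom[OF siegel_block_in_siegel(1)[OF that]])
  have blk: "((\<lambda>q. siegel_block g q $$ (i, j)) \<longlongrightarrow> siegel_block g p $$ (i, j)) (at p within siegel_level g)"
    if "i < g" "j < g" for i j
    using lim that by simp
  have mi: "mat_inv (denom (siegel_block g q)) \<in> carrier_mat g g" if "q \<in> siegel_level g" for q
    by (rule mat_inv(3)[OF _ d[OF that]]) simp
  have entry: "act (siegel_block g q) $$ (i, j) =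
      (\<Sum>k<g. numer (siegel_block g q) $$ (i, k) * mat_inv (denom (siegel_block g q)) $$ (k, j))"
    if "q \<in> siegel_level g" "i < g" "j < g" for q i j
    unfolding act_def by (rule mult_mat_index) (use that mi in auto)
  have dims: "dim_row (act (siegel_block g q)) = g" "dim_col (act (siegel_block g q)) = g"
    if "q \<in> siegel_level g" for q
    using carrier_matD[OF act_carrier[OF siegel_block_carrier d[OF that]]] by auto
  have "((\<lambda>q. act_pad q i j) \<longlongrightarrow> act_pad p i j) (at p within siegel_level g)" for i j
  proof (cases "i < g \<and> j < g")
    case True
    \<comment> \<open>\<open>mat_inv\<close> has a known shape only where the denominator is
      invertible, so the product formula is available on the level and is transferred along the
      filter.\<close>
    have ev: "eventually (\<lambda>q. (\<Sum>k<g. numer (siegel_block g q) $$ (i, k) *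
        mat_inv (denom (siegel_block g q)) $$ (k, j)) = act_pad q i j) (at p within siegel_level g)"
      unfolding eventually_at_filter
      by (intro always_eventually allI impI)
        (use True entry dims in \<open>simp add: act_pad_def pad_def\<close>)
    have "((\<lambda>q. \<Sum>k<g. numer (siegel_block g q) $$ (i, k) * mat_inv (denom (siegel_block g q)) $$ (k, j)) \<longlongrightarrow>
        (\<Sum>k<g. numer (siegel_block g p) $$ (i, k) * mat_inv (denom (siegel_block g p)) $$ (k, j)))
        (at p within siegel_level g)"
      by (intro tendsto_sum tendsto_mult tendsto_mat_inv[where n = g] tendsto_numer_denom blk d p)
        (use True in auto)
    also have "(\<Sum>k<g. numer (siegel_block g p) $$ (i, k) * mat_inv (denom (siegel_block g p)) $$ (k, j)) =
        act_pad p i j"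
      using entry[OF p] True dims[OF p] by (simp add: act_pad_def pad_def)
    finally show ?thesis
      by (rule Lim_transform_eventually) (rule ev)
  next
    case False
    have "act_pad q i j = (if i = j then \<i> else 0)" if "q \<in> siegel_level g" for q
      using False dims[OF that] by (auto simp add: act_pad_def pad_def)
    then have "eventually (\<lambda>q. (if i = j then \<i> else 0) = act_pad q i j) (at p within siegel_level g)"
      unfolding eventually_at_filter by (intro always_eventually) auto
    moreover have "((\<lambda>q. if i = j then \<i> else 0) \<longlongrightarrow> act_pad p i j) (at p within siegel_level g)"
      using False dims[OF p] by (auto simp add: act_pad_def pad_def)
    ultimately show ?thesis
      by (rule Lim_transform_eventually[rotated])
  qed
  then show "(act_pad \<longlongrightarrow> act_pad p) (at p within siegel_level g)"
    by (simp add: tendsto_fun_iff)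
qed

text \<open>By \<open>act_diff\<close> the matrix difference quotient at \<open>t\<close> equals
  \<open>Q(Z)^-T V Q(Z + t V)^-1\<close> exactly, so the derivative only requires continuity of the
  inverse at the denominator of \<open>Z\<close>.\<close>

lemma has_gateaux_deriv_act_pad:
  fixes p v
  defines "Z \<equiv> siegel_block g p"
  assumes p: "p \<in> siegel_level g" and v: "v \<in> cseq (triangle g)"
  shows "has_gateaux_deriv (enat (triangle g))
    (level_map g act_pad) (siegel_coord p) v
    (mat_coord g (transpose_mat (mat_inv (denom Z)) * (coord_mat g v * mat_inv (denom Z))))"
proof -
  let ?V = "coord_mat g v" and ?x = "siegel_coord p"
  define Zt where "Zt t = Z + t \<cdot>\<^sub>m ?V" for t
  have x: "?x \<in> siegel_dom g" "uncoord ?x = p"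
    using p by (auto simp: siegel_dom_def uncoord_siegel_coord_level)
  have Z: "Z \<in> siegel g"
    unfolding Z_def by (rule siegel_block_in_siegel[OF p])
  then have Zc [simp]: "Z \<in> carrier_mat g g" and sym: "transpose_mat Z = Z"
    by (auto simp: siegel_iff)
  have Ztc [simp]: "Zt t \<in> carrier_mat g g" for t
    by (simp add: Zt_def)
  have blk: "siegel_block g (uncoord (\<lambda>j. ?x j + t * v j)) = Zt t" for t
    by (simp add: siegel_block_line x Zt_def Z_def)
  have dom: "eventually (\<lambda>t::complex. (\<lambda>j. ?x j + t * v j) \<in> siegel_dom g) (at 0)"
    by (rule line_in_siegel_dom[OF x(1) v]) (rule tendsto_ident_at)
  have d: "eventually (\<lambda>t. det (denom (Zt t)) \<noteq> 0) (at 0)"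
    using dom
  proof eventually_elim
    fix t
    assume "(\<lambda>j. ?x j + t * v j) \<in> siegel_dom g"
    then have "siegel_block g (uncoord (\<lambda>j. ?x j + t * v j)) \<in> siegel g"
      by (intro siegel_block_in_siegel) (simp add: siegel_dom_iff)
    then show "det (denom (Zt t)) \<noteq> 0"
      unfolding blk by (rule det_denom)
  qed
  define f where "f x = siegel_coord (act_pad (uncoord x))" for x
  define E where "E t = transpose_mat (mat_inv (denom Z)) * (?V * mat_inv (denom (Zt t)))" for t
  have Zt0: "Zt 0 = Z"
    by (rule eq_matI) (use carrier_matD[OF Zc] in \<open>auto simp: Zt_def\<close>)
  have quot: "eventually (\<lambda>t. (\<lambda>k. (f (\<lambda>j. ?x j + t * v j) k - f ?x k) / t) = mat_coord g (E t)) (at 0)"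
    using d eventually_neq_at_within[of 0 0 UNIV]
  proof eventually_elim
    fix t :: complex
    assume t: "det (denom (Zt t)) \<noteq> 0" "t \<noteq> 0"
    have inv [simp]: "mat_inv (denom Z) \<in> carrier_mat g g" "mat_inv (denom (Zt t)) \<in> carrier_mat g g"
      using mat_inv(3)[of "denom Z" g] mat_inv(3)[of "denom (Zt t)" g] det_denom[OF Z] t by auto
    have "Zt t - Z = t \<cdot>\<^sub>m ?V"
      using carrier_matD[OF Zc] by (intro eq_matI) (auto simp: Zt_def)
    then have "act (Zt t) - act Z = transpose_mat (mat_inv (denom Z)) * ((t \<cdot>\<^sub>m ?V) * mat_inv (denom (Zt t)))"
      using act_diff[OF Zc sym det_denom[OF Z] Ztc t(1)] by simp
    also have "\<dots> = t \<cdot>\<^sub>m E t"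
      unfolding E_def
      by (simp add: mult_smult_assoc_mat[of _ g g _ g] mult_smult_distrib[of _ g g _ g])
    finally have diff: "act (Zt t) - act Z = t \<cdot>\<^sub>m E t" .
    have Ec: "E t \<in> carrier_mat g g"
      by (simp add: E_def)
    show "(\<lambda>k. (f (\<lambda>j. ?x j + t * v j) k - f ?x k) / t) = mat_coord g (E t)"
    proof
      fix k
      have "f (\<lambda>j. ?x j + t * v j) k - f ?x k = mat_coord g (act (Zt t) - act Z) k"
        unfolding f_def act_pad_def blk x(2) Z_def[symmetric]
        by (rule siegel_coord_pad_diff) (use t det_denom[OF Z] in auto)
      also have "\<dots> = t * mat_coord g (E t) k"
        unfolding diff using carrier_matD[OF Ec] by (auto simp: mat_coord_def split: prod.split)
      finally show "(f (\<lambda>j. ?x j + t * v j) k - f ?x k) / t = mat_coord g (E t) k"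
        using t by simp
    qed
  qed
  have dn: "eventually (\<lambda>t. mat_inv (denom (Zt t)) \<in> carrier_mat g g) (at 0)"
    using d by eventually_elim (auto intro: mat_inv(3))
  have Elim: "((\<lambda>t. E t $$ (i, j)) \<longlongrightarrow> E 0 $$ (i, j)) (at 0)" if ij: "i < g" "j < g" for i j
  proof -
    let ?e = "\<lambda>t. \<Sum>k<g. transpose_mat (mat_inv (denom Z)) $$ (i, k) *
        (\<Sum>l<g. ?V $$ (k, l) * mat_inv (denom (Zt t)) $$ (l, j))"
    have e: "?e t = E t $$ (i, j)" if "mat_inv (denom (Zt t)) \<in> carrier_mat g g" for t
    proof -
      have "mat_inv (denom Z) \<in> carrier_mat g g"
        using mat_inv(3)[of "denom Z" g] det_denom[OF Z] by auto
      then show ?thesis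
        unfolding E_def using that ij
        by (subst mult_mat_index[of _ g], simp_all del: index_mult_mat(1) index_transpose_mat(1))
          (intro sum.cong refl, subst mult_mat_index[of _ g], simp_all)
    qed
    have ze: "((\<lambda>t. Zt t $$ (k, l)) \<longlongrightarrow> Zt 0 $$ (k, l)) (at 0)" if "k < g" "l < g" for k l
      using that carrier_matD[OF Zc] carrier_matD[OF coord_mat_carrier[of g v]]
      unfolding Zt_def by (auto intro!: tendsto_eq_intros)
    have "(?e \<longlongrightarrow> ?e 0) (at 0)"
      by (intro tendsto_sum tendsto_mult tendsto_const tendsto_mat_inv[where n = g]
          tendsto_numer_denom ze)
        (use ij det_denom[OF Z] in \<open>auto simp: Zt0\<close>)
    also have "?e 0 = E 0 $$ (i, j)"
      using det_denom[OF Z] by (intro e) (auto simp: Zt0 intro: mat_inv(3))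
    finally show ?thesis
      by (rule Lim_transform_eventually) (use dn in eventually_elim, rule e)
  qed
  have "has_gateaux_deriv (enat (triangle g)) f ?x v (mat_coord g (E 0))"
    unfolding has_gateaux_deriv_enat_iff
  proof (intro conjI allI)
    show "mat_coord g (E 0) \<in> cseq (triangle g)"
      by (rule mat_coord_cseq)
    show "eventually (\<lambda>t. (\<lambda>k. (f (\<lambda>j. ?x j + t * v j) k - f ?x k) / t) \<in> cseq (triangle g)) (at 0)"
      using quot by eventually_elim (simp add: mat_coord_cseq)
    fix n
    obtain i k where ik: "prod_decode n = (i, k)"
      by (cases "prod_decode n")
    have "((\<lambda>t. mat_coord g (E t) n) \<longlongrightarrow> mat_coord g (E 0) n) (at 0)"
      using Elim[of i "i + k"] by (simp add: mat_coord_def ik)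
    then show "((\<lambda>t. (f (\<lambda>j. ?x j + t * v j) n - f ?x n) / t) \<longlongrightarrow> mat_coord g (E 0) n) (at 0)"
    proof (rule Lim_transform_eventually)
      show "eventually (\<lambda>t. mat_coord g (E t) n = (f (\<lambda>j. ?x j + t * v j) n - f ?x n) / t) (at 0)"
        using quot by eventually_elim metis
    qed
  qed
  then have "has_gateaux_deriv (enat (triangle g)) (level_map g act_pad) ?x v (mat_coord g (E 0))"
    by (rule has_gateaux_deriv_dom_cong[OF _ p v]) (simp only: f_def level_map_eq)
  then show ?thesis
    by (simp add: E_def Zt0)
qed

end


section \<open>The trace form\<close>

text \<open>The trace written out as a sum: sesquilinearity, smoothness and the comparison of
  consecutive levels are read off the summands.\<close>

definition siegel_form ::
  "nat \<Rightarrow> (nat \<Rightarrow> nat \<Rightarrow> complex) \<Rightarrow> (nat \<Rightarrow> complex) \<Rightarrow> (nat \<Rightarrow> complex) \<Rightarrow> complex" where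
  "siegel_form g p v w =
     (let Yi = mat_inv (im_mat (siegel_block g p)); V = coord_mat g v; W = coord_mat g w
      in \<Sum>i<g. \<Sum>j<g. \<Sum>k<g. \<Sum>l<g. Yi $$ (i, j) * V $$ (j, k) * Yi $$ (k, l) * cnj (W $$ (i, l)))"

lemma siegel_form_trace:
  fixes p v w g
  defines "Yi \<equiv> mat_inv (im_mat (siegel_block g p))"
  assumes p: "p \<in> siegel_level g"
  shows "siegel_form g p v w = (\<Sum>i<g.
    (Yi * (coord_mat g v * (Yi * transpose_mat (cnj_mat (coord_mat g w))))) $$ (i, i))"
proof -
  have [simp]: "Yi \<in> carrier_mat g g"
    unfolding Yi_def by (rule mat_inv(3)[OF _ det_im_mat[OF siegel_block_in_siegel(1)[OF p]]]) simp
  have "(Yi * (coord_mat g v * (Yi * transpose_mat (cnj_mat (coord_mat g w))))) $$ (i, i) =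
    (\<Sum>j<g. Yi $$ (i, j) * (\<Sum>k<g. coord_mat g v $$ (j, k) *
      (\<Sum>l<g. Yi $$ (k, l) * cnj (coord_mat g w $$ (i, l)))))" if "i < g" for i
  proof -
    let ?W = "transpose_mat (cnj_mat (coord_mat g w))"
    have W: "?W \<in> carrier_mat g g" "Yi * ?W \<in> carrier_mat g g"
        "coord_mat g v * (Yi * ?W) \<in> carrier_mat g g"
      by (auto intro!: mult_carrier_mat[where n = g])
    have "(Yi * ?W) $$ (k, i) = (\<Sum>l<g. Yi $$ (k, l) * cnj (coord_mat g w $$ (i, l)))" if "k < g" for k
      using \<open>i < g\<close> that by (subst mult_mat_index[OF _ W(1)]) auto
    moreover have "(coord_mat g v * (Yi * ?W)) $$ (j, i) =
        (\<Sum>k<g. coord_mat g v $$ (j, k) * (Yi * ?W) $$ (k, i))" if "j < g" for j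
      using \<open>i < g\<close> that by (intro mult_mat_index[OF _ W(2)]) auto
    moreover have "(Yi * (coord_mat g v * (Yi * ?W))) $$ (i, i) =
        (\<Sum>j<g. Yi $$ (i, j) * (coord_mat g v * (Yi * ?W)) $$ (j, i))"
      using that by (intro mult_mat_index[OF _ W(3)]) auto
    ultimately show ?thesis
      by (simp del: index_mult_mat(1))
  qed
  then show ?thesis
    by (simp add: siegel_form_def Let_def Yi_def[symmetric] sum_distrib_left mult.assoc)
qed

lemma trace_mult_commute:
  fixes X Y :: "'a::comm_semiring_0 mat"
  assumes "X \<in> carrier_mat n n" "Y \<in> carrier_mat n n"
  shows "(\<Sum>i<n. (X * Y) $$ (i, i)) = (\<Sum>i<n. (Y * X) $$ (i, i))"
proof -
  have "(\<Sum>i<n. (X * Y) $$ (i, i)) = (\<Sum>i<n. \<Sum>k<n. X $$ (i, k) * Y $$ (k, i))"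
    by (intro sum.cong refl mult_mat_index) (use assms in auto)
  also have "\<dots> = (\<Sum>k<n. \<Sum>i<n. Y $$ (k, i) * X $$ (i, k))"
    by (subst sum.swap) (simp add: mult.commute)
  also have "\<dots> = (\<Sum>k<n. (Y * X) $$ (k, k))"
    by (intro sum.cong refl mult_mat_index[symmetric]) (use assms in auto)
  finally show ?thesis .
qed

text \<open>The first tangent matrix becomes \<open>Q^-T V Q^-1\<close>, and the adjoint of the
  second changes in the same way with the conjugate denominator \<open>Qc\<close>. One copy of the
  new inverse imaginary part is written as \<open>Qc Yi Q^T\<close> and the other as
  \<open>Q Yi Qc^T\<close>; then all inner factors cancel, and the remaining conjugation by
  \<open>Qc\<close> does not change the trace.\<close>

lemma (in symplectic_action) siegel_form_invariant:
  fixes p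
  defines "Z \<equiv> siegel_block g p"
  defines "T \<equiv> \<lambda>v. mat_coord g (transpose_mat (mat_inv (denom Z)) * (coord_mat g v * mat_inv (denom Z)))"
  assumes p: "p \<in> siegel_level g" and Fp: "act_pad p \<in> siegel_level g"
  shows "siegel_form g (act_pad p) (T v) (T w) = siegel_form g p v w"
proof -
  have Z: "Z \<in> siegel g"
    unfolding Z_def by (rule siegel_block_in_siegel[OF p])
  have Zc [simp]: "Z \<in> carrier_mat g g"
    using Z by (auto simp: siegel_iff)
  define Q Qi Qc Qci Yi Yi' where "Q = denom Z" and "Qi = mat_inv Q" and "Qc = cnj_mat Q"
    and "Qci = mat_inv Qc" and "Yi = mat_inv (im_mat Z)" and "Yi' = mat_inv (im_mat (act Z))"
  have dQ: "det Q \<noteq> 0"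
    using det_denom[OF Z] by (simp add: Q_def)
  have Qcarr [simp]: "Q \<in> carrier_mat g g" "Qc \<in> carrier_mat g g"
    by (auto simp: Q_def Qc_def)
  have dQc: "det Qc \<noteq> 0" and cQi: "cnj_mat Qi = Qci"
    using cnj_mat_inv[OF Qcarr(1) dQ] by (auto simp: Qc_def Qi_def Qci_def)
  note i = mat_inv[OF Qcarr(1) dQ, folded Qi_def] mat_inv[OF Qcarr(2) dQc, folded Qci_def]
  note [simp] = i(3,6)
  have imc: "im_mat Z \<in> carrier_mat g g"
    by simp
  have Yic [simp]: "Yi \<in> carrier_mat g g"
    unfolding Yi_def by (rule mat_inv(3)[OF imc det_im_mat[OF Z]])
  have cYi: "cnj_mat Yi = Yi"
    unfolding Yi_def using cnj_mat_inv(2)[OF imc det_im_mat[OF Z]] by simp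
  have actZ: "siegel_block g (act_pad p) = act Z"
    unfolding act_pad_def Z_def[symmetric]
    by (rule siegel_block_pad) (simp add: det_denom[OF Z])
  have actS: "act Z \<in> siegel g"
    using siegel_block_in_siegel(1)[OF Fp] by (simp add: actZ)
  have Yi': "Yi' = Q * (Yi * transpose_mat Qc)"
    unfolding Yi'_def Q_def Qc_def Yi_def by (rule inv_im_act[OF Z])
  \<comment> \<open>The matrix is real, so conjugating the formula for \<open>Yi'\<close> yields the
    second expression.\<close>
  have "cnj_mat Yi' = Yi'"
    unfolding Yi'_def using cnj_mat_inv(2)[of "im_mat (act Z)" g] det_im_mat[OF actS] actS
    by (simp add: siegel_iff)
  moreover have "cnj_mat (Q * (Yi * transpose_mat Qc)) = Qc * (Yi * transpose_mat Q)"
  proof -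
    have "cnj_mat (transpose_mat Qc) = transpose_mat Q"
      by (rule eq_matI) (use carrier_matD[OF Qcarr(1)] in \<open>auto simp: Qc_def\<close>)
    then show ?thesis
      by (simp add: cnj_mat_mult[of _ g] cYi) (simp add: Qc_def)
  qed
  ultimately have Yi'': "Yi' = Qc * (Yi * transpose_mat Q)"
    using Yi' by simp
  have tQ: "transpose_mat Q * transpose_mat Qi = 1\<^sub>m g" "transpose_mat Qc * transpose_mat Qci = 1\<^sub>m g"
    by (subst transpose_mult[symmetric, where nr = g and n = g and nc = g]; simp add: i)+
  have sym: "transpose_mat (transpose_mat Qi * (coord_mat g u * Qi)) = transpose_mat Qi * (coord_mat g u * Qi)" for u
  proof -
    have "transpose_mat (transpose_mat Qi * (coord_mat g u * Qi)) =
        transpose_mat (coord_mat g u * Qi) * Qi"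
      by (subst transpose_mult[where nr = g and n = g and nc = g]) auto
    also have "transpose_mat (coord_mat g u * Qi) = transpose_mat Qi * coord_mat g u"
      by (subst transpose_mult[where nr = g and n = g and nc = g]) (auto simp: coord_mat_sym)
    finally show ?thesis
      by simp
  qed
  have T: "coord_mat g (T u) = transpose_mat Qi * (coord_mat g u * Qi)" for u
    unfolding T_def Q_def[symmetric] Qi_def[symmetric]
    by (rule coord_mat_mat_coord[OF _ sym]) simp
  let ?V = "coord_mat g v" and ?W = "transpose_mat (cnj_mat (coord_mat g w))"
  have Wc [simp]: "cnj_mat (coord_mat g w) \<in> carrier_mat g g"
    by simp
  have "transpose_mat (cnj_mat (coord_mat g (T w))) = transpose_mat Qci * (?W * Qci)"
  proof -
    have "cnj_mat (transpose_mat Qi) = transpose_mat Qci"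
      unfolding cQi[symmetric] by (simp add: map_mat_transpose)
    then have "cnj_mat (coord_mat g (T w)) = transpose_mat Qci * (cnj_mat (coord_mat g w) * Qci)"
      by (simp add: T cnj_mat_mult[of _ g] cQi)
    also have "transpose_mat \<dots> = transpose_mat (cnj_mat (coord_mat g w) * Qci) * Qci"
      by (subst transpose_mult[where nr = g and n = g and nc = g]) auto
    also have "transpose_mat (cnj_mat (coord_mat g w) * Qci) = transpose_mat Qci * ?W"
      by (subst transpose_mult[where nr = g and n = g and nc = g]) auto
    finally show ?thesis
      by simp
  qed
  then have "Yi' * (coord_mat g (T v) * (Yi' * transpose_mat (cnj_mat (coord_mat g (T w))))) =
      (Qc * (Yi * transpose_mat Q)) * ((transpose_mat Qi * (?V * Qi)) *
        ((Q * (Yi * transpose_mat Qc)) * (transpose_mat Qci * (?W * Qci))))"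
    unfolding T by (subst Yi'', subst Yi') simp
  also have "\<dots> = Qc * ((Yi * (?V * (Yi * ?W))) * Qci)"
    by (simp add: mat_cancel_left[OF tQ(1)] mat_cancel_left[OF tQ(2)] mat_cancel_left[OF i(2)])
  finally have N: "Yi' * (coord_mat g (T v) * (Yi' * transpose_mat (cnj_mat (coord_mat g (T w))))) =
      Qc * ((Yi * (?V * (Yi * ?W))) * Qci)" .
  have "siegel_form g (act_pad p) (T v) (T w) = (\<Sum>k<g. (Qc * ((Yi * (?V * (Yi * ?W))) * Qci)) $$ (k, k))"
    unfolding siegel_form_trace[OF Fp] actZ Yi'_def[symmetric] N ..
  also have "\<dots> = (\<Sum>k<g. (((Yi * (?V * (Yi * ?W))) * Qci) * Qc) $$ (k, k))"
    by (rule trace_mult_commute) auto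
  also have "((Yi * (?V * (Yi * ?W))) * Qci) * Qc = Yi * (?V * (Yi * ?W))"
    by (simp add: i(5))
  also have "(\<Sum>k<g. (Yi * (?V * (Yi * ?W))) $$ (k, k)) = siegel_form g p v w"
    unfolding siegel_form_trace[OF p] Yi_def Z_def ..
  finally show ?thesis .
qed


section \<open>The derivative of the inverse matrix\<close>

lemma mat_inv_diff:
  fixes A B :: "'a::field mat"
  assumes A: "A \<in> carrier_mat n n" "det A \<noteq> 0" and B: "B \<in> carrier_mat n n" "det B \<noteq> 0"
  shows "mat_inv A - mat_inv B = mat_inv A * ((B - A) * mat_inv B)"
proof -
  note a = mat_inv[OF A] and b = mat_inv[OF B]
  have "(B - A) * mat_inv B = 1\<^sub>m n - A * mat_inv B"
    using minus_mult_distrib_mat[OF B(1) A(1) b(3)] by (simp add: b(1))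
  then have "mat_inv A * ((B - A) * mat_inv B) = mat_inv A * (1\<^sub>m n - A * mat_inv B)"
    by simp
  also have "\<dots> = mat_inv A * 1\<^sub>m n - mat_inv A * (A * mat_inv B)"
    by (rule mult_minus_distrib_mat[where nr = n and n = n and nc = n]) (use a b A B in auto)
  also have "mat_inv A * 1\<^sub>m n = mat_inv A"
    using a(3) by simp
  also have "mat_inv A * (A * mat_inv B) = mat_inv B"
    by (rule mat_cancel_left[OF a(2)]) (use a b A in auto)
  finally show ?thesis ..
qed

lemma mat_mult3_index:
  assumes "A \<in> carrier_mat n n" "B \<in> carrier_mat n n" "C \<in> carrier_mat n n" "i < n" "j < n"
  shows "(A * (B * C)) $$ (i, j) = (\<Sum>k<n. \<Sum>l<n. A $$ (i, k) * B $$ (k, l) * C $$ (l, j))"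
proof -
  have "(A * (B * C)) $$ (i, j) = (\<Sum>k<n. A $$ (i, k) * (B * C) $$ (k, j))"
    by (rule mult_mat_index) (use assms in auto)
  also have "\<dots> = (\<Sum>k<n. A $$ (i, k) * (\<Sum>l<n. B $$ (k, l) * C $$ (l, j)))"
  proof (intro sum.cong refl)
    fix k
    assume "k \<in> {..<n}"
    then have "(B * C) $$ (k, j) = (\<Sum>l<n. B $$ (k, l) * C $$ (l, j))"
      using assms by (intro mult_mat_index) auto
    then show "A $$ (i, k) * (B * C) $$ (k, j) = A $$ (i, k) * (\<Sum>l<n. B $$ (k, l) * C $$ (l, j))"
      by simp
  qed
  finally show ?thesis
    by (simp add: sum_distrib_left mult.assoc)
qed

text \<open>The resolvent identity \<open>mat_inv_diff\<close> gives the difference quotient in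
  closed form; its limit is \<open>- Y^-1 V Y^-1\<close> by continuity of the inverse.\<close>

lemma mat_inv_has_field_derivative:
  fixes Y V :: "complex mat"
  assumes Y: "Y \<in> carrier_mat n n" "det Y \<noteq> 0" and V: "V \<in> carrier_mat n n" and ij: "i < n" "j < n"
  shows "((\<lambda>s. mat_inv (Y + s \<cdot>\<^sub>m V) $$ (i, j)) has_field_derivative
    - (\<Sum>k<n. \<Sum>l<n. mat_inv Y $$ (i, k) * V $$ (k, l) * mat_inv Y $$ (l, j))) (at 0)"
proof -
  let ?B = "\<lambda>s. Y + s \<cdot>\<^sub>m V"
  have Bc: "?B s \<in> carrier_mat n n" for s
    using Y V by auto
  have B0: "?B 0 = Y"
    by (rule eq_matI) (use Y V in auto)
  have lim: "((\<lambda>s. ?B s $$ (k, l)) \<longlongrightarrow> Y $$ (k, l)) (at 0)" if "k < n" "l < n" for k l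
    using that Y V by (auto intro!: tendsto_eq_intros)
  have ev: "eventually (\<lambda>s. det (?B s) \<noteq> 0) (at 0)"
    by (rule tendsto_imp_eventually_ne[OF tendsto_det[OF Bc Y(1) lim] Y(2)])
  have "((\<lambda>s. - (\<Sum>k<n. \<Sum>l<n. mat_inv Y $$ (i, k) * V $$ (k, l) * mat_inv (?B s) $$ (l, j))) \<longlongrightarrow>
      - (\<Sum>k<n. \<Sum>l<n. mat_inv Y $$ (i, k) * V $$ (k, l) * mat_inv Y $$ (l, j))) (at 0)"
    by (intro tendsto_minus tendsto_sum tendsto_mult tendsto_const tendsto_mat_inv[OF Bc Y(1) lim Y(2)])
      (use ij in auto)
  then have "(\<lambda>h. (mat_inv (?B (0 + h)) $$ (i, j) - mat_inv (?B 0) $$ (i, j)) / h) \<midarrow>0\<rightarrow>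
      - (\<Sum>k<n. \<Sum>l<n. mat_inv Y $$ (i, k) * V $$ (k, l) * mat_inv Y $$ (l, j))"
  proof (rule Lim_transform_eventually)
    show "\<forall>\<^sub>F s in at 0. - (\<Sum>k<n. \<Sum>l<n. mat_inv Y $$ (i, k) * V $$ (k, l) * mat_inv (?B s) $$ (l, j)) =
        (mat_inv (?B (0 + s)) $$ (i, j) - mat_inv (?B 0) $$ (i, j)) / s"
      using ev eventually_neq_at_within[of 0 0 UNIV]
    proof eventually_elim
      fix s :: complex
      assume d: "det (?B s) \<noteq> 0" and s: "s \<noteq> 0"
      have i: "mat_inv Y \<in> carrier_mat n n" "mat_inv (?B s) \<in> carrier_mat n n"
        using mat_inv(3)[OF Y] mat_inv(3)[OF Bc d] by auto
      have "?B s - Y = s \<cdot>\<^sub>m V"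
        by (rule eq_matI) (use Y V in auto)
      then have "mat_inv Y - mat_inv (?B s) = mat_inv Y * ((s \<cdot>\<^sub>m V) * mat_inv (?B s))"
        using mat_inv_diff[OF Y Bc d] by simp
      then have "(mat_inv Y - mat_inv (?B s)) $$ (i, j) =
          (mat_inv Y * ((s \<cdot>\<^sub>m V) * mat_inv (?B s))) $$ (i, j)"
        by simp
      then have "mat_inv Y $$ (i, j) - mat_inv (?B s) $$ (i, j) =
          (mat_inv Y * ((s \<cdot>\<^sub>m V) * mat_inv (?B s))) $$ (i, j)"
        using i ij by simp
      also have "\<dots> = (\<Sum>k<n. \<Sum>l<n. mat_inv Y $$ (i, k) * (s \<cdot>\<^sub>m V) $$ (k, l) * mat_inv (?B s) $$ (l, j))"
        by (rule mat_mult3_index) (use i V ij in auto)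
      also have "\<dots> = s * (\<Sum>k<n. \<Sum>l<n. mat_inv Y $$ (i, k) * V $$ (k, l) * mat_inv (?B s) $$ (l, j))"
        unfolding sum_distrib_left by (intro sum.cong refl) (use V in auto)
      finally have "mat_inv (?B s) $$ (i, j) - mat_inv Y $$ (i, j) =
          - s * (\<Sum>k<n. \<Sum>l<n. mat_inv Y $$ (i, k) * V $$ (k, l) * mat_inv (?B s) $$ (l, j))"
        by (simp add: algebra_simps)
      then show "- (\<Sum>k<n. \<Sum>l<n. mat_inv Y $$ (i, k) * V $$ (k, l) * mat_inv (?B s) $$ (l, j)) =
          (mat_inv (?B (0 + s)) $$ (i, j) - mat_inv (?B 0) $$ (i, j)) / s"
        unfolding B0 using s by simp
    qed
  qed
  then show ?thesis
    unfolding DERIV_def by simp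
qed


section \<open>Smooth functions\<close>

text \<open>Directional derivatives of \<open>f'\<close> involve its values along lines through
  \<open>x\<close>, which is why lines have to stay in \<open>W\<close> near 0. One unfolding
  suffices: the derivative functions of \<open>f\<close> serve for \<open>f'\<close>
  unchanged.\<close>

lemma smooth_fun_cong:
  assumes "smooth_fun N W f" and eq: "\<And>x. x \<in> W \<Longrightarrow> f x = f' x"
    and lines: "\<And>x v. x \<in> W \<Longrightarrow> v \<in> model N \<Longrightarrow>
      eventually (\<lambda>t::real. (\<lambda>j. x j + of_real t * v j) \<in> W) (nhds 0)"
  shows "smooth_fun N W f'"
  using assms(1)
proof cases
  case 1
  show ?thesis
  proof (rule smooth_fun.intros)
    show "continuous_map (subtopology (model_top N) W) euclidean f'"
      by (rule continuous_map_eq[OF 1(1)]) (simp add: eq)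
    show "\<forall>v\<in>model N. \<exists>f''. (\<forall>x\<in>W. ((\<lambda>t::real. f' (\<lambda>j. x j + of_real t * v j))
        has_vector_derivative f'' x) (at 0)) \<and> smooth_fun N W f''"
    proof
      fix v
      assume v: "v \<in> model N"
      with 1(2) obtain f'' where f'': "\<forall>x\<in>W. ((\<lambda>t::real. f (\<lambda>j. x j + of_real t * v j))
          has_vector_derivative f'' x) (at 0)" "smooth_fun N W f''"
        by blast
      have "((\<lambda>t::real. f' (\<lambda>j. x j + of_real t * v j)) has_vector_derivative f'' x) (at 0)"
        if x: "x \<in> W" for x
      proof (subst has_vector_derivative_cong_ev[where g = "\<lambda>t::real. f (\<lambda>j. x j + of_real t * v j)"])
        show "\<forall>\<^sub>F t in nhds 0. t \<in> UNIV \<longrightarrow>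
            f' (\<lambda>j. x j + complex_of_real t * v j) = f (\<lambda>j. x j + complex_of_real t * v j)"
          using lines[OF x v] by eventually_elim (simp add: eq)
        show "f' (\<lambda>j. x j + complex_of_real 0 * v j) = f (\<lambda>j. x j + complex_of_real 0 * v j)"
          using x by (simp add: eq)
      qed (use f'' x in auto)
      with f''(2) show "\<exists>f''. (\<forall>x\<in>W. ((\<lambda>t::real. f' (\<lambda>j. x j + of_real t * v j))
          has_vector_derivative f'' x) (at 0)) \<and> smooth_fun N W f''"
        by blast
    qed
  qed
qed

lemma real_line_in_siegel_dom:
  assumes "x \<in> siegel_dom g" "v \<in> cseq (triangle g)"
  shows "eventually (\<lambda>t::real. (\<lambda>j. x j + of_real t * v j) \<in> siegel_dom g) (nhds 0)"
proof (rule line_in_siegel_dom[OF assms])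
  have "isCont complex_of_real 0"
    by simp
  then show "(complex_of_real \<longlongrightarrow> 0) (nhds 0)"
    unfolding isCont_def tendsto_at_iff_tendsto_nhds by simp
qed

text \<open>The algebra generated by the entries of the inverse imaginary part is closed under
  directional derivatives, because the derivative of \<open>Y\<^sup>-\<^sup>1\<close> along \<open>V\<close> is \<open>- Y\<^sup>-\<^sup>1 V Y\<^sup>-\<^sup>1\<close>.\<close>

inductive inv_im_poly :: "nat \<Rightarrow> ((nat \<Rightarrow> complex) \<Rightarrow> complex) \<Rightarrow> bool" for g :: nat where
  const: "inv_im_poly g (\<lambda>x. c)"
| entry: "i < g \<Longrightarrow> j < g \<Longrightarrow>
    inv_im_poly g (\<lambda>x. mat_inv (im_mat (siegel_block g (uncoord x))) $$ (i, j))"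
| add: "inv_im_poly g f \<Longrightarrow> inv_im_poly g f' \<Longrightarrow> inv_im_poly g (\<lambda>x. f x + f' x)"
| mult: "inv_im_poly g f \<Longrightarrow> inv_im_poly g f' \<Longrightarrow> inv_im_poly g (\<lambda>x. f x * f' x)"

lemma inv_im_poly_sum:
  assumes "finite A" "\<And>i. i \<in> A \<Longrightarrow> inv_im_poly g (f i)"
  shows "inv_im_poly g (\<lambda>x. \<Sum>i\<in>A. f i x)"
  using assms by (induction A rule: finite_induct) (auto intro: inv_im_poly.intros)

lemma siegel_block_uncoord:
  "x \<in> siegel_dom g \<Longrightarrow> siegel_block g (uncoord x) \<in> siegel g"
  by (simp add: siegel_block_in_siegel siegel_dom_iff)

lemma inv_im_poly_continuous:
  assumes "inv_im_poly g f"
  shows "continuous_on (siegel_dom g) f"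
  using assms
proof induction
  case (entry i j)
  show ?case
    unfolding continuous_on_def
  proof
    fix x
    assume x: "x \<in> siegel_dom g"
    show "((\<lambda>x. mat_inv (im_mat (siegel_block g (uncoord x))) $$ (i, j)) \<longlongrightarrow>
        mat_inv (im_mat (siegel_block g (uncoord x))) $$ (i, j)) (at x within siegel_dom g)"
    proof (rule tendsto_mat_inv[where n = g])
      show "((\<lambda>x. im_mat (siegel_block g (uncoord x)) $$ (k, l)) \<longlongrightarrow>
          im_mat (siegel_block g (uncoord x)) $$ (k, l)) (at x within siegel_dom g)"
        if "k < g" "l < g" for k l
        using that tendsto_siegel_block[OF tendsto_ident_at that, of x "siegel_dom g"]
          carrier_matD[OF siegel_block_carrier[of g]]
        unfolding im_mat_def by (auto intro!: tendsto_intros)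
      show "det (im_mat (siegel_block g (uncoord x))) \<noteq> 0"
        by (rule det_im_mat[OF siegel_block_uncoord[OF x]])
    qed (use entry in auto)
  qed
qed (auto intro: continuous_intros)

lemma inv_im_poly_derivative:
  assumes "inv_im_poly g f" and v: "v \<in> cseq (triangle g)"
  shows "\<exists>f'. inv_im_poly g f' \<and>
    (\<forall>x\<in>siegel_dom g. ((\<lambda>t::real. f (\<lambda>j. x j + of_real t * v j)) has_vector_derivative f' x) (at 0))"
  using assms(1)
proof induction
  case (const c)
  show ?case
    by (intro exI[of _ "\<lambda>x. 0"]) (auto intro: inv_im_poly.const)
next
  case (entry i j)
  let ?Yi = "\<lambda>x. mat_inv (im_mat (siegel_block g (uncoord x)))" and ?V = "im_mat (coord_mat g v)"
  \<comment> \<open>For real \<open>t\<close> the imaginary part moves along the imaginary part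
    \<open>?V\<close> of the direction, so the derivative is \<open>- Yi ?V Yi\<close>. The sign is
    written as a constant factor to fit the rules of \<open>inv_im_poly\<close>.\<close>
  let ?f = "\<lambda>x. (- 1) * (\<Sum>k<g. \<Sum>l<g. ?Yi x $$ (i, k) * ?V $$ (k, l) * ?Yi x $$ (l, j))"
  have "inv_im_poly g ?f"
    using entry by (intro inv_im_poly.intros inv_im_poly_sum) auto
  moreover have "((\<lambda>t::real. ?Yi (\<lambda>j. x j + of_real t * v j) $$ (i, j)) has_vector_derivative ?f x) (at 0)"
    if x: "x \<in> siegel_dom g" for x
  proof -
    have Y: "im_mat (siegel_block g (uncoord (\<lambda>j. x j + of_real t * v j))) =
        im_mat (siegel_block g (uncoord x)) + of_real t \<cdot>\<^sub>m ?V" for t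
      unfolding siegel_block_line
      by (rule eq_matI) (use carrier_matD[OF siegel_block_carrier[of g]] in \<open>auto simp: im_mat_def\<close>)
    \<comment> \<open>Differentiability in a complex parameter, to be restricted to the real
      axis.\<close>
    have "((\<lambda>s. mat_inv (im_mat (siegel_block g (uncoord x)) + s \<cdot>\<^sub>m ?V) $$ (i, j))
        has_field_derivative ?f x) (at (of_real 0))"
      using mat_inv_has_field_derivative[OF _ det_im_mat[OF siegel_block_uncoord[OF x]] _ entry, of ?V]
      by simp
    then show ?thesis
      unfolding Y by (rule has_vector_derivative_real_field)
  qed
  ultimately show ?case
    by blast
next
  case (add f f')
  then obtain h h' where "inv_im_poly g h" "inv_im_poly g h'"
    "\<forall>x\<in>siegel_dom g. ((\<lambda>t::real. f (\<lambda>j. x j + of_real t * v j)) has_vector_derivative h x) (at 0)"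
    "\<forall>x\<in>siegel_dom g. ((\<lambda>t::real. f' (\<lambda>j. x j + of_real t * v j)) has_vector_derivative h' x) (at 0)"
    by blast
  then show ?case
    by (intro exI[of _ "\<lambda>x. h x + h' x"]) (auto intro: inv_im_poly.add has_vector_derivative_add)
next
  case (mult f f')
  then obtain h h' where h: "inv_im_poly g h" "inv_im_poly g h'"
    "\<forall>x\<in>siegel_dom g. ((\<lambda>t::real. f (\<lambda>j. x j + of_real t * v j)) has_vector_derivative h x) (at 0)"
    "\<forall>x\<in>siegel_dom g. ((\<lambda>t::real. f' (\<lambda>j. x j + of_real t * v j)) has_vector_derivative h' x) (at 0)"
    by blast
  have "((\<lambda>t::real. f (\<lambda>j. x j + of_real t * v j) * f' (\<lambda>j. x j + of_real t * v j))
      has_vector_derivative f x * h' x + h x * f' x) (at 0)" if "x \<in> siegel_dom g" for x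
    using has_vector_derivative_mult[OF h(3)[rule_format, OF that] h(4)[rule_format, OF that]] by simp
  then show ?case
    using mult h by (intro exI[of _ "\<lambda>x. f x * h' x + h x * f' x"]) (auto intro: inv_im_poly.intros)
qed

text \<open>The algebra itself serves as the coinductive invariant.\<close>

lemma inv_im_poly_smooth:
  assumes "inv_im_poly g f"
  shows "smooth_fun (enat (triangle g)) (siegel_dom g) f"
  using assms
proof (coinduction arbitrary: f rule: smooth_fun.coinduct)
  case smooth_fun
  have "siegel_dom g \<subseteq> cseq (triangle g)"
    by (auto simp: siegel_dom_iff')
  then have "cseq (triangle g) \<inter> siegel_dom g = siegel_dom g"
    by blast
  then have "continuous_map (subtopology (model_top (enat (triangle g))) (siegel_dom g)) euclidean f"
    using inv_im_poly_continuous[OF smooth_fun] by (simp add: model_top_def subtopology_subtopology)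
  then show ?case
    using inv_im_poly_derivative[OF smooth_fun] unfolding model_enat by blast
qed


section \<open>Existence of the invariant metrics\<close>

lemma siegel_form_sum:
  fixes p g
  defines "Yi \<equiv> mat_inv (im_mat (siegel_block g p))"
    and "e \<equiv> \<lambda>i j. prod_encode (min i j, max i j - min i j)"
  shows "siegel_form g p v w =
    (\<Sum>i<g. \<Sum>j<g. \<Sum>k<g. \<Sum>l<g. Yi $$ (i, j) * v (e j k) * Yi $$ (k, l) * cnj (w (e i l)))"
  unfolding siegel_form_def Let_def Yi_def[symmetric]
  by (intro sum.cong refl) (simp add: coord_mat_def e_def)

lemma siegel_form_linear:
  "siegel_form g p (\<lambda>k. a * u k + b * v k) w = a * siegel_form g p u w + b * siegel_form g p v w"
  unfolding siegel_form_sum sum_distrib_left sum.distrib[symmetric]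
  by (intro sum.cong refl) (simp add: algebra_simps)

lemma inv_im_mat:
  assumes "Z \<in> siegel g"
  defines "Yi \<equiv> mat_inv (im_mat Z)"
  shows "Yi \<in> carrier_mat g g" "transpose_mat Yi = Yi" "cnj_mat Yi = Yi"
proof -
  have c: "im_mat Z \<in> carrier_mat g g"
    using assms(1) by (simp add: siegel_iff)
  have "transpose_mat (im_mat Z) = im_mat (transpose_mat Z)"
    unfolding im_mat_def by (rule map_mat_transpose)
  then have "transpose_mat (im_mat Z) = im_mat Z"
    using assms(1) by (simp add: siegel_iff)
  then show "Yi \<in> carrier_mat g g" "transpose_mat Yi = Yi" "cnj_mat Yi = Yi"
    unfolding Yi_def
    using mat_inv(3)[OF c] transpose_mat_inv[OF c] cnj_mat_inv(2)[OF c] det_im_mat[OF assms(1)] by auto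
qed

lemma transpose_cnj_mat_mult:
  assumes "A \<in> carrier_mat n n" "B \<in> carrier_mat n n"
  shows "transpose_mat (cnj_mat (A * B)) = transpose_mat (cnj_mat B) * transpose_mat (cnj_mat A)"
  unfolding cnj_mat_mult[OF assms] by (rule transpose_mult[of _ n n]) (use assms in auto)

text \<open>Writing \<open>^H\<close> for adjoints, the adjoint of \<open>Yi V Yi W^H\<close> is
  \<open>W Yi V^H Yi\<close>. Its trace is the conjugate one, and a cyclic shift turns it into the
  form with the two vectors exchanged.\<close>

lemma siegel_form_cnj:
  assumes p: "p \<in> siegel_level g"
  shows "siegel_form g p w v = cnj (siegel_form g p v w)"
proof -
  define Yi where "Yi = mat_inv (im_mat (siegel_block g p))"
  note Y = inv_im_mat[OF siegel_block_in_siegel(1)[OF p], folded Yi_def]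
  let ?V = "coord_mat g v" and ?W = "coord_mat g w"
  let ?N = "Yi * (?V * (Yi * transpose_mat (cnj_mat ?W)))"
  note [simp] = Y(1) mult_carrier_mat[where nr = g and n = g and nc = g]
    assoc_mult_mat[where ?n\<^sub>1.0 = g and ?n\<^sub>2.0 = g and ?n\<^sub>3.0 = g and ?n\<^sub>4.0 = g]
  have [simp]: "transpose_mat (cnj_mat ?W) \<in> carrier_mat g g" "transpose_mat (cnj_mat ?V) \<in> carrier_mat g g"
    by auto
  have N: "?N \<in> carrier_mat g g"
    by simp
  have "cnj_mat (transpose_mat (cnj_mat ?W)) = transpose_mat ?W"
    by (rule eq_matI) auto
  then have "transpose_mat (cnj_mat ?N) = (?W * Yi) * (transpose_mat (cnj_mat ?V) * Yi)"
    by (simp add: transpose_cnj_mat_mult[of _ g] Y coord_mat_sym del: transpose_carrier_mat)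
  also have "\<dots> = ?W * (Yi * (transpose_mat (cnj_mat ?V) * Yi))"
    by simp
  finally have N': "transpose_mat (cnj_mat ?N) = ?W * (Yi * (transpose_mat (cnj_mat ?V) * Yi))" .
  have "cnj (siegel_form g p v w) = (\<Sum>i<g. transpose_mat (cnj_mat ?N) $$ (i, i))"
    unfolding siegel_form_trace[OF p] Yi_def[symmetric] cnj_sum
    by (intro sum.cong refl) (use carrier_matD[OF N] in simp)
  also have "\<dots> = (\<Sum>i<g. ((?W * (Yi * transpose_mat (cnj_mat ?V))) * Yi) $$ (i, i))"
    unfolding N' by simp
  also have "\<dots> = (\<Sum>i<g. (Yi * (?W * (Yi * transpose_mat (cnj_mat ?V)))) $$ (i, i))"
    by (rule trace_mult_commute) auto
  also have "\<dots> = siegel_form g p w v"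
    unfolding siegel_form_trace[OF p] Yi_def ..
  finally show ?thesis ..
qed

lemma mat_coord_coord_mat:
  assumes "v \<in> cseq (triangle g)"
  shows "mat_coord g (coord_mat g v) = v"
proof
  fix n
  obtain i k where ik: "prod_decode n = (i, k)"
    by (cases "prod_decode n")
  then have n: "n = prod_encode (i, k)"
    by (metis prod_decode_inverse)
  show "mat_coord g (coord_mat g v) n = v n"
  proof (cases "i + k < g")
    case True
    then show ?thesis
      by (simp add: mat_coord_def coord_mat_def n)
  next
    case False
    then have "triangle g \<le> n"
      using prod_decode_sum_less[OF ik, of g] by simp
    then have "v n = 0"
      using assms unfolding cseq_def by blast
    with False show ?thesis
      by (simp add: mat_coord_def ik)
  qed
qed

text \<open>With \<open>Y = L^T L\<close> and \<open>S = L^-T V L^-1\<close> the form becomes the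
  trace of \<open>S\<close> times its adjoint, which is the sum of the squared moduli of the entries
  of \<open>S\<close>.\<close>

lemma siegel_form_pos:
  assumes p: "p \<in> siegel_level g" and v: "v \<in> cseq (triangle g)" "v \<noteq> (\<lambda>k. 0)"
  shows "0 < Re (siegel_form g p v v)"
proof -
  define Z Y Yi where "Z = siegel_block g p" and "Y = im_mat Z" and "Yi = mat_inv Y"
  have Z: "Z \<in> siegel g"
    unfolding Z_def by (rule siegel_block_in_siegel[OF p])
  note Yi = inv_im_mat[OF Z, folded Y_def, folded Yi_def]
  have Yc [simp]: "Y \<in> carrier_mat g g"
    using Z by (simp add: Y_def siegel_iff)
  have dY: "det Y \<noteq> 0"
    unfolding Y_def by (rule det_im_mat[OF Z])
  have "\<exists>c. \<forall>i<g. \<forall>j<g. Im (p i j) = (\<Sum>m<g. c m i * c m j)"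
    using p by (intro pd_sum_of_squares) (auto simp: siegel_level_iff)
  then obtain c where c: "\<And>i j. i < g \<Longrightarrow> j < g \<Longrightarrow> Im (p i j) = (\<Sum>m<g. c m i * c m j)"
    by blast
  define L where "L = Matrix.mat g g (\<lambda>(m, i). complex_of_real (c m i))"
  have Lc [simp]: "L \<in> carrier_mat g g" and cL: "cnj_mat L = L"
    by (auto simp: L_def intro!: eq_matI)
  note [simp] = Yi(1) mult_carrier_mat[where nr = g and n = g and nc = g]
    assoc_mult_mat[where ?n\<^sub>1.0 = g and ?n\<^sub>2.0 = g and ?n\<^sub>3.0 = g and ?n\<^sub>4.0 = g]
  have YL: "Y = transpose_mat L * L"
  proof (rule eq_matI)
    fix i j
    assume "i < dim_row (transpose_mat L * L)" "j < dim_col (transpose_mat L * L)"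
    then have ij: "i < g" "j < g"
      using Lc by auto
    have "(transpose_mat L * L) $$ (i, j) = (\<Sum>m<g. transpose_mat L $$ (i, m) * L $$ (m, j))"
      by (rule mult_mat_index) (use ij in auto)
    also have "\<dots> = (\<Sum>m<g. complex_of_real (c m i * c m j))"
      by (intro sum.cong refl) (use ij in \<open>auto simp: L_def\<close>)
    also have "\<dots> = Y $$ (i, j)"
      using ij by (simp add: Y_def Z_def im_mat_def siegel_block_def c)
    finally show "Y $$ (i, j) = (transpose_mat L * L) $$ (i, j)" ..
  qed (use carrier_matD[OF Yc] carrier_matD[OF Lc] in auto)
  have dL: "det L \<noteq> 0"
    using dY det_mult[of "transpose_mat L" g L] unfolding YL by auto
  define Li where "Li = mat_inv L"
  note Li = mat_inv[OF Lc dL, folded Li_def]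
  note [simp] = Li(3)
  have cLi: "cnj_mat Li = Li"
    unfolding Li_def using cnj_mat_inv(2)[OF Lc dL] by (simp add: cL)
  have tL: "transpose_mat L * transpose_mat Li = 1\<^sub>m g" "transpose_mat Li * transpose_mat L = 1\<^sub>m g"
    by (subst transpose_mult[symmetric, where nr = g and n = g and nc = g]; simp add: Li)+
  have YiL: "Yi = Li * transpose_mat Li"
    unfolding Yi_def
  proof (rule mat_inv_unique(2)[of _ g])
    show "Y * (Li * transpose_mat Li) = 1\<^sub>m g"
      unfolding YL by (simp add: mat_cancel_left[OF Li(1)] tL)
  qed auto
  let ?V = "coord_mat g v"
  define S where "S = transpose_mat Li * (?V * Li)"
  have Sc [simp]: "S \<in> carrier_mat g g"
    by (simp add: S_def)
  have St: "transpose_mat (cnj_mat S) = transpose_mat Li * (transpose_mat (cnj_mat ?V) * Li)"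
  proof -
    have "cnj_mat (transpose_mat Li) = transpose_mat Li"
      using cLi by (simp add: map_mat_transpose[symmetric])
    then have "cnj_mat S = transpose_mat Li * (cnj_mat ?V * Li)"
      unfolding S_def by (simp add: cnj_mat_mult[of _ g] cLi)
    moreover have "transpose_mat (transpose_mat Li * (cnj_mat ?V * Li)) =
        transpose_mat (cnj_mat ?V * Li) * Li"
      by (subst transpose_mult[where nr = g and n = g and nc = g]) auto
    moreover have "transpose_mat (cnj_mat ?V * Li) = transpose_mat Li * transpose_mat (cnj_mat ?V)"
      by (subst transpose_mult[where nr = g and n = g and nc = g]) auto
    ultimately show ?thesis
      by simp
  qed
  have "siegel_form g p v v = (\<Sum>i<g. (Yi * (?V * (Yi * transpose_mat (cnj_mat ?V)))) $$ (i, i))"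
    unfolding siegel_form_trace[OF p] Yi_def Y_def Z_def ..
  also have "Yi * (?V * (Yi * transpose_mat (cnj_mat ?V))) =
      Li * (S * (transpose_mat Li * transpose_mat (cnj_mat ?V)))"
    unfolding YiL S_def by simp
  also have "(\<Sum>i<g. (Li * (S * (transpose_mat Li * transpose_mat (cnj_mat ?V)))) $$ (i, i)) =
      (\<Sum>i<g. ((S * (transpose_mat Li * transpose_mat (cnj_mat ?V))) * Li) $$ (i, i))"
    by (rule trace_mult_commute) auto
  also have "(S * (transpose_mat Li * transpose_mat (cnj_mat ?V))) * Li = S * transpose_mat (cnj_mat S)"
    unfolding St by simp
  also have "(\<Sum>i<g. (S * transpose_mat (cnj_mat S)) $$ (i, i)) =
      (\<Sum>i<g. \<Sum>j<g. S $$ (i, j) * transpose_mat (cnj_mat S) $$ (j, i))"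
    by (intro sum.cong refl mult_mat_index) auto
  also have "\<dots> = (\<Sum>i<g. \<Sum>j<g. complex_of_real ((cmod (S $$ (i, j)))\<^sup>2))"
    by (intro sum.cong refl) (use carrier_matD[OF Sc] in \<open>auto simp: complex_norm_square[symmetric]\<close>)
  finally have form: "Re (siegel_form g p v v) = (\<Sum>i<g. \<Sum>j<g. (cmod (S $$ (i, j)))\<^sup>2)"
    by simp
  have "\<exists>i<g. \<exists>j<g. S $$ (i, j) \<noteq> 0"
  proof (rule ccontr)
    assume "\<not> ?thesis"
    then have "S = 0\<^sub>m g g"
      using carrier_matD[OF Sc] by (auto intro!: eq_matI)
    \<comment> \<open>The matrix is recovered as \<open>L^T S L\<close>, so \<open>S = 0\<close>
      forces it to vanish.\<close>
    have "?V = transpose_mat L * (transpose_mat Li * ?V)"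
      by (rule mat_cancel_left[OF tL(1), symmetric]) auto
    also have "transpose_mat Li * ?V = transpose_mat Li * (?V * (Li * L))"
      by (simp add: Li)
    also have "\<dots> = S * L"
      unfolding S_def by simp
    also have "\<dots> = 0\<^sub>m g g"
      unfolding \<open>S = 0\<^sub>m g g\<close> by (rule left_mult_zero_mat[of _ g g]) simp
    also have "transpose_mat L * 0\<^sub>m g g = 0\<^sub>m g g"
      by (rule right_mult_zero_mat[of _ g g]) simp
    finally have "?V = 0\<^sub>m g g" .
    then have "v = mat_coord g (0\<^sub>m g g)"
      using mat_coord_coord_mat[OF v(1)] by simp
    also have "\<dots> = (\<lambda>k. 0)"
      by (auto simp: mat_coord_def split: prod.split)
    finally show False
      using v(2) by simp
  qed
  then obtain i j where ij: "i < g" "j < g" "S $$ (i, j) \<noteq> 0"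
    by blast
  then have "0 < (\<Sum>j<g. (cmod (S $$ (i, j)))\<^sup>2)"
    by (intro sum_pos2[of _ j]) auto
  then have "0 < (\<Sum>i<g. \<Sum>j<g. (cmod (S $$ (i, j)))\<^sup>2)"
    by (rule sum_pos2[where i = i, rotated 2]) (use ij(1) in \<open>simp_all add: sum_nonneg\<close>)
  then show ?thesis
    unfolding form .
qed


section \<open>The trace forms as a compatible family of metrics\<close>

lemma metric_preserving_iff_single_chart:
  assumes "mfd_atlas X = {(U, \<phi>)}" "mfd_atlas Y = {(V, \<psi>)}"
  shows "metric_preserving X G Y H F \<longleftrightarrow>
    (\<forall>p\<in>U. F p \<in> V \<longrightarrow> (\<forall>v\<in>model (mfd_dim X). \<forall>w\<in>model (mfd_dim X).
      H (V, \<psi>) (F p) (gateaux_deriv (mfd_dim Y) (\<psi> \<circ> F \<circ> inv_into U \<phi>) (\<phi> p) v)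
        (gateaux_deriv (mfd_dim Y) (\<psi> \<circ> F \<circ> inv_into U \<phi>) (\<phi> p) w) = G (U, \<phi>) p v w))"
  unfolding metric_preserving_def assms by (simp add: Let_def)

lemma siegel_mfd_simps [simp]:
  "mfd_dim (siegel_mfd g) = enat (triangle g)" "mfd_top (siegel_mfd g) = top_of_set (siegel_level g)"
  "mfd_atlas (siegel_mfd g) = {(siegel_level g, siegel_coord)}"
  by (simp_all add: siegel_mfd_def)

text \<open>Covers two cases at once: the identity of a level, with \<open>m = triangle g\<close>,
  and the inclusion into the next level, with the larger \<open>m\<close>.\<close>

lemma has_gateaux_deriv_inclusion:
  assumes p: "p \<in> siegel_level g" and v: "v \<in> cseq (triangle g)" "v \<in> cseq m"
    and F: "\<And>q. q \<in> siegel_level g \<Longrightarrow> F q = q"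
  shows "has_gateaux_deriv (enat m) (level_map g F) (siegel_coord p) v v"
  by (rule has_gateaux_deriv_dom_cong[OF has_gateaux_deriv_ident[OF v(2)] p v(1)])
    (simp add: inv_into_siegel_coord siegel_dom_iff F)

lemma siegel_form_smooth:
  "smooth_fun (enat (triangle g)) (siegel_dom g)
    (\<lambda>x. siegel_form g (inv_into (siegel_level g) siegel_coord x) v w)"
proof (rule smooth_fun_cong)
  show "smooth_fun (enat (triangle g)) (siegel_dom g) (\<lambda>x. siegel_form g (uncoord x) v w)"
    unfolding siegel_form_sum
    by (intro inv_im_poly_smooth inv_im_poly_sum inv_im_poly.intros) auto
qed (auto simp: inv_into_siegel_coord model_enat intro: real_line_in_siegel_dom)

lemma hermitian_siegel_form: "hermitian_metric (siegel_mfd g) (\<lambda>c. siegel_form g)"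
proof -
  have "metric_preserving (siegel_mfd g) (\<lambda>c. siegel_form g) (siegel_mfd g) (\<lambda>c. siegel_form g) (\<lambda>p. p)"
    unfolding metric_preserving_iff_single_chart[OF siegel_mfd_simps(3) siegel_mfd_simps(3)]
    by (intro ballI impI) (simp add: model_enat gateaux_derivI[OF has_gateaux_deriv_inclusion])
  then show ?thesis
    unfolding hermitian_metric_def
    by (simp add: siegel_mfd_def model_enat siegel_form_linear siegel_form_cnj[symmetric]
        siegel_form_pos siegel_form_smooth siegel_dom_def[symmetric])
qed

lemma siegel_form_symplectic:
  assumes "M \<in> symplectic_group g"
  shows "metric_preserving (siegel_mfd g) (\<lambda>c. siegel_form g) (siegel_mfd g) (\<lambda>c. siegel_form g)
    (\<lambda>p. pad (symplectic_act g M (siegel_block g p)))"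
proof -
  obtain A B C D where "symplectic_blocks g A B C D"
    and act: "\<And>Z. symplectic_act g M Z = (A * Z + B) * mat_inv (C * Z + D)"
    using symplectic_group_blocks[OF assms] by blast
  then interpret symplectic_action g A B C D
    by unfold_locales
  have F: "(\<lambda>p. pad (symplectic_act g M (siegel_block g p))) = act_pad"
    by (simp add: fun_eq_iff act_pad_def act_def act numer_def denom_def)
  show ?thesis
    unfolding metric_preserving_iff_single_chart[OF siegel_mfd_simps(3) siegel_mfd_simps(3)] F
    by (intro ballI impI)
      (simp add: model_enat gateaux_derivI[OF has_gateaux_deriv_act_pad] siegel_form_invariant)
qed

lemma siegel_level_outside:
  "p \<in> siegel_level g \<Longrightarrow> g \<le> i \<or> g \<le> j \<Longrightarrow> p i j = (if i = j then \<i> else 0)"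
  unfolding siegel_level_iff by blast

text \<open>The imaginary part gains a diagonal entry 1, hence so does its inverse, and the old
  block is unchanged. Terms involving the index \<open>g\<close> drop out because \<open>v\<close>
  and \<open>w\<close> have no coordinates there.\<close>

lemma siegel_form_Suc:
  assumes p: "p \<in> siegel_level g" and v: "v \<in> cseq (triangle g)" and w: "w \<in> cseq (triangle g)"
  shows "siegel_form (Suc g) p v w = siegel_form g p v w"
proof -
  define e where "e i j = prod_encode (min i j, max i j - min i j)" for i j :: nat
  have zero: "u (e i g) = 0" "u (e g i) = 0" if "u \<in> cseq (triangle g)" for u i
  proof -
    have "\<not> e i g < triangle g" "\<not> e g i < triangle g"
      unfolding e_def prod_encode_less_triangle by auto
    with that show "u (e i g) = 0" "u (e g i) = 0"
      unfolding cseq_def by (metis (mono_tags) mem_Collect_eq not_le)+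
  qed
  let ?Y = "im_mat (siegel_block g p)" and ?Y' = "im_mat (siegel_block (Suc g) p)"
  note Z = siegel_block_in_siegel(1)[OF p]
  note Yi = inv_im_mat(1)[OF Z] and inv = mat_inv(1)[OF im_mat_carrier[THEN iffD2, OF siegel_block_carrier] det_im_mat[OF Z]]
  let ?B = "four_block_mat (mat_inv ?Y) (0\<^sub>m g 1) (0\<^sub>m 1 g) (1\<^sub>m 1)"
  have Y': "?Y' = four_block_mat ?Y (0\<^sub>m g 1) (0\<^sub>m 1 g) (1\<^sub>m 1)"
  proof (rule eq_matI)
    fix i j
    assume "i < dim_row (four_block_mat ?Y (0\<^sub>m g 1) (0\<^sub>m 1 g) (1\<^sub>m 1 :: complex mat))"
      "j < dim_col (four_block_mat ?Y (0\<^sub>m g 1) (0\<^sub>m 1 g) (1\<^sub>m 1 :: complex mat))"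
    then have ij: "i < Suc g" "j < Suc g"
      by (simp_all add: im_mat_def siegel_block_def)
    have "p i j = (if i = j then \<i> else 0)" if "g \<le> i \<or> g \<le> j"
      by (rule siegel_level_outside[OF p that])
    with ij show "?Y' $$ (i, j) = four_block_mat ?Y (0\<^sub>m g 1) (0\<^sub>m 1 g) (1\<^sub>m 1) $$ (i, j)"
      by (auto simp: im_mat_def siegel_block_def)
  qed (auto simp: im_mat_def siegel_block_def)
  have "?Y' * ?B = four_block_mat (1\<^sub>m g) (0\<^sub>m g 1) (0\<^sub>m 1 g) (1\<^sub>m 1)"
    unfolding Y' using Yi inv
    by (subst mult_four_block_mat[of _ g g _ 1 _ 1 _ _ g _ 1])
      (auto simp: left_mult_zero_mat[of _ g g] right_mult_zero_mat[of _ g g])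
  also have "\<dots> = 1\<^sub>m (Suc g)"
    by simp
  finally have "?Y' * ?B = 1\<^sub>m (Suc g)" .
  moreover have "?B \<in> carrier_mat (g + 1) (g + 1)"
    by (rule four_block_carrier_mat[OF Yi]) simp
  ultimately have "mat_inv ?Y' = ?B"
    by (intro mat_inv_unique(2)[of _ "Suc g"]) simp_all
  then have Yi': "mat_inv ?Y' $$ (i, j) = mat_inv ?Y $$ (i, j)" if "i < g" "j < g" for i j
    using that carrier_matD[OF Yi] by simp
  show ?thesis
    unfolding siegel_form_sum e_def[symmetric]
    by (simp add: zero[OF v] zero[OF w] Yi')
qed

lemma compatible_siegel_form: "compatible_invariant_metrics (\<lambda>g c. siegel_form g)"
  unfolding compatible_invariant_metrics_def invariant_hermitian_metric_def
proof (intro allI impI conjI ballI hermitian_siegel_form siegel_form_symplectic)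
  fix g :: nat
  let ?F = "\<lambda>p. pad (siegel_embed g (siegel_block g p))"
  \<comment> \<open>On infinite matrices the embedding is the identity, hence so is its
    derivative.\<close>
  have F: "?F p = p" if "p \<in> siegel_level g" for p
    using siegel_block_in_siegel(2)[OF that] by (simp add: pad_siegel_embed)
  show "metric_preserving (siegel_mfd g) (\<lambda>c. siegel_form g) (siegel_mfd (Suc g)) (\<lambda>c. siegel_form (Suc g)) ?F"
    unfolding metric_preserving_iff_single_chart[OF siegel_mfd_simps(3) siegel_mfd_simps(3)]
      siegel_mfd_simps model_enat
  proof (intro ballI impI)
    fix p v w
    assume p: "p \<in> siegel_level g" and v: "v \<in> cseq (triangle g)" and w: "w \<in> cseq (triangle g)"
    let ?D = "gateaux_deriv (enat (triangle (Suc g)))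
      (level_map g ?F) (siegel_coord p)"
    have D: "?D u = u" if u: "u \<in> cseq (triangle g)" for u
    proof (rule gateaux_derivI, rule has_gateaux_deriv_inclusion[OF p u _ F])
      have "triangle g \<le> triangle (Suc g)"
        by simp
      then show "u \<in> cseq (triangle (Suc g))"
        using u monoD[OF mono_cseq] by blast
    qed
    show "siegel_form (Suc g) (?F p) (?D v) (?D w) = siegel_form g p v w"
      unfolding D[OF v] D[OF w] F[OF p] by (rule siegel_form_Suc[OF p v w])
  qed
qed


section \<open>The limit manifold\<close>

abbreviation siegel_union :: "(nat \<Rightarrow> nat \<Rightarrow> complex) set" where
  "siegel_union \<equiv> \<Union>n. siegel_level (Suc n)"

abbreviation siegel_udom :: "(nat \<Rightarrow> complex) set" where
  "siegel_udom \<equiv> \<Union>n. siegel_dom (Suc n)"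

lemma siegel_limit_simps [simp]:
  "mfd_dim siegel_limit = \<infinity>"
  "mfd_top siegel_limit = direct_limit_topology (\<lambda>n. siegel_level (Suc n))"
  "mfd_atlas siegel_limit = {(siegel_union, siegel_coord)}"
  by (simp_all add: siegel_limit_def)

abbreviation union_map ::
  "((nat \<Rightarrow> nat \<Rightarrow> complex) \<Rightarrow> nat \<Rightarrow> nat \<Rightarrow> complex) \<Rightarrow> (nat \<Rightarrow> complex) \<Rightarrow> nat \<Rightarrow> complex" where
  "union_map F \<equiv> siegel_coord \<circ> F \<circ> inv_into siegel_union siegel_coord"

lemma siegel_level_mono: "p \<in> siegel_level g \<Longrightarrow> g \<le> g' \<Longrightarrow> p \<in> siegel_level g'"
  using monoD[OF mono_siegel_level] by blast

lemma siegel_dom_mono: "x \<in> siegel_dom g \<Longrightarrow> g \<le> g' \<Longrightarrow> x \<in> siegel_dom g'"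
  using monoD[OF mono_siegel_dom] by blast

lemma siegel_unionI: "p \<in> siegel_level g \<Longrightarrow> p \<in> siegel_union"
  by (rule UN_I[of g]) (auto intro: siegel_level_mono)

lemma siegel_udomI: "x \<in> siegel_dom g \<Longrightarrow> x \<in> siegel_udom"
  by (rule UN_I[of g]) (auto intro: siegel_dom_mono)

lemma siegel_unionE:
  assumes "p \<in> siegel_union"
  obtains g0 where "\<And>g. g0 \<le> g \<Longrightarrow> p \<in> siegel_level g"
proof -
  from assms obtain n where "p \<in> siegel_level (Suc n)"
    by blast
  then show ?thesis
    using that[of "Suc n"] siegel_level_mono by blast
qed

lemma siegel_udomE:
  assumes "x \<in> siegel_udom"
  obtains g0 where "\<And>g. g0 \<le> g \<Longrightarrow> x \<in> siegel_dom g"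
proof -
  from assms obtain n where "x \<in> siegel_dom (Suc n)"
    by blast
  then show ?thesis
    using that[of "Suc n"] siegel_dom_mono by blast
qed

lemma siegel_coord_union: "siegel_coord ` siegel_union = siegel_udom"
  by (simp add: siegel_dom_def image_UN)

lemma uncoord_siegel_coord_union: "p \<in> siegel_union \<Longrightarrow> uncoord (siegel_coord p) = p"
  using uncoord_siegel_coord_level by blast

lemma inv_into_siegel_union:
  assumes "x \<in> siegel_udom"
  shows "inv_into siegel_union siegel_coord x = uncoord x"
proof -
  obtain n where "x \<in> siegel_dom (Suc n)"
    using assms by (rule UN_E)
  then have u: "uncoord x \<in> siegel_union"
    unfolding siegel_dom_iff by (rule siegel_unionI)
  have "inj_on siegel_coord siegel_union"
    by (rule inj_on_inverseI[of _ uncoord]) (rule uncoord_siegel_coord_union)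
  from inv_into_f_f[OF this u] show ?thesis
    by simp
qed

lemma siegel_udom_Int_cseq: "siegel_udom \<inter> cseq (triangle (Suc n)) = siegel_dom (Suc n)"
proof
  show "siegel_udom \<inter> cseq (triangle (Suc n)) \<subseteq> siegel_dom (Suc n)"
    by (auto simp del: triangle_Suc intro: siegel_dom_Int_cseq)
  show "siegel_dom (Suc n) \<subseteq> siegel_udom \<inter> cseq (triangle (Suc n))"
    by (auto simp: siegel_dom_iff' simp del: triangle_Suc)
qed

text \<open>The coordinate space with index \<open>n\<close> need not belong to a level, but it is
  contained in the one with index \<open>triangle (Suc n)\<close>, on which the trace is an open
  domain.\<close>

lemma openin_siegel_udom: "openin (model_top \<infinity>) siegel_udom"
proof -
  have "openin (top_of_set (cseq n)) (siegel_udom \<inter> cseq n)" for n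
  proof -
    have sub: "cseq n \<subseteq> cseq (triangle (Suc n))"
      using monoD[OF mono_cseq, of n "triangle (Suc n)"] triangle_ge[of "Suc n"]
      by (auto simp del: triangle_Suc)
    obtain V where V: "open V" "siegel_dom (Suc n) = cseq (triangle (Suc n)) \<inter> V"
      using openin_siegel_dom[of "Suc n"] unfolding openin_open by blast
    have "siegel_udom \<inter> cseq n = cseq n \<inter> V"
      using V(2) siegel_udom_Int_cseq[of n] sub by blast
    then show ?thesis
      using V(1) by (simp add: openin_open_Int)
  qed
  moreover have "siegel_udom \<subseteq> (\<Union>n. cseq n)"
    by (auto simp: siegel_dom_iff')
  ultimately show ?thesis
    by (simp add: model_top_def openin_direct_limit_topology)
qed

lemma subtopology_model_udom:
  "subtopology (model_top \<infinity>) siegel_udom = direct_limit_topology (\<lambda>n. siegel_dom (Suc n))"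
proof -
  have "n \<le> triangle (Suc n)" for n
    using triangle_ge[of "Suc n"] by linarith
  then show ?thesis
    unfolding model_top_def enat.case
    using openin_siegel_udom siegel_udom_Int_cseq
    by (intro subtopology_direct_limit[where r = "\<lambda>n. triangle (Suc n)"] mono_cseq)
      (simp_all add: model_top_def del: triangle_Suc)
qed

lemma mono_Suc_level: "mono (\<lambda>n. siegel_level (Suc n))"
  using mono_siegel_level unfolding mono_def by simp

lemma mono_Suc_dom: "mono (\<lambda>n. siegel_dom (Suc n))"
  using mono_siegel_dom unfolding mono_def by simp

text \<open>Both spaces are direct limits of corresponding levels, so each map is tested level by
  level, where the topologies are induced from products.\<close>

lemma homeomorphic_maps_siegel_coord:
  "homeomorphic_maps (mfd_top siegel_limit) (subtopology (model_top \<infinity>) siegel_udom)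
    siegel_coord uncoord"
  unfolding homeomorphic_maps_def subtopology_model_udom siegel_limit_simps
    topspace_direct_limit_topology
proof (intro conjI ballI)
  show "continuous_map (direct_limit_topology (\<lambda>n. siegel_level (Suc n)))
      (direct_limit_topology (\<lambda>n. siegel_dom (Suc n))) siegel_coord"
  proof (rule continuous_map_from_direct_limit[OF mono_Suc_level, of 0],
      rule continuous_map_into_direct_limit)
    fix n
    show "continuous_map (top_of_set (siegel_level (Suc n))) (top_of_set (siegel_dom (Suc n))) siegel_coord"
      by (simp add: continuous_on_siegel_coord siegel_dom_def)
  qed
  show "continuous_map (direct_limit_topology (\<lambda>n. siegel_dom (Suc n)))
      (direct_limit_topology (\<lambda>n. siegel_level (Suc n))) uncoord"
  proof (rule continuous_map_from_direct_limit[OF mono_Suc_dom, of 0],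
      rule continuous_map_into_direct_limit)
    fix n
    show "continuous_map (top_of_set (siegel_dom (Suc n))) (top_of_set (siegel_level (Suc n))) uncoord"
      by (auto simp: continuous_on_uncoord siegel_dom_iff)
  qed
qed (auto simp: uncoord_siegel_coord_union)

text \<open>The conditions on a map that pass to the limit. They are asked only from some level on,
  since a symmetry is controlled on those levels that contain its centre.\<close>

definition levelwise :: "((nat \<Rightarrow> nat \<Rightarrow> complex) \<Rightarrow> nat \<Rightarrow> nat \<Rightarrow> complex) \<Rightarrow> bool" where
  "levelwise F \<longleftrightarrow> (\<exists>g0. \<forall>g\<ge>g0. F ` siegel_level g \<subseteq> siegel_level g \<and>
     continuous_on (siegel_level g) F \<and>
     (\<forall>p\<in>siegel_level g. \<forall>v\<in>cseq (triangle g). \<exists>d. has_gateaux_deriv (enat (triangle g)) (level_map g F) (siegel_coord p) v d))"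

text \<open>The two coordinate expressions agree on \<open>siegel_dom g\<close>, and lines in the
  direction \<open>v\<close> stay there for small parameters.\<close>

lemma has_gateaux_deriv_limit:
  assumes p: "p \<in> siegel_level g" and v: "v \<in> cseq (triangle g)"
    and d: "has_gateaux_deriv (enat (triangle g)) (level_map g F) (siegel_coord p) v d"
  shows "has_gateaux_deriv \<infinity> (union_map F) (siegel_coord p) v d"
  by (rule has_gateaux_deriv_dom_cong[OF has_gateaux_deriv_infinity[OF d] p v])
    (simp add: inv_into_siegel_coord inv_into_siegel_union[OF siegel_udomI])

lemma levelwise_continuous:
  assumes "levelwise F"
  shows "continuous_map (mfd_top siegel_limit) (mfd_top siegel_limit) F"
proof -
  obtain g0 where g0: "\<And>g. g0 \<le> g \<Longrightarrow> F ` siegel_level g \<subseteq> siegel_level g"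
    "\<And>g. g0 \<le> g \<Longrightarrow> continuous_on (siegel_level g) F"
    using assms unfolding levelwise_def by blast
  show ?thesis
    unfolding siegel_limit_simps
  proof (rule continuous_map_from_direct_limit[OF mono_Suc_level, of g0],
      rule continuous_map_into_direct_limit)
    fix n
    assume "g0 \<le> n"
    then have "F ` siegel_level (Suc n) \<subseteq> siegel_level (Suc n)" "continuous_on (siegel_level (Suc n)) F"
      using g0[of "Suc n"] by auto
    then show "continuous_map (top_of_set (siegel_level (Suc n))) (top_of_set (siegel_level (Suc n))) F"
      by (simp add: image_subset_iff_funcset)
  qed
qed

text \<open>Continuity is transported through the global chart. A point and a direction already lie
  in a common level, so the Gateaux derivative is found there.\<close>

lemma levelwise_holomorphic_map:
  assumes F: "levelwise F"
  shows "holomorphic_map \<infinity> \<infinity> siegel_udom (union_map F)"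
  unfolding holomorphic_map_def
proof (intro conjI ballI)
  have c: "continuous_map (mfd_top siegel_limit) (model_top \<infinity>) siegel_coord"
    "continuous_map (subtopology (model_top \<infinity>) siegel_udom) (mfd_top siegel_limit) uncoord"
    using homeomorphic_maps_siegel_coord unfolding homeomorphic_maps_def
    by (auto dest: continuous_map_into_fulltopology)
  have "continuous_map (subtopology (model_top \<infinity>) siegel_udom) (model_top \<infinity>)
      (siegel_coord \<circ> F \<circ> uncoord)"
    by (intro continuous_map_compose[OF c(2)] continuous_map_compose[OF levelwise_continuous[OF F]] c(1))
  then show "continuous_map (subtopology (model_top \<infinity>) siegel_udom) (model_top \<infinity>)
      (union_map F)"
    by (rule continuous_map_eq) (auto simp: inv_into_siegel_union)
  fix x v
  assume x: "x \<in> siegel_udom" and v: "v \<in> model \<infinity>"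
  obtain g0 where g0: "\<And>g. g0 \<le> g \<Longrightarrow> \<forall>p\<in>siegel_level g. \<forall>v\<in>cseq (triangle g).
      \<exists>d. has_gateaux_deriv (enat (triangle g)) (level_map g F) (siegel_coord p) v d"
    using F unfolding levelwise_def by blast
  obtain g1 where g1: "\<And>g. g1 \<le> g \<Longrightarrow> x \<in> siegel_dom g"
    using siegel_udomE[OF x] by blast
  obtain g2 where g2: "\<And>g. g2 \<le> g \<Longrightarrow> v \<in> cseq (triangle g)"
    using model_infinity_triangle[OF v] by blast
  define g where "g = max g0 (max g1 g2)"
  have g: "x \<in> siegel_dom g" "v \<in> cseq (triangle g)" "g0 \<le> g"
    using g1[of g] g2[of g] by (auto simp: g_def)
  have p: "uncoord x \<in> siegel_level g"
    using g(1) by (simp add: siegel_dom_iff)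
  with g0[OF g(3)] g(2) obtain d where "has_gateaux_deriv (enat (triangle g)) (level_map g F) (siegel_coord (uncoord x)) v d"
    by blast
  from has_gateaux_deriv_limit[OF p g(2) this]
  show "\<exists>d. has_gateaux_deriv \<infinity> (union_map F) x v d"
    by auto
qed

lemma levelwise_holomorphic:
  assumes F: "levelwise F"
  shows "mfd_holomorphic siegel_limit siegel_limit F"
proof -
  have "F p \<in> siegel_union" if "p \<in> siegel_union" for p
    using levelwise_continuous[OF F] that
    by (auto simp: continuous_map_def topspace_direct_limit_topology Pi_iff)
  then have "{p \<in> siegel_union. F p \<in> siegel_union} = siegel_union"
    by blast
  then show ?thesis
    using levelwise_continuous[OF F] levelwise_holomorphic_map[OF F] siegel_coord_union
    unfolding mfd_holomorphic_def siegel_limit_simps by simp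
qed

lemma levelwise_ident: "levelwise (\<lambda>p. p)"
  unfolding levelwise_def
  by (intro exI[of _ 0] allI impI conjI ballI)
    (auto intro: continuous_on_id has_gateaux_deriv_inclusion)

lemma complex_manifold_siegel_limit: "complex_manifold siegel_limit"
proof -
  have "homeomorphic_map (mfd_top siegel_limit) (subtopology (model_top \<infinity>) siegel_udom) siegel_coord"
    using homeomorphic_maps_siegel_coord homeomorphic_map_maps by blast
  moreover have "subtopology (mfd_top siegel_limit) siegel_union = mfd_top siegel_limit"
    by (metis siegel_limit_simps(2) subtopology_topspace topspace_direct_limit_topology)
  moreover have "openin (mfd_top siegel_limit) siegel_union"
    by (metis openin_topspace siegel_limit_simps(2) topspace_direct_limit_topology)
  \<comment> \<open>The only transition map is the coordinate expression of the identity.\<close>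
  moreover have "union_map (\<lambda>p. p) =
      siegel_coord \<circ> inv_into siegel_union siegel_coord"
    by (simp add: fun_eq_iff)
  ultimately show ?thesis
    unfolding complex_manifold_def
    using levelwise_holomorphic_map[OF levelwise_ident] openin_siegel_udom siegel_coord_union
    by (simp add: topspace_direct_limit_topology Hausdorff_direct_limit)
qed


section \<open>The limit metric\<close>

text \<open>The embedding is the identity on infinite matrices and its derivative the identity on
  coordinates, so preserving the metrics means equality of the two values.\<close>

lemma compatible_metric_Suc:
  assumes h: "compatible_invariant_metrics h" and g: "1 \<le> g" and p: "p \<in> siegel_level g"
    and v: "v \<in> cseq (triangle g)" and w: "w \<in> cseq (triangle g)"
  shows "h (Suc g) (siegel_level (Suc g), siegel_coord) p v w = h g (siegel_level g, siegel_coord) p v w"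
proof -
  let ?F = "\<lambda>p. pad (siegel_embed g (siegel_block g p))"
  let ?D = "gateaux_deriv (enat (triangle (Suc g)))
    (level_map g ?F) (siegel_coord p)"
  have F: "?F q = q" if "q \<in> siegel_level g" for q
    using siegel_block_in_siegel(2)[OF that] by (simp add: pad_siegel_embed)
  have D: "?D u = u" if u: "u \<in> cseq (triangle g)" for u
  proof (rule gateaux_derivI, rule has_gateaux_deriv_inclusion[OF p u _ F])
    have "triangle g \<le> triangle (Suc g)"
      by simp
    then show "u \<in> cseq (triangle (Suc g))"
      using u monoD[OF mono_cseq] by blast
  qed
  have Fp: "?F p \<in> siegel_level (Suc g)"
    unfolding F[OF p] by (rule siegel_level_mono[OF p]) simp
  have "metric_preserving (siegel_mfd g) (h g) (siegel_mfd (Suc g)) (h (Suc g)) ?F"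
    using h g unfolding compatible_invariant_metrics_def by blast
  then have "h (Suc g) (siegel_level (Suc g), siegel_coord) (?F p) (?D v) (?D w) =
      h g (siegel_level g, siegel_coord) p v w"
    unfolding metric_preserving_iff_single_chart[OF siegel_mfd_simps(3) siegel_mfd_simps(3)]
      siegel_mfd_simps model_enat
    using p Fp v w by blast
  then show ?thesis
    unfolding D[OF v] D[OF w] F[OF p] .
qed

text \<open>Induction upwards from the least admissible level, with one application of compatibility
  per step.\<close>

lemma limit_metric_eq:
  assumes h: "compatible_invariant_metrics h" and g: "1 \<le> g" and p: "p \<in> siegel_level g"
    and v: "v \<in> cseq (triangle g)" and w: "w \<in> cseq (triangle g)"
  shows "limit_metric h c p v w = h g (siegel_level g, siegel_coord) p v w"
proof -
  let ?P = "\<lambda>g. 1 \<le> g \<and> p \<in> siegel_level g \<and> v \<in> cseq (triangle g) \<and> w \<in> cseq (triangle g)"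
  define m where "m = (LEAST g. ?P g)"
  have m: "?P m"
    unfolding m_def by (rule LeastI[of ?P g]) (use assms in simp)
  have "m \<le> g"
    unfolding m_def by (rule Least_le) (use assms in simp)
  then have "h g (siegel_level g, siegel_coord) p v w = h m (siegel_level m, siegel_coord) p v w"
  proof (induction g rule: dec_induct)
    case (step n)
    have "cseq (triangle m) \<subseteq> cseq (triangle n)"
      using step.hyps monoD[OF mono_cseq monoD[OF mono_triangle]] by blast
    then have "h (Suc n) (siegel_level (Suc n), siegel_coord) p v w = h n (siegel_level n, siegel_coord) p v w"
      using m step.hyps siegel_level_mono[of p m n] by (intro compatible_metric_Suc[OF h]) auto
    with step.IH show ?case
      by simp
  qed simp
  then show ?thesis
    unfolding limit_metric_def m_def Let_def by (rule sym)
qed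

lemma common_level:
  assumes "p \<in> siegel_union" "v \<in> model \<infinity>" "w \<in> model \<infinity>"
  obtains g where "1 \<le> g" "g0 \<le> g" "p \<in> siegel_level g" "v \<in> cseq (triangle g)" "w \<in> cseq (triangle g)"
proof -
  obtain g1 where g1: "\<And>g. g1 \<le> g \<Longrightarrow> p \<in> siegel_level g"
    using siegel_unionE[OF assms(1)] by blast
  obtain g2 where g2: "\<And>g. g2 \<le> g \<Longrightarrow> v \<in> cseq (triangle g)"
    using model_infinity_triangle[OF assms(2)] by blast
  obtain g3 where g3: "\<And>g. g3 \<le> g \<Longrightarrow> w \<in> cseq (triangle g)"
    using model_infinity_triangle[OF assms(3)] by blast
  show ?thesis
    by (rule that[of "Suc (g0 + g1 + g2 + g3)"]) (auto intro: g1 g2 g3 simp del: triangle_Suc)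
qed

text \<open>The derivative in the limit coincides with the one on a common level \<open>g\<close>
  and stays in \<open>cseq (triangle g)\<close>, so both sides of the claim are values of
  \<open>h g\<close>.\<close>

lemma levelwise_metric_preserving:
  assumes h: "compatible_invariant_metrics h" and F: "levelwise F"
    and G: "\<And>g. g1 \<le> g \<Longrightarrow> metric_preserving (siegel_mfd g) (h g) (siegel_mfd g) (h g) F"
  shows "metric_preserving siegel_limit (limit_metric h) siegel_limit (limit_metric h) F"
  unfolding metric_preserving_iff_single_chart[OF siegel_limit_simps(3) siegel_limit_simps(3)]
    siegel_limit_simps
proof (intro ballI impI)
  fix p v w
  assume p: "p \<in> siegel_union" and v: "v \<in> model \<infinity>" and w: "w \<in> model \<infinity>"
  obtain g0 where g0: "\<And>g. g0 \<le> g \<Longrightarrow> F ` siegel_level g \<subseteq> siegel_level g \<and>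
      (\<forall>p\<in>siegel_level g. \<forall>v\<in>cseq (triangle g). \<exists>d. has_gateaux_deriv (enat (triangle g)) (level_map g F) (siegel_coord p) v d)"
    using F unfolding levelwise_def by blast
  obtain g where g: "1 \<le> g" "max g0 g1 \<le> g" "p \<in> siegel_level g" "v \<in> cseq (triangle g)" "w \<in> cseq (triangle g)"
    by (rule common_level[OF p v w])
  then have gg: "g0 \<le> g" "g1 \<le> g"
    by auto
  let ?D = "gateaux_deriv (enat (triangle g))
    (level_map g F) (siegel_coord p)"
  let ?D' = "gateaux_deriv \<infinity> (union_map F) (siegel_coord p)"
  have D: "?D' u = ?D u \<and> ?D u \<in> cseq (triangle g)" if u: "u \<in> cseq (triangle g)" for u
  proof -
    obtain d where d: "has_gateaux_deriv (enat (triangle g)) (level_map g F) (siegel_coord p) u d"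
      using g0[OF gg(1)] g(3) u by blast
    have "?D u = d" "?D' u = d"
      using gateaux_derivI[OF d] gateaux_derivI[OF has_gateaux_deriv_limit[OF g(3) u d]] by auto
    with d show ?thesis
      by (simp add: has_gateaux_deriv_enat_iff)
  qed
  have Fp: "F p \<in> siegel_level g"
    using g0[OF gg(1)] g(3) by blast
  have "h g (siegel_level g, siegel_coord) (F p) (?D v) (?D w) = h g (siegel_level g, siegel_coord) p v w"
    using G[OF gg(2)] g Fp
    unfolding metric_preserving_iff_single_chart[OF siegel_mfd_simps(3) siegel_mfd_simps(3)]
      siegel_mfd_simps model_enat by blast
  then show "limit_metric h (siegel_union, siegel_coord) (F p) (?D' v) (?D' w) =
      limit_metric h (siegel_union, siegel_coord) p v w"
    using limit_metric_eq[OF h g(1) g(3-5)] limit_metric_eq[OF h g(1) Fp] D[OF g(4)] D[OF g(5)] by simp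
qed

lemma top_of_set_siegel_dom:
  "subtopology (model_top (enat (triangle g))) (siegel_dom g) = top_of_set (siegel_dom g)"
proof -
  have "siegel_dom g \<subseteq> cseq (triangle g)"
    by (auto simp: siegel_dom_iff')
  then have "cseq (triangle g) \<inter> siegel_dom g = siegel_dom g"
    by blast
  then show ?thesis
    by (simp add: model_top_def subtopology_subtopology)
qed

text \<open>Coinduction on the property of being smooth on all large levels. The bound
  \<open>g0\<close> varies with the function, because a direction \<open>v\<close> may belong only
  to high levels.\<close>

lemma smooth_fun_limit:
  assumes "\<And>g. g0 \<le> g \<Longrightarrow> smooth_fun (enat (triangle g)) (siegel_dom g) f"
  shows "smooth_fun \<infinity> siegel_udom f"
  using assms
proof (coinduction arbitrary: f g0 rule: smooth_fun.coinduct)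
  case (smooth_fun f g0)
  have hyp: "smooth_fun (enat (triangle g)) (siegel_dom g) f" if "g0 \<le> g" for g
    using smooth_fun that by blast
  have cont: "continuous_map (subtopology (model_top \<infinity>) siegel_udom) euclidean f"
    unfolding subtopology_model_udom
  proof (rule continuous_map_from_direct_limit[OF mono_Suc_dom, of g0])
    fix n
    assume "g0 \<le> n"
    then have "smooth_fun (enat (triangle (Suc n))) (siegel_dom (Suc n)) f"
      by (intro hyp) simp
    then show "continuous_map (top_of_set (siegel_dom (Suc n))) euclidean f"
      by cases (simp only: top_of_set_siegel_dom)
  qed
  have "\<exists>f'. (\<forall>x\<in>siegel_udom. ((\<lambda>t::real. f (\<lambda>j. x j + of_real t * v j)) has_vector_derivative f' x) (at 0)) \<and>
      (\<exists>g1. \<forall>g\<ge>g1. smooth_fun (enat (triangle g)) (siegel_dom g) f')" if v: "v \<in> model \<infinity>" for v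
  proof -
    obtain g1 where g1: "\<And>g. g1 \<le> g \<Longrightarrow> v \<in> cseq (triangle g)"
      using model_infinity_triangle[OF v] by blast
    \<comment> \<open>The derivative functions supplied on different levels are separate choices;
      \<open>vector_derivative\<close> gives one function that agrees with each of them on its
      domain.\<close>
    define f' where "f' x = vector_derivative (\<lambda>t::real. f (\<lambda>j. x j + of_real t * v j)) (at 0)" for x
    have *: "smooth_fun (enat (triangle g)) (siegel_dom g) f' \<and>
        (\<forall>x\<in>siegel_dom g. ((\<lambda>t::real. f (\<lambda>j. x j + of_real t * v j)) has_vector_derivative f' x) (at 0))"
      if g: "max g0 g1 \<le> g" for g
    proof -
      have vg: "v \<in> model (enat (triangle g))"
        using g1[of g] g by (simp add: model_enat)
      have "smooth_fun (enat (triangle g)) (siegel_dom g) f"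
        using g by (intro hyp) simp
      then obtain f'' where f'': "\<And>x. x \<in> siegel_dom g \<Longrightarrow>
          ((\<lambda>t::real. f (\<lambda>j. x j + of_real t * v j)) has_vector_derivative f'' x) (at 0)"
        "smooth_fun (enat (triangle g)) (siegel_dom g) f''"
        using vg by cases blast
      have eq: "f'' x = f' x" if "x \<in> siegel_dom g" for x
        unfolding f'_def by (rule vector_derivative_at[OF f''(1)[OF that], symmetric])
      have "smooth_fun (enat (triangle g)) (siegel_dom g) f'"
        by (rule smooth_fun_cong[OF f''(2) eq]) (auto simp: model_enat intro: real_line_in_siegel_dom)
      with f''(1) eq show ?thesis
        by simp
    qed
    have "((\<lambda>t::real. f (\<lambda>j. x j + of_real t * v j)) has_vector_derivative f' x) (at 0)"
      if x: "x \<in> siegel_udom" for x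
    proof -
      obtain g2 where "\<And>g. g2 \<le> g \<Longrightarrow> x \<in> siegel_dom g"
        using siegel_udomE[OF x] by blast
      then show ?thesis
        using *[of "max g2 (max g0 g1)"] by simp
    qed
    with * show ?thesis
      by blast
  qed
  note deriv = this
  show ?case
  proof (rule exI[of _ f], intro conjI refl cont ballI)
    fix v
    assume v: "v \<in> model \<infinity>"
    obtain f' where f': "(\<forall>x\<in>siegel_udom.
        ((\<lambda>t::real. f (\<lambda>j. x j + of_real t * v j)) has_vector_derivative f' x) (at 0)) \<and>
        (\<exists>g1. \<forall>g\<ge>g1. smooth_fun (enat (triangle g)) (siegel_dom g) f')"
      using deriv[OF v] by (rule exE)
    have "\<exists>f g0. f' = f \<and> (\<forall>g\<ge>g0. smooth_fun (enat (triangle g)) (siegel_dom g) f)"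
      by (rule exI[of _ f'], simp only: simp_thms, rule conjunct2[OF f'])
    from conjI[OF conjunct1[OF f'] disjI1[OF this]]
    show "\<exists>f'. (\<forall>x\<in>siegel_udom.
          ((\<lambda>t::real. f (\<lambda>j. x j + of_real t * v j)) has_vector_derivative f' x) (at 0)) \<and>
        ((\<exists>f g0. f' = f \<and> (\<forall>g\<ge>g0. smooth_fun (enat (triangle g)) (siegel_dom g) f)) \<or>
          smooth_fun \<infinity> siegel_udom f')"
      by (rule exI[of _ f'])
  qed
qed

lemma hermitian_metric_iff_single_chart:
  assumes "mfd_atlas X = {(U, \<phi>)}"
  shows "hermitian_metric X G \<longleftrightarrow>
    (\<forall>p\<in>U. \<forall>u\<in>model (mfd_dim X). \<forall>v\<in>model (mfd_dim X). \<forall>w\<in>model (mfd_dim X). \<forall>a b.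
      G (U, \<phi>) p (\<lambda>k. a * u k + b * v k) w = a * G (U, \<phi>) p u w + b * G (U, \<phi>) p v w) \<and>
    (\<forall>p\<in>U. \<forall>v\<in>model (mfd_dim X). \<forall>w\<in>model (mfd_dim X).
      G (U, \<phi>) p w v = cnj (G (U, \<phi>) p v w)) \<and>
    (\<forall>p\<in>U. \<forall>v\<in>model (mfd_dim X). v \<noteq> (\<lambda>k. 0) \<longrightarrow> 0 < Re (G (U, \<phi>) p v v)) \<and>
    (\<forall>v\<in>model (mfd_dim X). \<forall>w\<in>model (mfd_dim X).
      smooth_fun (mfd_dim X) (\<phi> ` U) (\<lambda>x. G (U, \<phi>) (inv_into U \<phi> x) v w)) \<and>
    metric_preserving X G X G (\<lambda>p. p)"
  unfolding hermitian_metric_def assms by (simp only: ball_simps prod.case simp_thms conj_assoc)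

lemma hermitian_limit_metric:
  assumes h: "compatible_invariant_metrics h"
  shows "hermitian_metric siegel_limit (limit_metric h)"
proof -
  have herm: "hermitian_metric (siegel_mfd g) (h g)" if "1 \<le> g" for g
    using h that unfolding compatible_invariant_metrics_def invariant_hermitian_metric_def by blast
  let ?c = "\<lambda>g. (siegel_level g, siegel_coord)"
  have lin: "\<And>p u v w a b. p \<in> siegel_level g \<Longrightarrow> u \<in> cseq (triangle g) \<Longrightarrow> v \<in> cseq (triangle g) \<Longrightarrow>
      w \<in> cseq (triangle g) \<Longrightarrow>
      h g (?c g) p (\<lambda>k. a * u k + b * v k) w = a * h g (?c g) p u w + b * h g (?c g) p v w"
    and cnj: "\<And>p v w. p \<in> siegel_level g \<Longrightarrow> v \<in> cseq (triangle g) \<Longrightarrow> w \<in> cseq (triangle g) \<Longrightarrow>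
      h g (?c g) p w v = cnj (h g (?c g) p v w)"
    and pos: "\<And>p v. p \<in> siegel_level g \<Longrightarrow> v \<in> cseq (triangle g) \<Longrightarrow> v \<noteq> (\<lambda>k. 0) \<Longrightarrow>
      0 < Re (h g (?c g) p v v)"
    and smooth: "\<And>v w. v \<in> cseq (triangle g) \<Longrightarrow> w \<in> cseq (triangle g) \<Longrightarrow>
      smooth_fun (enat (triangle g)) (siegel_dom g)
        (\<lambda>x. h g (?c g) (inv_into (siegel_level g) siegel_coord x) v w)"
    and ident: "metric_preserving (siegel_mfd g) (h g) (siegel_mfd g) (h g) (\<lambda>p. p)"
    if "1 \<le> g" for g
  proof -
    note H = herm[OF that, unfolded hermitian_metric_iff_single_chart[OF siegel_mfd_simps(3)]
        siegel_mfd_simps model_enat]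
    show "\<And>p u v w a b. p \<in> siegel_level g \<Longrightarrow> u \<in> cseq (triangle g) \<Longrightarrow> v \<in> cseq (triangle g) \<Longrightarrow>
        w \<in> cseq (triangle g) \<Longrightarrow>
        h g (?c g) p (\<lambda>k. a * u k + b * v k) w = a * h g (?c g) p u w + b * h g (?c g) p v w"
      by (rule conjunct1[OF H, rule_format])
    show "\<And>p v w. p \<in> siegel_level g \<Longrightarrow> v \<in> cseq (triangle g) \<Longrightarrow> w \<in> cseq (triangle g) \<Longrightarrow>
        h g (?c g) p w v = cnj (h g (?c g) p v w)"
      by (rule H[THEN conjunct2, THEN conjunct1, rule_format])
    show "\<And>p v. p \<in> siegel_level g \<Longrightarrow> v \<in> cseq (triangle g) \<Longrightarrow> v \<noteq> (\<lambda>k. 0) \<Longrightarrow>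
        0 < Re (h g (?c g) p v v)"
      by (rule H[THEN conjunct2, THEN conjunct2, THEN conjunct1, rule_format])
    show "\<And>v w. v \<in> cseq (triangle g) \<Longrightarrow> w \<in> cseq (triangle g) \<Longrightarrow>
        smooth_fun (enat (triangle g)) (siegel_dom g)
          (\<lambda>x. h g (?c g) (inv_into (siegel_level g) siegel_coord x) v w)"
      unfolding siegel_dom_def
      by (rule H[THEN conjunct2, THEN conjunct2, THEN conjunct2, THEN conjunct1, rule_format])
    show "metric_preserving (siegel_mfd g) (h g) (siegel_mfd g) (h g) (\<lambda>p. p)"
      by (rule H[THEN conjunct2, THEN conjunct2, THEN conjunct2, THEN conjunct2])
  qed
  show ?thesis
    unfolding hermitian_metric_iff_single_chart[OF siegel_limit_simps(3)] siegel_limit_simps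
  proof (intro conjI ballI allI impI)
    fix p u v w :: "_ \<Rightarrow> _" and a b
    assume *: "p \<in> siegel_union" "u \<in> model \<infinity>" "v \<in> model \<infinity>" "w \<in> model \<infinity>"
    obtain g0 where g0: "\<And>g. g0 \<le> g \<Longrightarrow> u \<in> cseq (triangle g)"
      using model_infinity_triangle[OF *(2)] by blast
    obtain g where g: "1 \<le> g" "g0 \<le> g" "p \<in> siegel_level g" "v \<in> cseq (triangle g)" "w \<in> cseq (triangle g)"
      by (rule common_level[OF *(1,3,4)])
    have c: "(\<lambda>k. a * u k + b * v k) \<in> cseq (triangle g)"
      unfolding cseq_def
    proof (intro CollectI allI impI)
      fix k
      assume "triangle g \<le> k"
      then have "u k = 0" "v k = 0"
        using g0[OF g(2)] g(4) unfolding cseq_def by blast+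
      then show "a * u k + b * v k = 0"
        by simp
    qed
    note eq = limit_metric_eq[OF h g(1,3)]
    show "limit_metric h (siegel_union, siegel_coord) p (\<lambda>k. a * u k + b * v k) w =
        a * limit_metric h (siegel_union, siegel_coord) p u w +
        b * limit_metric h (siegel_union, siegel_coord) p v w"
      unfolding eq[OF c g(5)] eq[OF g0[OF g(2)] g(5)] eq[OF g(4,5)]
      by (rule lin[OF g(1,3) g0[OF g(2)] g(4,5)])
  next
    fix p v w
    assume *: "p \<in> siegel_union" "v \<in> model \<infinity>" "w \<in> model \<infinity>"
    obtain g where g: "1 \<le> g" "0 \<le> g" "p \<in> siegel_level g" "v \<in> cseq (triangle g)" "w \<in> cseq (triangle g)"
      by (rule common_level[OF *])
    show "limit_metric h (siegel_union, siegel_coord) p w v =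
        cnj (limit_metric h (siegel_union, siegel_coord) p v w)"
      unfolding limit_metric_eq[OF h g(1,3) g(5,4)] limit_metric_eq[OF h g(1,3) g(4,5)]
      by (rule cnj[OF g(1,3-5)])
  next
    fix p v
    assume *: "p \<in> siegel_union" "v \<in> model \<infinity>" and v: "v \<noteq> (\<lambda>k. 0)"
    obtain g where g: "1 \<le> g" "0 \<le> g" "p \<in> siegel_level g" "v \<in> cseq (triangle g)" "v \<in> cseq (triangle g)"
      by (rule common_level[OF * *(2)])
    show "0 < Re (limit_metric h (siegel_union, siegel_coord) p v v)"
      unfolding limit_metric_eq[OF h g(1,3-5)] by (rule pos[OF g(1,3,4) v])
  next
    fix v w
    assume v: "v \<in> model \<infinity>" and w: "w \<in> model \<infinity>"
    obtain g1 where g1: "\<And>g. g1 \<le> g \<Longrightarrow> v \<in> cseq (triangle g)"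
      using model_infinity_triangle[OF v] by blast
    obtain g2 where g2: "\<And>g. g2 \<le> g \<Longrightarrow> w \<in> cseq (triangle g)"
      using model_infinity_triangle[OF w] by blast
    show "smooth_fun \<infinity> (siegel_coord ` siegel_union)
        (\<lambda>x. limit_metric h (siegel_union, siegel_coord) (inv_into siegel_union siegel_coord x) v w)"
      unfolding siegel_coord_union
    proof (rule smooth_fun_limit)
      fix g
      \<comment> \<open>For fixed \<open>v\<close> and \<open>w\<close>, the limit metric is
        \<open>h g\<close> on the whole of every large level. \<open>Suc\<close> keeps
        \<open>g\<close> at least 1, where the metrics are given.\<close>
      assume "Suc (max g1 g2) \<le> g"
      then have g: "1 \<le> g" "v \<in> cseq (triangle g)" "w \<in> cseq (triangle g)"
        using g1[of g] g2[of g] by auto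
      show "smooth_fun (enat (triangle g)) (siegel_dom g)
        (\<lambda>x. limit_metric h (siegel_union, siegel_coord) (inv_into siegel_union siegel_coord x) v w)"
      proof (rule smooth_fun_cong[OF smooth[OF g]])
        fix x
        assume x: "x \<in> siegel_dom g"
        then have "uncoord x \<in> siegel_level g"
          by (simp add: siegel_dom_iff)
        from limit_metric_eq[OF h g(1) this g(2,3)]
        show "h g (?c g) (inv_into (siegel_level g) siegel_coord x) v w =
            limit_metric h (siegel_union, siegel_coord) (inv_into siegel_union siegel_coord x) v w"
          by (simp only: inv_into_siegel_coord[OF x] inv_into_siegel_union[OF siegel_udomI[OF x]])
      qed (auto simp: model_enat intro: real_line_in_siegel_dom)
    qed
  next
    show "metric_preserving siegel_limit (limit_metric h) siegel_limit (limit_metric h) (\<lambda>p. p)"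
      by (rule levelwise_metric_preserving[OF h levelwise_ident ident])
  qed
qed


section \<open>Symplectic maps preserve the Siegel space\<close>

text \<open>\<open>Z\<close> is the denominator of the action of the symplectic matrix with blocks
  \<open>0, -1, 1, 0\<close>, so \<open>det_denom\<close> applies.\<close>

lemma det_siegel:
  assumes Z: "Z \<in> siegel g"
  shows "det Z \<noteq> 0"
proof -
  have "symplectic_blocks g (0\<^sub>m g g) (- 1\<^sub>m g) (1\<^sub>m g) (0\<^sub>m g g)"
    unfolding symplectic_blocks_def by (auto intro!: eq_matI simp: transpose_uminus)
  then interpret symplectic_action g "0\<^sub>m g g" "- 1\<^sub>m g" "1\<^sub>m g" "0\<^sub>m g g"
    by unfold_locales
  show ?thesis
    using det_denom[OF Z] Z by (simp add: denom_def siegel_iff)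
qed

text \<open>By \<open>im_act\<close> the value of the new imaginary part at a real vector
  \<open>u\<close> is the Hermitian form of the old one at \<open>w = Q^-1 u\<close>, which is
  positive.\<close>

lemma (in symplectic_action) act_siegel:
  assumes Z: "Z \<in> siegel g"
  shows "act Z \<in> siegel g"
  unfolding siegel_iff
proof (intro conjI)
  have Zc [simp]: "Z \<in> carrier_mat g g" and sym: "transpose_mat Z = Z"
    using Z by (auto simp: siegel_iff)
  note dQ = det_denom[OF Z]
  show ac: "act Z \<in> carrier_mat g g"
    by (rule act_carrier[OF Zc dQ])
  show "transpose_mat (act Z) = act Z"
    by (rule act_transposed(2)[OF Zc sym dQ])
  define Qi where "Qi = mat_inv (denom Z)"
  have Qi [simp]: "Qi \<in> carrier_mat g g" and QQi: "denom Z * Qi = 1\<^sub>m g"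
    unfolding Qi_def using mat_inv[OF denom_carrier[OF Zc] dQ] by auto
  have cQi: "mat_inv (cnj_mat (denom Z)) = cnj_mat Qi"
    unfolding Qi_def by (rule cnj_mat_inv(2)[OF denom_carrier[OF Zc] dQ, symmetric])
  show "pd g (\<lambda>i j. Im (act Z $$ (i, j)))"
    unfolding pd_def
  proof (intro allI impI)
    fix x :: "nat \<Rightarrow> real"
    assume x: "\<exists>i<g. x i \<noteq> 0"
    define u where "u = Matrix.vec g (\<lambda>i. complex_of_real (x i))"
    define w where "w = Qi *\<^sub>v u"
    have uc [simp]: "u \<in> carrier_vec g" and cu: "map_vec cnj u = u"
      by (auto simp: u_def)
    have wc [simp]: "w \<in> carrier_vec g"
      unfolding w_def by (rule mult_mat_vec_carrier[of _ g g]) auto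
    have "denom Z *\<^sub>v w = u"
      unfolding w_def by (subst assoc_mult_mat_vec[symmetric, of _ g g _ g]) (auto simp: QQi)
    moreover have "u \<noteq> 0\<^sub>v g"
      using x by (auto simp: u_def vec_eq_iff)
    moreover have "denom Z *\<^sub>v 0\<^sub>v g = 0\<^sub>v g"
      by (rule eq_vecI) (use carrier_matD[OF denom_carrier[OF Zc]] in auto)
    ultimately have w0: "w \<noteq> 0\<^sub>v g"
      by metis
    have Yw: "im_mat Z *\<^sub>v w \<in> carrier_vec g"
      by (rule mult_mat_vec_carrier[of _ g g]) auto
    have cw: "cnj_mat Qi *\<^sub>v u = map_vec cnj w"
      using cnj_mat_mult_vec[OF Qi uc] by (simp add: cu w_def)
    have "im_mat (act Z) *\<^sub>v u = transpose_mat (cnj_mat Qi) * (im_mat Z * Qi) *\<^sub>v u"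
      by (simp add: im_act[OF Z] cQi Qi_def)
    also have "\<dots> = transpose_mat (cnj_mat Qi) *\<^sub>v (im_mat Z * Qi *\<^sub>v u)"
      by (rule assoc_mult_mat_vec[where ?n\<^sub>1.0 = g and ?n\<^sub>2.0 = g and ?n\<^sub>3.0 = g]) auto
    also have "im_mat Z * Qi *\<^sub>v u = im_mat Z *\<^sub>v w"
      unfolding w_def by (rule assoc_mult_mat_vec[where ?n\<^sub>1.0 = g and ?n\<^sub>2.0 = g and ?n\<^sub>3.0 = g]) auto
    finally have "u \<bullet> (im_mat (act Z) *\<^sub>v u) = u \<bullet> (transpose_mat (cnj_mat Qi) *\<^sub>v (im_mat Z *\<^sub>v w))"
      by simp
    also have "\<dots> = (cnj_mat Qi *\<^sub>v u) \<bullet> (im_mat Z *\<^sub>v w)"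
      by (subst transpose_vec_mult_scalar[of "transpose_mat (cnj_mat Qi)" g g, symmetric])
        (use Yw in auto)
    finally have "Re (u \<bullet> (im_mat (act Z) *\<^sub>v u)) = Re (map_vec cnj w \<bullet> (im_mat Z *\<^sub>v w))"
      by (simp add: cw)
    moreover have "u \<bullet> (im_mat (act Z) *\<^sub>v u) =
        (\<Sum>i<g. \<Sum>j<g. u $ i * im_mat (act Z) $$ (i, j) * u $ j)"
      by (rule scalar_prod_mult_mat_vec) (use ac in auto)
    moreover have "\<dots> = of_real (\<Sum>i<g. \<Sum>j<g. x i * Im (act Z $$ (i, j)) * x j)"
      unfolding of_real_sum
      by (intro sum.cong refl) (use carrier_matD[OF ac] in \<open>auto simp: u_def im_mat_def\<close>)
    ultimately show "0 < (\<Sum>i<g. \<Sum>j<g. x i * Im (act Z $$ (i, j)) * x j)"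
      using im_mat_form_pos[OF Z wc w0] by simp
  qed
qed


section \<open>The geodesic symmetries\<close>

definition re_mat :: "complex mat \<Rightarrow> complex mat" where
  "re_mat Z = map_mat (\<lambda>z. complex_of_real (Re z)) Z"

text \<open>The conjugate of \<open>Z \<mapsto> - Z\<^sup>-\<^sup>1\<close> that fixes \<open>P = X + \<i> Y\<close>: the map
  \<open>Z \<mapsto> X - Y (Z - X)\<^sup>-\<^sup>1 Y\<close>.\<close>

definition siegel_refl :: "complex mat \<Rightarrow> complex mat \<Rightarrow> complex mat" where
  "siegel_refl P Z = re_mat P - im_mat P * (mat_inv (Z - re_mat P) * im_mat P)"

text \<open>With \<open>V = Y^-1\<close> and \<open>W = Z - X\<close>, the denominator of this
  matrix is \<open>V W\<close> and its numerator is \<open>X V W - Y\<close>, so that it acts by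
  \<open>Z \<mapsto> X - Y W^-1 Y\<close>. The block relations reduce to cancelling \<open>Y\<close>
  against \<open>V\<close>.\<close>

lemma siegel_refl_matrix:
  fixes X Y :: "real mat"
  assumes X [simp]: "X \<in> carrier_mat g g" and Y [simp]: "Y \<in> carrier_mat g g"
    and sym: "transpose_mat X = X" "transpose_mat Y = Y" and d: "det Y \<noteq> 0"
  shows "four_block_mat (X * mat_inv Y) (- (X * (mat_inv Y * X)) - Y) (mat_inv Y) (- (mat_inv Y * X))
    \<in> symplectic_group g"
proof -
  define V where "V = mat_inv Y"
  note inv = mat_inv[OF Y d, folded V_def]
  note [simp] = inv(3) mult_carrier_mat[where nr = g and n = g and nc = g]
    assoc_mult_mat[where ?n\<^sub>1.0 = g and ?n\<^sub>2.0 = g and ?n\<^sub>3.0 = g and ?n\<^sub>4.0 = g]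
    minus_carrier_mat[where nr = g and nc = g]
    right_mult_one_mat[where nr = g and nc = g] left_mult_one_mat[where nr = g and nc = g]
  have tV: "transpose_mat V = V"
    unfolding V_def using transpose_mat_inv[OF Y d] sym by simp
  have tmult: "transpose_mat (P * Q) = transpose_mat Q * transpose_mat P"
    if "P \<in> carrier_mat g g" "Q \<in> carrier_mat g g" for P Q :: "real mat"
    using that by (rule transpose_mult)
  define T where "T = X * (V * X)"
  have Tc [simp]: "T \<in> carrier_mat g g" and tT: "transpose_mat T = T"
    by (simp_all add: T_def tmult sym tV)
  have neg1: "- P * R = - (P * R)" "R * - P = - (R * P)"
    if "P \<in> carrier_mat g g" "R \<in> carrier_mat g g" for P R :: "real mat"
    using that by (auto intro: uminus_mult_left_mat uminus_mult_right_mat)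
  have neg2: "(- P - Q) * R = - (P * R) - Q * R" "R * (- P - Q) = - (R * P) - R * Q"
    if "P \<in> carrier_mat g g" "Q \<in> carrier_mat g g" "R \<in> carrier_mat g g" for P Q R :: "real mat"
    using that minus_mult_distrib_mat[of "- P" g g Q R g] mult_minus_distrib_mat[of R g g "- P" g Q]
    by (simp_all add: neg1)
  note neg = neg1 neg2
  have arith: "P - P = 0\<^sub>m g g" "- P - (- P - Q) = Q" "- P - Q - - P = - Q"
    "- (- P) - - Q - (- (- P) - - Q) = 0\<^sub>m g g"
    if "P \<in> carrier_mat g g" "Q \<in> carrier_mat g g" for P Q :: "real mat"
    using that by (auto intro!: eq_matI)
  have tD: "transpose_mat (- (V * X)) = - (X * V)"
    by (simp add: transpose_uminus tmult sym tV)
  have tB: "transpose_mat (- T - Y) = - T - Y"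
    using transpose_minus[of "- T" g g Y] by (simp add: transpose_uminus tT sym)
  have tA: "transpose_mat (X * V) = V * X"
    by (simp add: tmult sym tV)
  have VT: "V * T = V * (X * (V * X))" "T * V = X * (V * (X * V))"
    by (simp_all add: T_def)
  have e1: "transpose_mat (X * V) * V - transpose_mat V * (X * V) = 0\<^sub>m g g"
    unfolding tA tV by (simp add: arith)
  have e2: "transpose_mat (X * V) * - (V * X) - transpose_mat V * (- T - Y) = 1\<^sub>m g"
    unfolding tA tV by (simp add: neg VT inv arith)
  have e3: "transpose_mat (- T - Y) * V - transpose_mat (- (V * X)) * (X * V) = - 1\<^sub>m g"
    unfolding tB tD by (simp add: neg VT inv arith)
  have e4: "transpose_mat (- T - Y) * - (V * X) - transpose_mat (- (V * X)) * (- T - Y) = 0\<^sub>m g g"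
  proof -
    have "Y * (V * X) = X"
      by (rule mat_cancel_left[OF inv(1)]) auto
    moreover have "X * (V * Y) = X"
      by (simp add: inv)
    moreover have "X * (V * T) = T * (V * X)"
      by (simp add: T_def)
    moreover have "A - - X = - (- A - X)" if "A \<in> carrier_mat g g" for A
      by (rule eq_matI) (use that carrier_matD[OF X] in auto)
    ultimately have "(- T - Y) * - (V * X) = - (- (T * (V * X)) - X)"
        "- (X * V) * (- T - Y) = - (- (T * (V * X)) - X)"
      by (simp_all add: neg)
    then show ?thesis
      unfolding tB tD by (simp add: arith)
  qed
  have "four_block_mat (X * V) (- T - Y) V (- (V * X)) \<in> symplectic_group g"
    unfolding symplectic_group_def symplectic_form_def
  proof (intro CollectI conjI)
    show "four_block_mat (X * V) (- T - Y) V (- (V * X)) \<in> carrier_mat (2 * g) (2 * g)"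
      using four_block_carrier_mat[of "X * V" g g "- (V * X)" g g] by (simp add: mult_2)
    show "transpose_mat (four_block_mat (X * V) (- T - Y) V (- (V * X))) *
        four_block_mat (0\<^sub>m g g) (1\<^sub>m g) (- 1\<^sub>m g) (0\<^sub>m g g) *
        four_block_mat (X * V) (- T - Y) V (- (V * X)) =
        four_block_mat (0\<^sub>m g g) (1\<^sub>m g) (- 1\<^sub>m g) (0\<^sub>m g g)"
      by (subst symplectic_form_product) (simp_all add: e1 e2 e3 e4)
  qed
  then show ?thesis
    by (simp add: T_def V_def)
qed

lemma symplectic_act_four_block:
  assumes "A \<in> carrier_mat g g" "B \<in> carrier_mat g g" "C \<in> carrier_mat g g" "D \<in> carrier_mat g g"
  shows "symplectic_act g (four_block_mat A B C D) Z =
    (map_mat complex_of_real A * Z + map_mat complex_of_real B) *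
      mat_inv (map_mat complex_of_real C * Z + map_mat complex_of_real D)"
proof -
  have "split_block (map_mat complex_of_real (four_block_mat A B C D)) g g =
      (map_mat complex_of_real A, map_mat complex_of_real B,
       map_mat complex_of_real C, map_mat complex_of_real D)"
    using assms by (auto simp: split_block_def Let_def intro!: eq_matI)
  then show ?thesis
    by (simp add: symplectic_act_def mat_inv_def)
qed

locale siegel_center =
  fixes g :: nat and P :: "complex mat"
  assumes P: "P \<in> siegel g"
begin

definition X where "X = re_mat P"
definition Y where "Y = im_mat P"
definition V where "V = mat_inv Y"

lemma P_carrier [simp]: "P \<in> carrier_mat g g"
  using P by (simp add: siegel_iff)

lemma X_carrier [simp]: "X \<in> carrier_mat g g" and Y_carrier [simp]: "Y \<in> carrier_mat g g"
  by (simp_all add: X_def Y_def re_mat_def)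

lemma V: "Y * V = 1\<^sub>m g" "V * Y = 1\<^sub>m g" "V \<in> carrier_mat g g"
  using mat_inv[OF Y_carrier] det_im_mat[OF P] by (auto simp: V_def Y_def)

lemmas center_simps [simp] = V(3)
  assoc_mult_mat[where ?n\<^sub>1.0 = g and ?n\<^sub>2.0 = g and ?n\<^sub>3.0 = g and ?n\<^sub>4.0 = g]
  mult_carrier_mat[where nr = g and n = g and nc = g] minus_carrier_mat[where nr = g and nc = g]
  right_mult_one_mat[where nr = g and nc = g] left_mult_one_mat[where nr = g and nc = g]

lemma P_eq: "P = X + \<i> \<cdot>\<^sub>m Y"
  by (rule eq_matI) (auto simp: X_def Y_def re_mat_def im_mat_def complex_eq_iff)

lemma transpose_X: "transpose_mat X = X"
proof -
  have "transpose_mat X = re_mat (transpose_mat P)"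
    unfolding X_def re_mat_def by (rule map_mat_transpose)
  then show ?thesis
    using P by (simp add: siegel_iff X_def)
qed

text \<open>Translation by a real symmetric matrix leaves the imaginary part alone. It follows that
  \<open>Z - X\<close> is invertible, by \<open>det_siegel\<close>.\<close>

lemma diff_siegel:
  assumes Z: "Z \<in> siegel g"
  shows "Z - X \<in> siegel g"
  unfolding siegel_iff
proof (intro conjI)
  have Z': "Z \<in> carrier_mat g g" "transpose_mat Z = Z" "pd g (\<lambda>i j. Im (Z $$ (i, j)))"
    using Z by (auto simp: siegel_iff)
  show "Z - X \<in> carrier_mat g g"
    by simp
  show "transpose_mat (Z - X) = Z - X"
    using transpose_minus[OF Z'(1) X_carrier] Z'(2) transpose_X by simp
  have "Im ((Z - X) $$ (i, j)) = Im (Z $$ (i, j))" if "i < g" "j < g" for i j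
    using that carrier_matD[OF X_carrier] carrier_matD[OF P_carrier] by (simp add: X_def re_mat_def)
  then have "pd g (\<lambda>i j. Im ((Z - X) $$ (i, j))) \<longleftrightarrow> pd g (\<lambda>i j. Im (Z $$ (i, j)))"
    by (rule pd_cong)
  with Z'(3) show "pd g (\<lambda>i j. Im ((Z - X) $$ (i, j)))"
    by simp
qed

lemma diff_inv:
  assumes Z: "Z \<in> siegel g"
  defines "W \<equiv> Z - X"
  shows "W * mat_inv W = 1\<^sub>m g" "mat_inv W * W = 1\<^sub>m g" "mat_inv W \<in> carrier_mat g g"
  using mat_inv[OF _ det_siegel[OF diff_siegel[OF Z]], of g] by (auto simp: W_def)

lemma siegel_refl_eq: "siegel_refl P Z = X - Y * (mat_inv (Z - X) * Y)"
  by (simp add: siegel_refl_def X_def Y_def)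

lemma siegel_refl_symplectic:
  obtains M where "M \<in> symplectic_group g" "\<And>Z. Z \<in> siegel g \<Longrightarrow> symplectic_act g M Z = siegel_refl P Z"
proof -
  let ?c = "map_mat complex_of_real"
  let ?X = "map_mat Re P" and ?Y = "map_mat Im P"
  have c: "?X \<in> carrier_mat g g" "?Y \<in> carrier_mat g g"
    by simp_all
  \<comment> \<open>The symplectic matrix is built from real matrices, the formula of the symmetry
    from complex ones; the entrywise embedding \<open>?c\<close> carries one to the other.\<close>
  have cX: "?c ?X = X" and cY: "?c ?Y = Y"
    by (auto intro!: eq_matI simp: X_def re_mat_def Y_def im_mat_def)
  have cmult: "?c (A * B) = ?c A * ?c B" if "A \<in> carrier_mat g g" "B \<in> carrier_mat g g" for A B
    by (rule eq_matI) (use that in \<open>auto simp: scalar_prod_def\<close>)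
  have cminus: "?c (- A - B) = - ?c A - ?c B" if "A \<in> carrier_mat g g" "B \<in> carrier_mat g g" for A B
    by (rule eq_matI) (use that in auto)
  have cneg: "?c (- A) = - ?c A" for A
    by (rule eq_matI) auto
  have d: "det ?Y \<noteq> 0"
  proof -
    have "det (?c ?Y) \<noteq> 0"
      unfolding cY using det_im_mat[OF P] by (simp add: Y_def)
    then show ?thesis
      by (metis of_real_0 of_real_hom.hom_det)
  qed
  note i = mat_inv[OF c(2) d]
  have cV: "?c (mat_inv ?Y) = V"
  proof -
    have "Y * ?c (mat_inv ?Y) = ?c (?Y * mat_inv ?Y)"
      using cmult[OF c(2) i(3)] by (simp add: cY)
    also have "\<dots> = 1\<^sub>m g"
      unfolding i(1) by (rule eq_matI) auto
    finally show ?thesis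
      unfolding V_def using i(3) by (intro mat_inv_unique(2)[symmetric, of _ g]) auto
  qed
  have sym: "transpose_mat ?X = ?X" "transpose_mat ?Y = ?Y"
    using P by (metis map_mat_transpose siegel_iff)+
  let ?M = "four_block_mat (?X * mat_inv ?Y) (- (?X * (mat_inv ?Y * ?X)) - ?Y) (mat_inv ?Y) (- (mat_inv ?Y * ?X))"
  have "symplectic_act g ?M Z = siegel_refl P Z" if Z: "Z \<in> siegel g" for Z
  proof -
    have Zc [simp]: "Z \<in> carrier_mat g g"
      using Z by (simp add: siegel_iff)
    define W Wi where "W = Z - X" and "Wi = mat_inv W"
    have W [simp]: "W \<in> carrier_mat g g" "Wi \<in> carrier_mat g g" and WWi: "W * Wi = 1\<^sub>m g"
      using diff_inv[OF Z] by (auto simp: W_def Wi_def)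
    have mW: "A * W = A * Z - A * X" if "A \<in> carrier_mat g g" for A
      unfolding W_def using that by (intro mult_minus_distrib_mat[where nr = g and n = g and nc = g]) auto
    have num: "X * V * Z + (- (X * (V * X)) - Y) = X * (V * W) - Y"
    proof -
      have "A + (- B - Y) = (A - B) - Y" if "A \<in> carrier_mat g g" "B \<in> carrier_mat g g" for A B
        by (rule eq_matI) (use that carrier_matD[OF Y_carrier] in auto)
      then show ?thesis
        using mW[of "X * V"] by simp
    qed
    have den: "V * Z + - (V * X) = V * W"
      using mW[of V] add_uminus_minus_mat[of "V * Z" g g "V * X"] by simp
    have "V * W * (Wi * Y) = 1\<^sub>m g"
      by (simp add: mat_cancel_left[OF WWi] V)
    then have deninv: "mat_inv (V * W) = Wi * Y"
      by (intro mat_inv_unique[of _ g]) auto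
    have "symplectic_act g ?M Z =
        (X * V * Z + (- (X * (V * X)) - Y)) * mat_inv (V * Z + - (V * X))"
      using i(3) c
      by (subst symplectic_act_four_block) (simp_all add: cmult cminus cneg cV cX cY)
    also have "\<dots> = (X * (V * W) - Y) * (Wi * Y)"
      unfolding num den deninv ..
    also have "\<dots> = X * (V * W) * (Wi * Y) - Y * (Wi * Y)"
      by (rule minus_mult_distrib_mat[where nr = g and n = g and nc = g]) auto
    also have "X * (V * W) * (Wi * Y) = X"
      by (simp add: mat_cancel_left[OF WWi] V)
    finally show ?thesis
      by (simp add: siegel_refl_eq Wi_def W_def)
  qed
  then show ?thesis
    using that[OF siegel_refl_matrix[OF c sym d]] by blast
qed

lemma siegel_refl_siegel:
  assumes Z: "Z \<in> siegel g"
  shows "siegel_refl P Z \<in> siegel g"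
proof -
  obtain M where M: "M \<in> symplectic_group g" "symplectic_act g M Z = siegel_refl P Z"
    using siegel_refl_symplectic Z by blast
  obtain A B C D where "symplectic_blocks g A B C D"
    and act: "\<And>Z. symplectic_act g M Z = (A * Z + B) * mat_inv (C * Z + D)"
    using symplectic_group_blocks[OF M(1)] by blast
  then interpret symplectic_action g A B C D
    by unfold_locales
  show ?thesis
    using act_siegel[OF Z] M(2) act by (simp add: act_def numer_def denom_def)
qed

text \<open>The first application turns \<open>W = Z - X\<close> into \<open>- Y W^-1 Y\<close>,
  whose inverse is \<open>- V W V\<close>; inserting this returns \<open>W\<close>.\<close>

lemma siegel_refl_involutive:
  assumes Z: "Z \<in> siegel g"
  shows "siegel_refl P (siegel_refl P Z) = Z"
proof -
  have Zc [simp]: "Z \<in> carrier_mat g g"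
    using Z by (simp add: siegel_iff)
  define W Wi where "W = Z - X" and "Wi = mat_inv W"
  have W [simp]: "W \<in> carrier_mat g g" "Wi \<in> carrier_mat g g"
    and WWi: "W * Wi = 1\<^sub>m g" "Wi * W = 1\<^sub>m g"
    using diff_inv[OF Z] by (auto simp: W_def Wi_def)
  have e: "siegel_refl P Z - X = - (Y * (Wi * Y))"
    unfolding siegel_refl_eq W_def[symmetric] Wi_def[symmetric]
    by (rule eq_matI) (use carrier_matD[OF X_carrier] carrier_matD[OF Y_carrier] in auto)
  have neg: "- A * - B = A * B" if "A \<in> carrier_mat g g" "B \<in> carrier_mat g g" for A B :: "complex mat"
    using that by (auto simp: uminus_mult_left_mat uminus_mult_right_mat)
  have "- (Y * (Wi * Y)) * - (V * (W * V)) = 1\<^sub>m g"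
    by (subst neg) (simp_all add: mat_cancel_left[OF V(1)] mat_cancel_left[OF WWi(2)]
        mat_cancel_left[OF V(2)] V)
  then have inv: "mat_inv (siegel_refl P Z - X) = - (V * (W * V))"
    unfolding e by (intro mat_inv_unique[of _ g]) auto
  have "Y * (- (V * (W * V)) * Y) = - W"
  proof -
    have "- (V * (W * V)) * Y = - (V * (W * V) * Y)"
      by (rule uminus_mult_left_mat) (use carrier_matD[OF V(3)] carrier_matD[OF Y_carrier] in auto)
    also have "V * (W * V) * Y = V * W"
      by (simp add: V)
    finally have "Y * (- (V * (W * V)) * Y) = Y * - (V * W)"
      by simp
    also have "\<dots> = - (Y * (V * W))"
      by (rule uminus_mult_right_mat) (use carrier_matD[OF V(3)] carrier_matD[OF Y_carrier] in auto)
    also have "Y * (V * W) = W"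
      by (simp add: mat_cancel_left[OF V(1)])
    finally show ?thesis .
  qed
  then have "siegel_refl P (siegel_refl P Z) = X - - W"
    using inv siegel_refl_eq[of "siegel_refl P Z"] by simp
  also have "\<dots> = Z"
    by (rule eq_matI) (use carrier_matD[OF X_carrier] carrier_matD[OF Zc] in \<open>auto simp: W_def\<close>)
  finally show ?thesis .
qed

text \<open>At the centre \<open>Z - X\<close> is \<open>\<i> Y\<close>, with inverse
  \<open>- \<i> V\<close>.\<close>

lemma siegel_refl_center: "siegel_refl P P = P"
proof -
  have W: "P - X = \<i> \<cdot>\<^sub>m Y"
    by (subst P_eq) (rule eq_matI, use carrier_matD[OF X_carrier] carrier_matD[OF Y_carrier] in auto)
  have "(\<i> \<cdot>\<^sub>m Y) * ((- \<i>) \<cdot>\<^sub>m V) = 1\<^sub>m g"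
    by (simp add: mult_smult_assoc_mat[of _ g g _ g] mult_smult_distrib[of _ g g _ g] V)
      (rule eq_matI, auto)
  then have "mat_inv (P - X) = (- \<i>) \<cdot>\<^sub>m V"
    unfolding W by (intro mat_inv_unique[of _ g]) auto
  then have "siegel_refl P P = X - (- \<i>) \<cdot>\<^sub>m Y"
    by (simp add: siegel_refl_eq mult_smult_assoc_mat[of _ g g _ g] mult_smult_distrib[of _ g g _ g] V)
  also have "\<dots> = X + \<i> \<cdot>\<^sub>m Y"
    by (rule eq_matI) (use carrier_matD[OF X_carrier] carrier_matD[OF Y_carrier] in auto)
  finally show ?thesis
    using P_eq by simp
qed

text \<open>A fixed point satisfies \<open>N\<^sup>2 = - 1\<close> for \<open>N = Y\<^sup>-\<^sup>1 W\<close>, \<open>W = Z - X\<close>, so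
  \<open>(W + \<i> Y) (N - \<i>) = 0\<close>; the first factor lies in the Siegel space and is invertible.\<close>

lemma siegel_refl_fixed_point:
  assumes Z: "Z \<in> siegel g" and fixed: "siegel_refl P Z = Z"
  shows "Z = P"
proof -
  have Zc [simp]: "Z \<in> carrier_mat g g"
    using Z by (simp add: siegel_iff)
  define W Wi where "W = Z - X" and "Wi = mat_inv W"
  have W [simp]: "W \<in> carrier_mat g g" "Wi \<in> carrier_mat g g"
    and WWi: "W * Wi = 1\<^sub>m g" "Wi * W = 1\<^sub>m g"
    using diff_inv[OF Z] by (auto simp: W_def Wi_def)
  have WS: "W \<in> siegel g"
    unfolding W_def by (rule diff_siegel[OF Z])
  have W_fixed: "W = - (Y * (Wi * Y))"
  proof -
    have "W = (X - Y * (Wi * Y)) - X"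
      using fixed by (simp add: siegel_refl_eq W_def Wi_def)
    also have "\<dots> = - (Y * (Wi * Y))"
      by (rule eq_matI) (use carrier_matD[OF X_carrier] carrier_matD[OF Y_carrier] in auto)
    finally show ?thesis .
  qed
  have WVW: "W * (V * W) = - Y"
  proof -
    have "W * (V * W) = W * (V * - (Y * (Wi * Y)))"
      by (subst (2) W_fixed) (rule refl)
    also have "V * - (Y * (Wi * Y)) = - (V * (Y * (Wi * Y)))"
      by (rule uminus_mult_right_mat) (use carrier_matD[OF V(3)] carrier_matD[OF Y_carrier] in auto)
    also have "V * (Y * (Wi * Y)) = Wi * Y"
      by (rule mat_cancel_left[OF V(2)]) auto
    also have "W * - (Wi * Y) = - (W * (Wi * Y))"
      by (rule uminus_mult_right_mat) (use carrier_matD[OF W(1)] carrier_matD[OF W(2)] in auto)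
    also have "W * (Wi * Y) = Y"
      by (rule mat_cancel_left[OF WWi(1)]) auto
    finally show ?thesis .
  qed
  define S where "S = W + \<i> \<cdot>\<^sub>m Y"
  have Sc [simp]: "S \<in> carrier_mat g g"
    by (simp add: S_def)
  \<comment> \<open>The imaginary part of \<open>S\<close> is a sum of two positive definite
    ones.\<close>
  have "S \<in> siegel g"
    unfolding siegel_iff
  proof (intro conjI Sc)
    have "transpose_mat Y = im_mat (transpose_mat P)"
      unfolding Y_def im_mat_def by (rule map_mat_transpose)
    then have tY: "transpose_mat Y = Y"
      using P by (simp add: siegel_iff Y_def)
    have sym: "W $$ (j, i) = W $$ (i, j)" "Y $$ (j, i) = Y $$ (i, j)" if "i < g" "j < g" for i j
      using WS tY that W(1) Y_carrier unfolding siegel_iff by (metis carrier_matD index_transpose_mat(1))+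
    show "transpose_mat S = S"
      by (rule eq_matI)
        (use sym carrier_matD[OF W(1)] carrier_matD[OF Y_carrier] in \<open>auto simp: S_def\<close>)
    have p1: "pd g (\<lambda>i j. Im (W $$ (i, j)))" and p2: "pd g (\<lambda>i j. Im (P $$ (i, j)))"
      using WS P by (auto simp: siegel_iff)
    have "Im (S $$ (i, j)) = Im (W $$ (i, j)) + Im (P $$ (i, j))" if "i < g" "j < g" for i j
      using that carrier_matD[OF W(1)] carrier_matD[OF Y_carrier] carrier_matD[OF P_carrier]
      by (simp add: S_def Y_def im_mat_def)
    then have "pd g (\<lambda>i j. Im (S $$ (i, j))) \<longleftrightarrow> pd g (\<lambda>i j. Im (W $$ (i, j)) + Im (P $$ (i, j)))"
      by (rule pd_cong)
    moreover have "pd g (\<lambda>i j. Im (W $$ (i, j)) + Im (P $$ (i, j)))"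
      using p1 p2 unfolding pd_def by (simp add: algebra_simps sum.distrib add_pos_pos)
    ultimately show "pd g (\<lambda>i j. Im (S $$ (i, j)))"
      by simp
  qed
  from det_siegel[OF this] have dS: "det S \<noteq> 0" .
  note Si = mat_inv[OF Sc dS]
  define R where "R = V * W - \<i> \<cdot>\<^sub>m 1\<^sub>m g"
  have Rc [simp]: "R \<in> carrier_mat g g"
    by (simp add: R_def)
  have SVW: "S * (V * W) = - Y + \<i> \<cdot>\<^sub>m W"
  proof -
    have "S * (V * W) = W * (V * W) + (\<i> \<cdot>\<^sub>m Y) * (V * W)"
      unfolding S_def by (rule add_mult_distrib_mat[where nr = g and n = g and nc = g]) auto
    also have "(\<i> \<cdot>\<^sub>m Y) * (V * W) = \<i> \<cdot>\<^sub>m (Y * (V * W))"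
      by (rule mult_smult_assoc_mat[of _ g g _ g]) auto
    also have "Y * (V * W) = W"
      by (rule mat_cancel_left[OF V(1)]) auto
    finally show ?thesis
      by (simp add: WVW)
  qed
  have "S * R = S * (V * W) - S * (\<i> \<cdot>\<^sub>m 1\<^sub>m g)"
    unfolding R_def by (rule mult_minus_distrib_mat[where nr = g and n = g and nc = g]) auto
  also have "S * (\<i> \<cdot>\<^sub>m 1\<^sub>m g) = \<i> \<cdot>\<^sub>m S"
    using mult_smult_distrib[OF Sc one_carrier_mat, of \<i>] by simp
  also have "S * (V * W) - \<i> \<cdot>\<^sub>m S = 0\<^sub>m g g"
    unfolding SVW unfolding S_def
    by (rule eq_matI) (use carrier_matD[OF W(1)] carrier_matD[OF Y_carrier] in \<open>auto simp: algebra_simps\<close>)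
  finally have SR: "S * R = 0\<^sub>m g g" .
  have "R = mat_inv S * (S * R)"
    by (rule mat_cancel_left[OF Si(2), symmetric]) (use Si in auto)
  also have "\<dots> = 0\<^sub>m g g"
    unfolding SR by (rule right_mult_zero_mat[OF Si(3)])
  finally have R0: "R = 0\<^sub>m g g" .
  have "V * W = R + \<i> \<cdot>\<^sub>m 1\<^sub>m g"
    unfolding R_def by (rule eq_matI) (use carrier_matD[OF V(3)] carrier_matD[OF W(1)] in auto)
  also have "\<dots> = \<i> \<cdot>\<^sub>m 1\<^sub>m g"
    unfolding R0 by (rule eq_matI) auto
  finally have VW: "V * W = \<i> \<cdot>\<^sub>m 1\<^sub>m g" .
  have "W = Y * (V * W)"
    by (rule mat_cancel_left[OF V(1), symmetric]) auto
  also have "\<dots> = \<i> \<cdot>\<^sub>m Y"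
    unfolding VW using mult_smult_distrib[OF Y_carrier one_carrier_mat, of \<i>] by simp
  finally have W_eq: "W = \<i> \<cdot>\<^sub>m Y" .
  have "Z = X + W"
    unfolding W_def by (rule eq_matI) (use carrier_matD[OF X_carrier] carrier_matD[OF Zc] in auto)
  then show ?thesis
    using P_eq W_eq by simp
qed

end


section \<open>The symmetries of the limit\<close>

text \<open>The corner is arbitrary because the formula of the symmetry combines matrices with
  corners 0, 1 and \<open>\<i>\<close>; the corner \<open>\<i>\<close> gives
  \<open>siegel_embed\<close>.\<close>

definition diag_block :: "nat \<Rightarrow> complex mat \<Rightarrow> complex \<Rightarrow> complex mat" where
  "diag_block g A a = four_block_mat A (0\<^sub>m g 1) (0\<^sub>m 1 g) (a \<cdot>\<^sub>m 1\<^sub>m 1)"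

lemma diag_block_carrier:
  assumes "A \<in> carrier_mat g g"
  shows "diag_block g A a \<in> carrier_mat (Suc g) (Suc g)"
  using four_block_carrier_mat[OF assms, of "a \<cdot>\<^sub>m 1\<^sub>m 1" 1 1] by (simp add: diag_block_def)

lemma diag_block_mult:
  assumes "A \<in> carrier_mat g g" "B \<in> carrier_mat g g"
  shows "diag_block g A a * diag_block g B b = diag_block g (A * B) (a * b)"
proof -
  have AB: "A * B \<in> carrier_mat g g"
    using assms by simp
  have "diag_block g A a * diag_block g B b =
    four_block_mat (A * B + 0\<^sub>m g 1 * 0\<^sub>m 1 g) (A * 0\<^sub>m g 1 + 0\<^sub>m g 1 * (b \<cdot>\<^sub>m 1\<^sub>m 1))
      (0\<^sub>m 1 g * B + (a \<cdot>\<^sub>m 1\<^sub>m 1) * 0\<^sub>m 1 g) (0\<^sub>m 1 g * 0\<^sub>m g 1 + (a \<cdot>\<^sub>m 1\<^sub>m 1) * (b \<cdot>\<^sub>m 1\<^sub>m 1))"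
    unfolding diag_block_def by (rule mult_four_block_mat) (use assms in auto)
  also have "A * B + 0\<^sub>m g 1 * 0\<^sub>m 1 g = A * B"
    by (rule eq_matI) (use carrier_matD[OF AB] in \<open>auto simp: scalar_prod_def\<close>)
  also have "A * 0\<^sub>m g 1 + 0\<^sub>m g 1 * (b \<cdot>\<^sub>m 1\<^sub>m 1) = 0\<^sub>m g 1"
    by (rule eq_matI) (use assms in \<open>auto simp: scalar_prod_def\<close>)
  also have "0\<^sub>m 1 g * B + (a \<cdot>\<^sub>m 1\<^sub>m 1) * 0\<^sub>m 1 g = 0\<^sub>m 1 g"
    by (rule eq_matI) (use assms in \<open>auto simp: scalar_prod_def\<close>)
  also have "0\<^sub>m 1 g * 0\<^sub>m g 1 + (a \<cdot>\<^sub>m 1\<^sub>m 1) * (b \<cdot>\<^sub>m 1\<^sub>m 1) = (a * b) \<cdot>\<^sub>m 1\<^sub>m 1"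
    by (rule eq_matI) (auto simp: scalar_prod_def)
  finally show ?thesis
    by (simp add: diag_block_def)
qed

lemma diag_block_minus:
  assumes "A \<in> carrier_mat g g" "B \<in> carrier_mat g g"
  shows "diag_block g A a - diag_block g B b = diag_block g (A - B) (a - b)"
  unfolding diag_block_def by (rule eq_matI) (use assms in auto)

lemma mat_inv_diag_block:
  assumes A: "A \<in> carrier_mat g g" "det A \<noteq> 0" and a: "a \<noteq> 0"
  shows "mat_inv (diag_block g A a) = diag_block g (mat_inv A) (1 / a)"
proof (rule mat_inv_unique(2)[of _ "Suc g"])
  have "diag_block g A a * diag_block g (mat_inv A) (1 / a) = diag_block g (1\<^sub>m g) 1"
    using diag_block_mult[OF A(1) mat_inv(3)[OF A]] mat_inv(1)[OF A] a by simp
  also have "\<dots> = 1\<^sub>m (Suc g)"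
    unfolding diag_block_def by (rule eq_matI) auto
  finally show "diag_block g A a * diag_block g (mat_inv A) (1 / a) = 1\<^sub>m (Suc g)" .
qed (use diag_block_carrier A mat_inv(3)[OF A] in auto)

lemma siegel_block_Suc:
  assumes p: "p \<in> siegel_level g"
  shows "siegel_block (Suc g) p = diag_block g (siegel_block g p) \<i>"
proof (rule eq_matI)
  fix i j
  assume "i < dim_row (diag_block g (siegel_block g p) \<i>)" "j < dim_col (diag_block g (siegel_block g p) \<i>)"
  then have ij: "i < Suc g" "j < Suc g"
    using carrier_matD[OF diag_block_carrier[OF siegel_block_carrier]] by auto
  have "p i j = (if i = j then \<i> else 0)" if "g \<le> i \<or> g \<le> j"
    by (rule siegel_level_outside[OF p that])
  with ij show "siegel_block (Suc g) p $$ (i, j) = diag_block g (siegel_block g p) \<i> $$ (i, j)"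
    using carrier_matD[OF siegel_block_carrier[of g p]] by (auto simp: diag_block_def)
qed (use carrier_matD[OF diag_block_carrier[OF siegel_block_carrier]] in \<open>auto simp: siegel_block_def\<close>)

text \<open>All ingredients are block diagonal, so only the corner needs a look:
  \<open>0 - 1 / \<i> = \<i>\<close>, the corner prescribed by the embedding.\<close>

lemma siegel_refl_Suc:
  assumes p: "p \<in> siegel_level g" and q: "q \<in> siegel_level g"
  shows "pad (siegel_refl (siegel_block (Suc g) p) (siegel_block (Suc g) q)) =
    pad (siegel_refl (siegel_block g p) (siegel_block g q))"
proof -
  let ?P = "siegel_block g p" and ?Z = "siegel_block g q"
  have P: "?P \<in> siegel g" and Z: "?Z \<in> siegel g"
    by (rule siegel_block_in_siegel p q)+
  interpret siegel_center g ?P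
    by unfold_locales (rule P)
  have re: "re_mat (diag_block g ?P \<i>) = diag_block g X 0"
    unfolding X_def by (rule eq_matI) (auto simp: re_mat_def diag_block_def siegel_block_def)
  have im: "im_mat (diag_block g ?P \<i>) = diag_block g Y 1"
    unfolding Y_def by (rule eq_matI) (auto simp: im_mat_def diag_block_def siegel_block_def)
  have W: "?Z - X \<in> carrier_mat g g"
    by simp
  note i = mat_inv_diag_block[OF W det_siegel[OF diff_siegel[OF Z]]] diff_inv(3)[OF Z]
  have "siegel_refl (diag_block g ?P \<i>) (diag_block g ?Z \<i>) = diag_block g (siegel_refl ?P ?Z) \<i>"
    unfolding siegel_refl_def[of "diag_block g ?P \<i>"] re im siegel_refl_eq
    using i by (simp add: diag_block_minus diag_block_mult)
  also have "\<dots> = siegel_embed g (siegel_refl ?P ?Z)"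
    by (simp add: diag_block_def siegel_embed_def)
  finally show ?thesis
    unfolding siegel_block_Suc[OF p] siegel_block_Suc[OF q]
    using siegel_refl_siegel[OF Z] by (simp add: pad_siegel_embed siegel_iff)
qed

text \<open>Read off at the first level containing both points, as for \<open>limit_metric\<close>,
  so that a single function serves all levels.\<close>

definition siegel_symmetry ::
  "(nat \<Rightarrow> nat \<Rightarrow> complex) \<Rightarrow> (nat \<Rightarrow> nat \<Rightarrow> complex) \<Rightarrow> nat \<Rightarrow> nat \<Rightarrow> complex" where
  "siegel_symmetry p q = (let g = LEAST g. p \<in> siegel_level g \<and> q \<in> siegel_level g
     in pad (siegel_refl (siegel_block g p) (siegel_block g q)))"

lemma siegel_symmetry_eq:
  assumes p: "p \<in> siegel_level g" and q: "q \<in> siegel_level g"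
  shows "siegel_symmetry p q = pad (siegel_refl (siegel_block g p) (siegel_block g q))"
proof -
  let ?Q = "\<lambda>g. p \<in> siegel_level g \<and> q \<in> siegel_level g"
  define m where "m = (LEAST g. ?Q g)"
  have m: "?Q m"
    unfolding m_def by (rule LeastI[of ?Q g]) (use assms in simp)
  have "m \<le> g"
    unfolding m_def by (rule Least_le) (use assms in simp)
  then have "pad (siegel_refl (siegel_block g p) (siegel_block g q)) =
      pad (siegel_refl (siegel_block m p) (siegel_block m q))"
  proof (induction g rule: dec_induct)
    case (step n)
    have "p \<in> siegel_level n" "q \<in> siegel_level n"
      using m siegel_level_mono step.hyps by blast+
    from siegel_refl_Suc[OF this] step.IH show ?case
      by simp
  qed simp
  then show ?thesis
    unfolding siegel_symmetry_def m_def Let_def by (rule sym)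
qed

lemma siegel_symmetry_block:
  assumes p: "p \<in> siegel_level g" and q: "q \<in> siegel_level g"
  shows "siegel_symmetry p q \<in> siegel_level g"
    and "siegel_block g (siegel_symmetry p q) = siegel_refl (siegel_block g p) (siegel_block g q)"
proof -
  interpret siegel_center g "siegel_block g p"
    by unfold_locales (rule siegel_block_in_siegel[OF p])
  have r: "siegel_refl (siegel_block g p) (siegel_block g q) \<in> siegel g"
    by (rule siegel_refl_siegel[OF siegel_block_in_siegel(1)[OF q]])
  then show "siegel_symmetry p q \<in> siegel_level g"
    unfolding siegel_symmetry_eq[OF p q] siegel_level_def by (rule imageI)
  show "siegel_block g (siegel_symmetry p q) = siegel_refl (siegel_block g p) (siegel_block g q)"
    unfolding siegel_symmetry_eq[OF p q] by (rule siegel_block_pad) (use r in \<open>simp add: siegel_iff\<close>)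
qed

lemma siegel_symmetry_involutive:
  assumes p: "p \<in> siegel_level g" and q: "q \<in> siegel_level g"
  shows "siegel_symmetry p (siegel_symmetry p q) = q"
proof -
  interpret siegel_center g "siegel_block g p"
    by unfold_locales (rule siegel_block_in_siegel[OF p])
  have "siegel_symmetry p (siegel_symmetry p q) = pad (siegel_block g q)"
    using siegel_symmetry_eq[OF p siegel_symmetry_block(1)[OF p q]] siegel_symmetry_block(2)[OF p q]
      siegel_refl_involutive[OF siegel_block_in_siegel(1)[OF q]] by simp
  then show ?thesis
    by (simp add: siegel_block_in_siegel(2)[OF q])
qed

lemma siegel_symmetry_fixed_iff:
  assumes p: "p \<in> siegel_level g" and q: "q \<in> siegel_level g"
  shows "siegel_symmetry p q = q \<longleftrightarrow> q = p"
proof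
  interpret siegel_center g "siegel_block g p"
    by unfold_locales (rule siegel_block_in_siegel[OF p])
  show "q = p" if "siegel_symmetry p q = q"
  proof -
    have "siegel_block g q = siegel_block g p"
      using siegel_refl_fixed_point[OF siegel_block_in_siegel(1)[OF q]] siegel_symmetry_block(2)[OF p q] that
      by simp
    then show ?thesis
      using siegel_block_in_siegel(2)[OF p] siegel_block_in_siegel(2)[OF q] by simp
  qed
  show "siegel_symmetry p q = q" if "q = p"
    using siegel_symmetry_eq[OF p p] siegel_refl_center siegel_block_in_siegel(2)[OF p] that by simp
qed

lemma siegel_symmetry_symplectic:
  assumes p: "p \<in> siegel_level g"
  obtains M where "M \<in> symplectic_group g"
    "\<And>q. q \<in> siegel_level g \<Longrightarrow> siegel_symmetry p q = pad (symplectic_act g M (siegel_block g q))"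
proof -
  interpret siegel_center g "siegel_block g p"
    by unfold_locales (rule siegel_block_in_siegel[OF p])
  obtain M where M: "M \<in> symplectic_group g"
    "\<And>Z. Z \<in> siegel g \<Longrightarrow> symplectic_act g M Z = siegel_refl (siegel_block g p) Z"
    using siegel_refl_symplectic by blast
  show ?thesis
    using that[OF M(1)] M(2) siegel_symmetry_eq[OF p] siegel_block_in_siegel(1) by simp
qed

lemma has_gateaux_deriv_level_cong:
  assumes p: "p \<in> siegel_level g" and v: "v \<in> cseq (triangle g)"
    and d: "has_gateaux_deriv M (level_map g F) (siegel_coord p) v d"
    and eq: "\<And>q. q \<in> siegel_level g \<Longrightarrow> F q = F' q"
  shows "has_gateaux_deriv M (level_map g F') (siegel_coord p) v d"
  by (rule has_gateaux_deriv_dom_cong[OF d p v]) (simp add: inv_into_siegel_coord siegel_dom_iff eq)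

text \<open>Meant for the inverse of a symmetry, which \<open>holomorphic_isometry\<close> describes
  by \<open>inv_into\<close> and which is compared with the symmetry on the union.\<close>

lemma levelwise_cong:
  assumes F: "levelwise F" and eq: "\<And>q. q \<in> siegel_union \<Longrightarrow> F q = F' q"
  shows "levelwise F'"
proof -
  obtain g0 where g0: "\<And>g. g0 \<le> g \<Longrightarrow> F ` siegel_level g \<subseteq> siegel_level g \<and>
     continuous_on (siegel_level g) F \<and>
     (\<forall>p\<in>siegel_level g. \<forall>v\<in>cseq (triangle g). \<exists>d. has_gateaux_deriv (enat (triangle g)) (level_map g F) (siegel_coord p) v d)"
    using F unfolding levelwise_def by blast
  have eq': "F q = F' q" if "q \<in> siegel_level g" for q g
    by (rule eq[OF siegel_unionI[OF that]])
  show ?thesis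
    unfolding levelwise_def
  proof (intro exI[of _ g0] allI impI conjI ballI)
    fix g
    assume g: "g0 \<le> g"
    show "F' ` siegel_level g \<subseteq> siegel_level g"
      using conjunct1[OF g0[OF g]] eq' by (metis image_cong)
    show "continuous_on (siegel_level g) F'"
      using conjunct1[OF conjunct2[OF g0[OF g]]] by (rule continuous_on_eq) (rule eq')
    fix p v
    assume p: "p \<in> siegel_level g" and v: "v \<in> cseq (triangle g)"
    obtain d where d: "has_gateaux_deriv (enat (triangle g)) (level_map g F) (siegel_coord p) v d"
      using conjunct2[OF conjunct2[OF g0[OF g]]] p v by blast
    show "\<exists>d. has_gateaux_deriv (enat (triangle g))
        (siegel_coord \<circ> F' \<circ> inv_into (siegel_level g) siegel_coord) (siegel_coord p) v d"
      by (rule exI, rule has_gateaux_deriv_level_cong[OF p v d], rule eq')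
  qed
qed

text \<open>All three facts come from one symplectic matrix representing the symmetry on the level.
  For the metric, invariance under that matrix is a hypothesis on \<open>h\<close>.\<close>

lemma siegel_symmetry_level_map:
  assumes p: "p \<in> siegel_level g"
  shows "continuous_on (siegel_level g) (siegel_symmetry p)"
    and "\<And>q v. q \<in> siegel_level g \<Longrightarrow> v \<in> cseq (triangle g) \<Longrightarrow> \<exists>d. has_gateaux_deriv (enat (triangle g))
      (siegel_coord \<circ> siegel_symmetry p \<circ> inv_into (siegel_level g) siegel_coord) (siegel_coord q) v d"
    and "invariant_hermitian_metric g h \<Longrightarrow>
      metric_preserving (siegel_mfd g) h (siegel_mfd g) h (siegel_symmetry p)"
proof -
  obtain M where M: "M \<in> symplectic_group g"
    and eq: "\<And>q. q \<in> siegel_level g \<Longrightarrow> siegel_symmetry p q = pad (symplectic_act g M (siegel_block g q))"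
    using siegel_symmetry_symplectic[OF p] by blast
  obtain A B C D where "symplectic_blocks g A B C D"
    and act: "\<And>Z. symplectic_act g M Z = (A * Z + B) * mat_inv (C * Z + D)"
    using symplectic_group_blocks[OF M] by blast
  then interpret symplectic_action g A B C D
    by unfold_locales
  have act_pad: "(\<lambda>q. pad (symplectic_act g M (siegel_block g q))) = act_pad"
    by (simp add: fun_eq_iff act_pad_def act_def act numer_def denom_def)
  then have eq': "act_pad q = siegel_symmetry p q" if "q \<in> siegel_level g" for q
    using eq[OF that] by metis
  show "continuous_on (siegel_level g) (siegel_symmetry p)"
    using continuous_on_act_pad by (rule continuous_on_eq) (rule eq')
  have deriv: "has_gateaux_deriv (enat (triangle g))
      (siegel_coord \<circ> siegel_symmetry p \<circ> inv_into (siegel_level g) siegel_coord) (siegel_coord q) v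
      (mat_coord g (transpose_mat (mat_inv (denom (siegel_block g q))) *
        (coord_mat g v * mat_inv (denom (siegel_block g q)))))"
    if "q \<in> siegel_level g" "v \<in> cseq (triangle g)" for q v
    by (rule has_gateaux_deriv_level_cong[OF that has_gateaux_deriv_act_pad[OF that]]) (rule eq')
  show "\<exists>d. has_gateaux_deriv (enat (triangle g))
      (siegel_coord \<circ> siegel_symmetry p \<circ> inv_into (siegel_level g) siegel_coord) (siegel_coord q) v d"
    if "q \<in> siegel_level g" "v \<in> cseq (triangle g)" for q v
    by (rule exI, rule deriv[OF that])
  show "metric_preserving (siegel_mfd g) h (siegel_mfd g) h (siegel_symmetry p)"
    if h: "invariant_hermitian_metric g h"
    unfolding metric_preserving_iff_single_chart[OF siegel_mfd_simps(3) siegel_mfd_simps(3)]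
      siegel_mfd_simps model_enat
  proof (intro ballI impI)
    fix q v w
    assume q: "q \<in> siegel_level g" and Fq: "siegel_symmetry p q \<in> siegel_level g"
      and v: "v \<in> cseq (triangle g)" and w: "w \<in> cseq (triangle g)"
    let ?D = "\<lambda>F. gateaux_deriv (enat (triangle g)) (level_map g F) (siegel_coord q)"
    have D: "?D (siegel_symmetry p) u = ?D act_pad u" if "u \<in> cseq (triangle g)" for u
      using gateaux_derivI[OF deriv[OF q that]] gateaux_derivI[OF has_gateaux_deriv_act_pad[OF q that]]
      by simp
    have "metric_preserving (siegel_mfd g) h (siegel_mfd g) h act_pad"
      using h M unfolding invariant_hermitian_metric_def act_pad[symmetric] by blast
    then have "h (siegel_level g, siegel_coord) (act_pad q) (?D act_pad v) (?D act_pad w) =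
        h (siegel_level g, siegel_coord) q v w"
      unfolding metric_preserving_iff_single_chart[OF siegel_mfd_simps(3) siegel_mfd_simps(3)]
        siegel_mfd_simps model_enat
      using q Fq v w eq'[OF q] by metis
    then show "h (siegel_level g, siegel_coord) (siegel_symmetry p q)
        (?D (siegel_symmetry p) v) (?D (siegel_symmetry p) w) = h (siegel_level g, siegel_coord) q v w"
      unfolding D[OF v] D[OF w] eq'[OF q] .
  qed
qed

lemma levelwise_siegel_symmetry:
  assumes "p \<in> siegel_union"
  shows "levelwise (siegel_symmetry p)"
proof -
  obtain g0 where g0: "\<And>g. g0 \<le> g \<Longrightarrow> p \<in> siegel_level g"
    using siegel_unionE[OF assms] by blast
  show ?thesis
    unfolding levelwise_def
  proof (intro exI[of _ g0] allI impI conjI ballI)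
    fix g
    assume "g0 \<le> g"
    note p = g0[OF this]
    show "siegel_symmetry p ` siegel_level g \<subseteq> siegel_level g"
      using siegel_symmetry_block(1)[OF p] by blast
    show "continuous_on (siegel_level g) (siegel_symmetry p)"
      by (rule siegel_symmetry_level_map(1)[OF p])
  qed (rule siegel_symmetry_level_map(2)[OF g0])
qed

lemma siegel_union_common_level:
  assumes "p \<in> siegel_union" "q \<in> siegel_union"
  obtains g where "p \<in> siegel_level g" "q \<in> siegel_level g"
proof -
  obtain g1 where g1: "\<And>g. g1 \<le> g \<Longrightarrow> p \<in> siegel_level g"
    using siegel_unionE[OF assms(1)] by blast
  obtain g2 where g2: "\<And>g. g2 \<le> g \<Longrightarrow> q \<in> siegel_level g"
    using siegel_unionE[OF assms(2)] by blast
  show ?thesis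
    by (rule that[of "max g1 g2"]) (auto intro: g1 g2)
qed

lemma siegel_symmetry_isometry:
  assumes h: "compatible_invariant_metrics h" and p: "p \<in> siegel_union"
  shows "holomorphic_isometry siegel_limit (limit_metric h) (siegel_symmetry p)"
    and "\<And>q. q \<in> siegel_union \<Longrightarrow> siegel_symmetry p (siegel_symmetry p q) = q"
proof -
  have inv: "siegel_symmetry p (siegel_symmetry p q) = q \<and> siegel_symmetry p q \<in> siegel_union"
    if q: "q \<in> siegel_union" for q
  proof -
    obtain g where pq: "p \<in> siegel_level g" "q \<in> siegel_level g"
      by (rule siegel_union_common_level[OF p q])
    show ?thesis
      by (rule conjI[OF siegel_symmetry_involutive[OF pq] siegel_unionI[OF siegel_symmetry_block(1)[OF pq]]])
  qed
  then show "\<And>q. q \<in> siegel_union \<Longrightarrow> siegel_symmetry p (siegel_symmetry p q) = q"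
    by (rule conjunct1)
  have bij: "bij_betw (siegel_symmetry p) siegel_union siegel_union"
    by (rule bij_betw_byWitness[of _ "siegel_symmetry p"]) (use inv in auto)
  \<comment> \<open>An involution is its own inverse.\<close>
  have "siegel_symmetry p q = inv_into siegel_union (siegel_symmetry p) q" if "q \<in> siegel_union" for q
    using bij_betw_inv_into_left[OF bij, of "siegel_symmetry p q"] inv[OF that] by simp
  note inverse = levelwise_cong[OF levelwise_siegel_symmetry[OF p] this]
  obtain g0 where g0: "\<And>g. g0 \<le> g \<Longrightarrow> p \<in> siegel_level g"
    using siegel_unionE[OF p] by blast
  have "metric_preserving siegel_limit (limit_metric h) siegel_limit (limit_metric h) (siegel_symmetry p)"
  proof (rule levelwise_metric_preserving[OF h levelwise_siegel_symmetry[OF p], of "max 1 g0"])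
    fix g
    assume "max 1 g0 \<le> g"
    then show "metric_preserving (siegel_mfd g) (h g) (siegel_mfd g) (h g) (siegel_symmetry p)"
      using h unfolding compatible_invariant_metrics_def
      by (intro siegel_symmetry_level_map(3) g0) auto
  qed
  then show "holomorphic_isometry siegel_limit (limit_metric h) (siegel_symmetry p)"
    unfolding holomorphic_isometry_def
    using bij levelwise_holomorphic[OF levelwise_siegel_symmetry[OF p]] levelwise_holomorphic[OF inverse]
    by (simp add: topspace_direct_limit_topology)
qed

lemma hermitian_symmetric_siegel_limit:
  assumes h: "compatible_invariant_metrics h"
  shows "hermitian_symmetric_space siegel_limit (limit_metric h)"
proof -
  have top: "topspace (mfd_top siegel_limit) = siegel_union"
    by (simp add: topspace_direct_limit_topology)
  have isolated: "isolated_fixed_point (mfd_top siegel_limit) (siegel_symmetry p) p" if p: "p \<in> siegel_union" for p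
  proof -
    have iff: "siegel_symmetry p q = q \<longleftrightarrow> q = p" if q: "q \<in> siegel_union" for q
    proof -
      obtain g where "p \<in> siegel_level g" "q \<in> siegel_level g"
        by (rule siegel_union_common_level[OF p q])
      then show ?thesis
        by (rule siegel_symmetry_fixed_iff)
    qed
    \<comment> \<open>The centre is the only fixed point altogether, so the whole space can serve as
      the isolating neighbourhood.\<close>
    have "openin (mfd_top siegel_limit) siegel_union"
      unfolding top[symmetric] by (rule openin_topspace)
    then show ?thesis
      unfolding isolated_fixed_point_def
      by (intro conjI exI[of _ siegel_union] ballI impI) (simp_all only: iff p)
  qed
  show ?thesis
    unfolding hermitian_symmetric_space_def top
  proof (intro conjI complex_manifold_siegel_limit hermitian_limit_metric[OF h] ballI)
    fix p
    assume p: "p \<in> siegel_union"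
    show "\<exists>F. holomorphic_isometry siegel_limit (limit_metric h) F \<and>
        (\<forall>q\<in>siegel_union. F (F q) = q) \<and> isolated_fixed_point (mfd_top siegel_limit) F p"
      by (rule exI[of _ "siegel_symmetry p"])
        (intro conjI ballI siegel_symmetry_isometry[OF h p] isolated[OF p])
  qed
qed

theorem proposition3p1:
  shows "(\<exists>h. compatible_invariant_metrics h) \<and>
    (\<forall>h. compatible_invariant_metrics h \<longrightarrow>
       infinite_dimensional siegel_limit \<and>
       hermitian_symmetric_space siegel_limit (limit_metric h))"
  using compatible_siegel_form hermitian_symmetric_siegel_limit
  by (auto simp: infinite_dimensional_def)

end
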